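(* Let $0<s<1$, $\nu=\frac{1-s^2}{2s}$, $\alpha=\frac{1+s^2}{4s}$, and let $n\ge0$ be an integer. For $x\in\mathbb{R}$, $z\in\mathbb{C}$ let $$S^s_n(x,z)=\sum_{m=0}^{+\infty}g^\nu_m(x)\,\psi^s_{m,n}(z,\overline{z}).$$ Then $$S^s_n(x,z)=\left(\frac{\nu}{\pi s}\right)^{\frac14}\left(\frac{1-s^2}{2\pi s\,\nu^nn!}\right)^{1/2}e^{-\frac{1}{2s}z^2-\frac{\nu(1-s)}{2s}x^2+\frac{\nu\sqrt{2s}}{s}xz}\;I_n^{\nu,-\frac{\nu}{2}}\left(z,\overline{z}\,\Big|\,\frac{\nu\sqrt{2s}}{s}x\right).$$ Moreover, the transform $$\mathscr{S}^s_nf(z)=\int_{\mathbb{R}}f(x)\,S^s_n(x,z)\,e^{-\nu x^2}\,dx$$ defines an isometric transform from $L^{2,\nu}(\mathbb{R})$ onto $\mathcal{X}_{n,s}(\mathbb{C})$.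
   Context: $d\lambda$ is Lebesgue measure on $\mathbb{C}\equiv\mathbb{R}^2$; $\partial_z,\partial_{\overline z}$ are the Wirtinger derivatives. Throughout $0<s<1$, $\nu=\frac{1-s^2}{2s}$, $\alpha=\frac{1+s^2}{4s}$. Put $\omega_s(z)=e^{\alpha(z^2+\overline{z}^2)-\nu|z|^2}$. Let $\Delta_\nu=-\partial_z\partial_{\overline z}+\nu\overline{z}\,\partial_{\overline z}$, and let $\mathcal{F}^{2,\nu}_n(\mathbb{C})=\{F\in L^2(\mathbb{C},e^{-\nu|z|^2}d\lambda):\Delta_\nu F=n\nu F\}$ (such eigenfunctions are smooth by ellipticity). Then $\mathcal{X}_{n,s}(\mathbb{C})=\{z\mapsto e^{-\alpha z^2}F(z):F\in\mathcal{F}^{2,\nu}_n(\mathbb{C})\}$, a subspace of $L^2(\mathbb{C},\omega_s\,d\lambda)$ with its inner product. $H_m$ is the (physicists') Hermite polynomial, for real or complex argument: $H_m(z)=m!\sum_{k=0}^{\lfloor m/2\rfloor}\frac{(-1)^k}{k!}\frac{(2z)^{m-2k}}{(m-2k)!}$. For smooth $g$ on $\mathbb{C}$ and $\gamma\in\mathbb{R}$, $\nabla_{\nu,\gamma}g=-\partial_zg+\nu\overline{z}g-2\gamma zg$, with $n$-th iterate $\nabla^n_{\nu,\gamma}$. For $m=0,1,2,\dots$, $$\psi^s_{m,n}(z,\overline{z})=\left(\frac{1-s}{\pi\nu^nn!\sqrt{s}}\right)^{1/2}\left(\frac{1-s}{1+s}\right)^{m/2}\frac{e^{-z^2/2}}{\sqrt{2^mm!}}\left(\nabla^n_{\nu,\alpha-\frac12}H_m\right)(z).$$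 $L^{2,\nu}(\mathbb{R})=L^2(\mathbb{R},e^{-\nu x^2}dx)$ (complex-valued functions), with orthonormal basis $g^\nu_m(x)=\left(\frac{\nu}{\pi}\right)^{1/4}\frac{H_m(\sqrt{\nu}x)}{\sqrt{2^mm!}}$, $m\ge 0$. For $a>0$, $b\in\mathbb{R}$, $c\in\mathbb{C}$, $$I_n^{a,b}(z,\overline{z}|c)=(-1)^ne^{a|z|^2-bz^2-cz}\,\partial_z^n\left(e^{-a|z|^2+bz^2+cz}\right).$$ *)

theory Defs
  imports "HOL-Analysis.Analysis"
begin

section \<open>Wirtinger derivatives and smooth functions on the complex plane\<close>

definition partial_x :: "(complex \<Rightarrow> complex) \<Rightarrow> complex \<Rightarrow> complex" where
  "partial_x f z = frechet_derivative f (at z) 1"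

definition partial_y :: "(complex \<Rightarrow> complex) \<Rightarrow> complex \<Rightarrow> complex" where
  "partial_y f z = frechet_derivative f (at z) \<i>"

definition wirt :: "(complex \<Rightarrow> complex) \<Rightarrow> complex \<Rightarrow> complex" where
  "wirt f z = (partial_x f z - \<i> * partial_y f z) / 2"

definition wirt_bar :: "(complex \<Rightarrow> complex) \<Rightarrow> complex \<Rightarrow> complex" where
  "wirt_bar f z = (partial_x f z + \<i> * partial_y f z) / 2"

text \<open>Smoothness is in the real sense (for the plane as a two-dimensional real space):
  differentiability below is real Frechet differentiability, not holomorphy.\<close>

fun Ck :: "nat \<Rightarrow> (complex \<Rightarrow> complex) \<Rightarrow> bool" where
  "Ck 0 f \<longleftrightarrow> continuous_on UNIV f"
| "Ck (Suc k) f \<longleftrightarrow>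
     (\<forall>z. f differentiable (at z)) \<and> Ck k (partial_x f) \<and> Ck k (partial_y f)"

definition smooth :: "(complex \<Rightarrow> complex) \<Rightarrow> bool" where
  "smooth f \<longleftrightarrow> (\<forall>k. Ck k f)"

section \<open>Square-integrable functions\<close>

text \<open>These are functions rather than classes modulo almost-everywhere equality.\<close>

definition L2 :: "'a measure \<Rightarrow> ('a \<Rightarrow> complex) set" where
  "L2 M = {f \<in> borel_measurable M. integrable M (\<lambda>x. (norm (f x))\<^sup>2)}"

definition l2_inner :: "'a measure \<Rightarrow> ('a \<Rightarrow> complex) \<Rightarrow> ('a \<Rightarrow> complex) \<Rightarrow> complex" where
  "l2_inner M f g = (LINT x|M. f x * cnj (g x))"

definition l2_norm :: "'a measure \<Rightarrow> ('a \<Rightarrow> complex) \<Rightarrow> real" where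
  "l2_norm M f = sqrt (Re (l2_inner M f f))"

section \<open>Parameters and weighted measures\<close>

definition nu :: "real \<Rightarrow> real" where
  "nu s = (1 - s\<^sup>2) / (2 * s)"

definition alpha :: "real \<Rightarrow> real" where
  "alpha s = (1 + s\<^sup>2) / (4 * s)"

definition gauss_real :: "real \<Rightarrow> real measure" where
  "gauss_real \<nu> = density lebesgue (\<lambda>x. ennreal (exp (- \<nu> * x\<^sup>2)))"

definition gauss_complex :: "real \<Rightarrow> complex measure" where
  "gauss_complex \<nu> = density lebesgue (\<lambda>z. ennreal (exp (- \<nu> * (norm z)\<^sup>2)))"

text \<open>The number \<open>z\<^sup>2 + (cnj z)\<^sup>2\<close> is real, so taking its real part is only a type conversion.\<close>

definition omega :: "real \<Rightarrow> complex \<Rightarrow> real" where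
  "omega s z = exp (alpha s * Re (z\<^sup>2 + (cnj z)\<^sup>2) - nu s * (norm z)\<^sup>2)"

definition omega_measure :: "real \<Rightarrow> complex measure" where
  "omega_measure s = density lebesgue (\<lambda>z. ennreal (omega s z))"

section \<open>The spaces of eigenfunctions\<close>

definition magnetic_laplacian :: "real \<Rightarrow> (complex \<Rightarrow> complex) \<Rightarrow> complex \<Rightarrow> complex" where
  "magnetic_laplacian \<nu> F z =
     - wirt (wirt_bar F) z + complex_of_real \<nu> * cnj z * wirt_bar F z"

text \<open>By ellipticity every square-integrable distributional eigenfunction has a unique smooth
  representative; the space consists of these representatives.\<close>

definition Fock :: "real \<Rightarrow> nat \<Rightarrow> (complex \<Rightarrow> complex) set" where
  "Fock \<nu> n = {F \<in> L2 (gauss_complex \<nu>). smooth F \<and>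
     (\<forall>z. magnetic_laplacian \<nu> F z = of_nat n * complex_of_real \<nu> * F z)}"

definition X_space :: "nat \<Rightarrow> real \<Rightarrow> (complex \<Rightarrow> complex) set" where
  "X_space n s = {\<lambda>z. exp (- complex_of_real (alpha s) * z\<^sup>2) * F z | F. F \<in> Fock (nu s) n}"

section \<open>Hermite polynomials and the special functions\<close>

definition hermite :: "nat \<Rightarrow> 'a::field_char_0 \<Rightarrow> 'a" where
  "hermite m z = fact m *
     (\<Sum>k\<le>m div 2. (-1) ^ k / fact k * ((2 * z) ^ (m - 2 * k) / fact (m - 2 * k)))"

definition nabla :: "real \<Rightarrow> real \<Rightarrow> (complex \<Rightarrow> complex) \<Rightarrow> complex \<Rightarrow> complex" where
  "nabla \<nu> \<gamma> g z =
     - wirt g z + complex_of_real \<nu> * cnj z * g z - 2 * complex_of_real \<gamma> * z * g z"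

definition psi :: "real \<Rightarrow> nat \<Rightarrow> nat \<Rightarrow> complex \<Rightarrow> complex" where
  "psi s m n z =
     complex_of_real (sqrt ((1 - s) / (pi * nu s ^ n * fact n * sqrt s))
       * ((1 - s) / (1 + s)) powr (real m / 2))
     * (exp (- z\<^sup>2 / 2) / complex_of_real (sqrt (2 ^ m * fact m)))
     * (nabla (nu s) (alpha s - 1 / 2) ^^ n) (hermite m) z"

definition g_fun :: "real \<Rightarrow> nat \<Rightarrow> real \<Rightarrow> real" where
  "g_fun \<nu> m x = (\<nu> / pi) powr (1 / 4) * (hermite m (sqrt \<nu> * x) / sqrt (2 ^ m * fact m))"

definition I_poly :: "nat \<Rightarrow> real \<Rightarrow> real \<Rightarrow> complex \<Rightarrow> complex \<Rightarrow> complex" where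
  "I_poly n a b c z =
     (-1) ^ n * exp (complex_of_real (a * (norm z)\<^sup>2) - complex_of_real b * z\<^sup>2 - c * z)
     * (wirt ^^ n)
         (\<lambda>w. exp (- complex_of_real (a * (norm w)\<^sup>2) + complex_of_real b * w\<^sup>2 + c * w)) z"

definition S_kernel :: "real \<Rightarrow> nat \<Rightarrow> real \<Rightarrow> complex \<Rightarrow> complex" where
  "S_kernel s n x z = (\<Sum>m. complex_of_real (g_fun (nu s) m x) * psi s m n z)"

definition S_transform :: "real \<Rightarrow> nat \<Rightarrow> (real \<Rightarrow> complex) \<Rightarrow> complex \<Rightarrow> complex" where
  "S_transform s n f z =
     (LINT x|lebesgue. f x * S_kernel s n x z * complex_of_real (exp (- nu s * x\<^sup>2)))"

end

theory Submission
  imports Defs "HOL-Complex_Analysis.Complex_Analysis" "HOL-Probability.Probability"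
begin

text \<open>Write \<open>A = - \<partial> + \<nu> cnj z\<close> for the adjoint of the Cauchy-Riemann operator \<open>D = \<partial>/\<partial> cnj z\<close> in the Gaussian
  space; the magnetic Laplacian is \<open>A D\<close>. Mehler's formula shows that the kernel \<open>S\<^sub>n(x, \<cdot>)\<close> is
  \<open>exp (- \<alpha> z\<^sup>2) A\<^sup>n K(x, \<cdot>)\<close> divided by the square root of \<open>n! \<nu>\<^sup>n\<close>, where \<open>K\<close> is a Segal-Bargmann kernel
  independent of \<open>n\<close>. The transform with kernel \<open>K\<close> sends an orthonormal basis of rescaled Hermite
  functions to the normalised monomials, so it is an isometry onto the entire functions in the
  Gaussian space. Since \<open>D A - A D = \<nu>\<close>, the operator \<open>A\<^sup>n\<close> maps these onto the \<open>n\<close>-th eigenspace and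
  multiplies squared norms by \<open>n! \<nu>\<^sup>n\<close>; that \<open>A F\<close> and \<open>D F\<close> are square-integrable for an eigenfunction \<open>F\<close>
  comes from integrating by parts against a cutoff.\<close>

section \<open>Wirtinger calculus\<close>

text \<open>The defining series of the kernel runs over \<open>g_fun (nu s) m\<close>, but isometry
  and surjectivity are not read off from it: that would need orthogonality and completeness of the
  functions \<open>psi s m n\<close>. Its sum in closed form has a second expansion, by the Hermite
  generating function, into products of \<open>hermite_fun (nu s) (nu s / s) m x\<close> and the
  normalised monomial of degree m, and there both factors have elementary theories. The scale
  \<nu>/s is the one for which the generating function reproduces Mehler's kernel. The operator
  \<open>nabla \<nu> \<gamma>\<close> is \<open>nabla \<nu> 0\<close> conjugated by exp (\<gamma>
  z^2). This explains the shift \<alpha> - 1/2 in \<open>psi\<close>: the prefactor exp (- z^2/2)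
  completes it to the exp (- \<alpha> z^2) of \<open>X_space\<close>. Powers of \<open>A\<close>
  must be exchanged with infinite sums. On entire functions they involve only complex derivatives
  and multiplication by \<open>cnj z\<close>, so Cauchy's estimate suffices. Completeness of the
  Hermite functions also comes from the kernel: at imaginary z it is a Fourier exponential times a
  Gaussian in x, so a function orthogonal to all of them has zero Fourier transform.\<close>

definition has_wirt :: "(complex \<Rightarrow> complex) \<Rightarrow> complex \<Rightarrow> complex \<Rightarrow> complex \<Rightarrow> bool" where
  "has_wirt f a b z \<longleftrightarrow> (f has_derivative (\<lambda>h. a * h + b * cnj h)) (at z)"

lemma has_wirt_differentiable: "has_wirt f a b z \<Longrightarrow> f differentiable (at z)"
  unfolding has_wirt_def differentiable_def by blast

lemma has_wirt_frechet:
  assumes "has_wirt f a b z"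
  shows "frechet_derivative f (at z) = (\<lambda>h. a * h + b * cnj h)"
  using assms unfolding has_wirt_def by (rule frechet_derivative_at[symmetric])

lemma has_wirt_partial:
  assumes "has_wirt f a b z"
  shows "partial_x f z = a + b" "partial_y f z = \<i> * (a - b)"
  unfolding partial_x_def partial_y_def has_wirt_frechet[OF assms]
  by (simp_all add: algebra_simps)

lemma has_wirt_eqs:
  assumes "has_wirt f a b z"
  shows "wirt f z = a" "wirt_bar f z = b"
proof -
  have i: "\<i> * (\<i> * c) = - c" for c :: complex
    by (simp add: mult.assoc[symmetric])
  show "wirt f z = a" "wirt_bar f z = b"
    unfolding wirt_def wirt_bar_def has_wirt_partial[OF assms] i by (simp_all add: field_simps)
qed

text \<open>Every real-linear map of the plane is \<open>a * h + b * cnj h\<close> for exactly one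
  pair, and the Wirtinger derivatives are that pair. Carrying both coefficients in
  \<open>has_wirt\<close> makes product and chain rules look like the complex ones.\<close>

lemma differentiable_has_wirt:
  assumes "f differentiable (at z)"
  shows "has_wirt f (wirt f z) (wirt_bar f z) z"
proof -
  have d: "(f has_derivative frechet_derivative f (at z)) (at z)"
    using assms by (simp add: frechet_derivative_works)
  then have l: "linear (frechet_derivative f (at z))"
    by (rule has_derivative_linear)
  have "frechet_derivative f (at z) h = wirt f z * h + wirt_bar f z * cnj h" for h
  proof -
    have "frechet_derivative f (at z) h = frechet_derivative f (at z) (Re h *\<^sub>R 1 + Im h *\<^sub>R \<i>)"
      by (rule arg_cong[of _ _ "frechet_derivative f (at z)"]) (simp add: complex_eq_iff)
    also have "\<dots> = Re h *\<^sub>R partial_x f z + Im h *\<^sub>R partial_y f z"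
      unfolding partial_x_def partial_y_def by (simp only: linear_add[OF l] linear_scale[OF l])
    also have "\<dots> = (partial_x f z * (h + cnj h) - \<i> * partial_y f z * (h - cnj h)) / 2"
      unfolding complex_add_cnj complex_diff_cnj by (simp add: scaleR_conv_of_real)
    also have "\<dots> = wirt f z * h + wirt_bar f z * cnj h"
      unfolding wirt_def wirt_bar_def by (simp add: algebra_simps add_divide_distrib diff_divide_distrib)
    finally show ?thesis .
  qed
  then have "frechet_derivative f (at z) = (\<lambda>h. wirt f z * h + wirt_bar f z * cnj h)"
    by blast
  with d show ?thesis
    unfolding has_wirt_def by simp
qed

lemma has_wirt_const: "has_wirt (\<lambda>_. c) 0 0 z"
  unfolding has_wirt_def by simp

lemma has_wirt_id: "has_wirt (\<lambda>z. z) 1 0 z"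
  unfolding has_wirt_def by simp

lemma has_wirt_cnj:
  assumes "has_wirt f a b z"
  shows "has_wirt (\<lambda>z. cnj (f z)) (cnj b) (cnj a) z"
  using has_derivative_cnj[OF assms[unfolded has_wirt_def]]
  unfolding has_wirt_def by (simp add: add.commute)

lemma has_wirt_add:
  assumes "has_wirt f a b z" "has_wirt g c d z"
  shows "has_wirt (\<lambda>z. f z + g z) (a + c) (b + d) z"
  using has_derivative_add[OF assms[unfolded has_wirt_def]]
  unfolding has_wirt_def by (simp add: algebra_simps)

lemma has_wirt_minus:
  assumes "has_wirt f a b z"
  shows "has_wirt (\<lambda>z. - f z) (- a) (- b) z"
  using has_derivative_minus[OF assms[unfolded has_wirt_def]]
  unfolding has_wirt_def by (simp add: algebra_simps)

lemma has_wirt_mult: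
  assumes "has_wirt f a b z" "has_wirt g c d z"
  shows "has_wirt (\<lambda>z. f z * g z) (a * g z + f z * c) (b * g z + f z * d) z"
  using has_derivative_mult[OF assms[unfolded has_wirt_def]]
  unfolding has_wirt_def by (simp add: algebra_simps)

lemma has_wirt_compose_holomorphic:
  assumes "has_wirt f a b z" "(g has_field_derivative g') (at (f z))"
  shows "has_wirt (\<lambda>z. g (f z)) (g' * a) (g' * b) z"
  using has_derivative_compose[OF assms(1)[unfolded has_wirt_def]
      assms(2)[unfolded has_field_derivative_def]]
  unfolding has_wirt_def by (simp add: algebra_simps)

lemma has_wirt_holomorphic:
  assumes "(g has_field_derivative g') (at z)"
  shows "has_wirt g g' 0 z"
  using has_wirt_compose_holomorphic[OF has_wirt_id assms] by simp

text \<open>The squared norm is z times \<open>cnj z\<close>, with Wirtinger derivatives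
  \<open>cnj z\<close> and z. Taking the profile as a function of the squared norm covers both the
  Gaussian weight and the cutoff.\<close>

lemma has_wirt_radial:
  fixes p :: "real \<Rightarrow> real"
  assumes "(p has_real_derivative d) (at ((norm z)\<^sup>2))"
  shows "has_wirt (\<lambda>z. complex_of_real (p ((norm z)\<^sup>2))) (d * cnj z) (d * z) z"
proof -
  have 1: "((\<lambda>z::complex. (norm z)\<^sup>2) has_derivative (\<lambda>h. 2 * (z \<bullet> h))) (at z)"
    unfolding power2_norm_eq_inner
    by (auto intro!: derivative_eq_intros simp: inner_commute)
  have "((\<lambda>z. complex_of_real (p ((norm z)\<^sup>2))) has_derivative
      (\<lambda>h. complex_of_real (d * (2 * (z \<bullet> h))))) (at z)"
    using has_derivative_of_real[OF has_derivative_compose[OF 1 assms[unfolded has_field_derivative_def]]]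
    by simp
  moreover have "complex_of_real (d * (2 * (z \<bullet> h))) = d * cnj z * h + d * z * cnj h" for h
    by (simp add: complex_eq_iff inner_complex_def algebra_simps)
  ultimately show ?thesis
    unfolding has_wirt_def by simp
qed

text \<open>Lets the calculus rules compute the coefficients in raw form and leaves their
  simplification to the end.\<close>

lemma has_wirt_unique:
  assumes "has_wirt f a b z" "a = a'" "b = b'"
  shows "has_wirt f a' b' z"
  using assms by simp

section \<open>Smooth functions\<close>

lemma Ck_Suc_imp: "Ck (Suc k) f \<Longrightarrow> Ck k f"
proof (induction k arbitrary: f)
  case 0
  then have "f differentiable_on UNIV"
    by (simp add: differentiable_on_def)
  then show ?case
    by (simp add: differentiable_imp_continuous_on)
next
  case (Suc k)
  show ?case
    using Suc.prems Suc.IH[of "partial_x f"] Suc.IH[of "partial_y f"]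
    unfolding Ck.simps(2)[of k] Ck.simps(2)[of "Suc k"] by blast
qed

lemma Ck_add:
  assumes "Ck k f" "Ck k g"
  shows "Ck k (\<lambda>z. f z + g z)"
  using assms
proof (induction k arbitrary: f g)
  case 0
  then show ?case
    by (auto intro: continuous_intros)
next
  case (Suc k)
  have e: "has_wirt (\<lambda>z. f z + g z) (wirt f z + wirt g z) (wirt_bar f z + wirt_bar g z) z" for z
    using Suc.prems by (intro has_wirt_add differentiable_has_wirt) auto
  have "partial_x (\<lambda>z. f z + g z) z = partial_x f z + partial_x g z"
       "partial_y (\<lambda>z. f z + g z) z = partial_y f z + partial_y g z" for z
    unfolding has_wirt_partial[OF e]
    by (auto simp: wirt_def wirt_bar_def field_simps)
  then have "partial_x (\<lambda>z. f z + g z) = (\<lambda>z. partial_x f z + partial_x g z)"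
       "partial_y (\<lambda>z. f z + g z) = (\<lambda>z. partial_y f z + partial_y g z)"
    by blast+
  then show ?case
    using Suc.prems Suc.IH has_wirt_differentiable[OF e] by simp
qed

lemma Ck_mult:
  assumes "Ck k f" "Ck k g"
  shows "Ck k (\<lambda>z. f z * g z)"
  using assms
proof (induction k arbitrary: f g)
  case 0
  then show ?case
    by (auto intro: continuous_intros)
next
  case (Suc k)
  have e: "has_wirt (\<lambda>z. f z * g z) (wirt f z * g z + f z * wirt g z)
      (wirt_bar f z * g z + f z * wirt_bar g z) z" for z
    using Suc.prems by (intro has_wirt_mult differentiable_has_wirt) auto
  have "partial_x (\<lambda>z. f z * g z) z = partial_x f z * g z + f z * partial_x g z"
       "partial_y (\<lambda>z. f z * g z) z = partial_y f z * g z + f z * partial_y g z" for z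
    unfolding has_wirt_partial[OF e]
    by (auto simp: wirt_def wirt_bar_def field_simps)
  then have "partial_x (\<lambda>z. f z * g z) = (\<lambda>z. partial_x f z * g z + f z * partial_x g z)"
       "partial_y (\<lambda>z. f z * g z) = (\<lambda>z. partial_y f z * g z + f z * partial_y g z)"
    by blast+
  moreover have "Ck k f" "Ck k g"
    using Suc.prems Ck_Suc_imp by blast+
  ultimately show ?case
    using Suc.prems has_wirt_differentiable[OF e] by (auto intro!: Ck_add Suc.IH)
qed

lemma Ck_const: "Ck k (\<lambda>_. c)"
proof (induction k arbitrary: c)
  case (Suc k)
  have "partial_x (\<lambda>_. c) = (\<lambda>_. 0)" "partial_y (\<lambda>_. c) = (\<lambda>_. 0)"
    using has_wirt_partial[OF has_wirt_const] by auto
  with Suc show ?case by simp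
qed simp

lemma Ck_holomorphic:
  assumes "f holomorphic_on UNIV"
  shows "Ck k f"
  using assms
proof (induction k arbitrary: f)
  case 0
  then show ?case by (simp add: holomorphic_on_imp_continuous_on)
next
  case (Suc k)
  have e: "has_wirt f (deriv f z) 0 z" for z
    using Suc.prems by (intro has_wirt_holomorphic holomorphic_derivI[of f UNIV]) auto
  have "deriv f holomorphic_on UNIV"
    using Suc.prems by (intro holomorphic_deriv) auto
  then have "Ck k (deriv f)" "Ck k (\<lambda>z. \<i> * deriv f z)"
    using Suc.IH by (auto intro!: Ck_mult Ck_const)
  moreover have "partial_x f = deriv f" "partial_y f = (\<lambda>z. \<i> * deriv f z)"
    using has_wirt_partial[OF e] by auto
  ultimately show ?case
    using has_wirt_differentiable[OF e] by simp
qed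

lemma Ck_cnj: "Ck k cnj"
proof (cases k)
  case 0
  then show ?thesis by (auto intro: continuous_intros)
next
  case (Suc l)
  have e: "has_wirt cnj 0 1 z" for z
    using has_wirt_cnj[OF has_wirt_id] by simp
  have "partial_x cnj = (\<lambda>z. 1)" "partial_y cnj = (\<lambda>z. - \<i>)"
    using has_wirt_partial[OF e] by auto
  with Suc show ?thesis
    using has_wirt_differentiable[OF e] by (simp add: Ck_const)
qed

lemma smooth_add: "smooth f \<Longrightarrow> smooth g \<Longrightarrow> smooth (\<lambda>z. f z + g z)"
  unfolding smooth_def using Ck_add by blast

lemma smooth_mult: "smooth f \<Longrightarrow> smooth g \<Longrightarrow> smooth (\<lambda>z. f z * g z)"
  unfolding smooth_def using Ck_mult by blast

lemma smooth_const: "smooth (\<lambda>_. c)"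
  unfolding smooth_def using Ck_const by blast

lemma smooth_holomorphic: "f holomorphic_on UNIV \<Longrightarrow> smooth f"
  unfolding smooth_def using Ck_holomorphic by blast

lemma smooth_cnj: "smooth cnj"
  unfolding smooth_def using Ck_cnj by blast

lemma smooth_differentiable: "smooth f \<Longrightarrow> f differentiable (at z)"
  unfolding smooth_def using Ck.simps(2) by blast

lemma smooth_continuous: "smooth f \<Longrightarrow> continuous_on UNIV f"
  unfolding smooth_def using Ck.simps(1) by blast

lemma smooth_has_wirt: "smooth f \<Longrightarrow> has_wirt f (wirt f z) (wirt_bar f z) z"
  by (intro differentiable_has_wirt smooth_differentiable)

lemma smooth_partial: "smooth f \<Longrightarrow> smooth (partial_x f)" "smooth f \<Longrightarrow> smooth (partial_y f)"
  unfolding smooth_def by (metis Ck.simps(2))+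

lemma smooth_wirt: "smooth f \<Longrightarrow> smooth (wirt f)"
proof -
  assume f: "smooth f"
  have "wirt f = (\<lambda>z. (1/2) * partial_x f z + (- \<i>/2) * partial_y f z)"
    by (rule ext) (simp add: wirt_def field_simps)
  then show ?thesis
    by (simp only:) (intro smooth_add smooth_mult smooth_const smooth_partial f)
qed

lemma smooth_wirt_bar: "smooth f \<Longrightarrow> smooth (wirt_bar f)"
proof -
  assume f: "smooth f"
  have "wirt_bar f = (\<lambda>z. (1/2) * partial_x f z + (\<i>/2) * partial_y f z)"
    by (rule ext) (simp add: wirt_bar_def field_simps)
  then show ?thesis
    by (simp only:) (intro smooth_add smooth_mult smooth_const smooth_partial f)
qed

lemma smooth_nabla: "smooth f \<Longrightarrow> smooth (nabla \<nu> \<gamma> f)"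
proof -
  assume f: "smooth f"
  have "nabla \<nu> \<gamma> f = (\<lambda>z. (-1) * wirt f z + complex_of_real \<nu> * cnj z * f z
      + (- 2 * complex_of_real \<gamma>) * z * f z)"
    by (rule ext) (simp add: nabla_def field_simps)
  then show ?thesis
    by (simp only:) (intro smooth_add smooth_mult smooth_const smooth_wirt smooth_cnj
        smooth_holomorphic[of "\<lambda>z. z"] f holomorphic_intros)
qed

lemma smooth_nabla_funpow: "smooth f \<Longrightarrow> smooth ((nabla \<nu> \<gamma> ^^ n) f)"
  by (induction n) (auto intro: smooth_nabla)

text \<open>Symmetry of the second derivative, by evaluating the second difference over a small square
  twice with the mean value theorem.\<close>

lemma mvt_along:
  fixes f :: "complex \<Rightarrow> complex" and h :: real
  assumes "\<And>z. f differentiable (at z)" "0 < h"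
    and L: "bounded_linear (L :: complex \<Rightarrow> real)"
  shows "\<exists>t. 0 < t \<and> t < h \<and>
    L (f (z + of_real h * v)) - L (f z) = h * L (frechet_derivative f (at (z + of_real t * v)) v)"
proof -
  have "((\<lambda>t. L (f (z + of_real t * v))) has_real_derivative
      L (frechet_derivative f (at (z + of_real t * v)) v)) (at t)" for t :: real
  proof -
    have "(f has_derivative frechet_derivative f (at (z + of_real t * v))) (at (z + of_real t * v))"
      using assms(1) by (simp add: frechet_derivative_works)
    moreover have "((\<lambda>t. z + of_real t * v) has_derivative (\<lambda>r. of_real r * v)) (at t)"
      by (auto intro!: derivative_eq_intros)
    ultimately have "((\<lambda>t. f (z + of_real t * v)) has_derivative
        (\<lambda>r. frechet_derivative f (at (z + of_real t * v)) (of_real r * v))) (at t)"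
      using has_derivative_compose by blast
    then have "((\<lambda>t. L (f (z + of_real t * v))) has_derivative
        (\<lambda>r. L (frechet_derivative f (at (z + of_real t * v)) (of_real r * v)))) (at t)"
      using bounded_linear.has_derivative[OF L] by blast
    moreover have "L (frechet_derivative f (at (z + of_real t * v)) (of_real r * v))
        = L (frechet_derivative f (at (z + of_real t * v)) v) * r" for r
    proof -
      have "linear (frechet_derivative f (at (z + of_real t * v)))"
        using assms(1) by (rule linear_frechet_derivative)
      then have "frechet_derivative f (at (z + of_real t * v)) (r *\<^sub>R v)
        = r *\<^sub>R frechet_derivative f (at (z + of_real t * v)) v"
        by (rule linear_scale)
      then show ?thesis
        using linear_scale[OF bounded_linear.linear[OF L]] by (simp add: scaleR_conv_of_real)
    qed
    ultimately show ?thesis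
      by (simp add: has_field_derivative_def)
  qed
  from MVT2[OF \<open>0 < h\<close> this] show ?thesis
    by (auto simp: algebra_simps)
qed

text \<open>The mean value theorem is applied to the increment \<open>f (u + h w) - f u\<close> in
  direction \<open>v\<close>, then to \<open>g\<close> in direction \<open>w\<close>. It fails for
  complex values, hence the real functional \<open>L\<close>.\<close>

lemma second_difference:
  fixes f :: "complex \<Rightarrow> complex"
  assumes d: "\<And>z. f differentiable (at z)"
    and g: "\<And>z. g z = frechet_derivative f (at z) v" and dg: "\<And>z. g differentiable (at z)"
    and L: "bounded_linear (L :: complex \<Rightarrow> real)" and h: "0 < h"
  shows "\<exists>s t. 0 < s \<and> s < h \<and> 0 < t \<and> t < h \<and>
    L (f (z + of_real h * v + of_real h * w)) - L (f (z + of_real h * w))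
      - L (f (z + of_real h * v)) + L (f z)
    = h * (h * L (frechet_derivative g (at (z + of_real s * v + of_real t * w)) w))"
proof -
  let ?F = "\<lambda>u. f (u + of_real h * w) - f u"
  have F: "(?F has_derivative (\<lambda>r. frechet_derivative f (at (u + of_real h * w)) r
      - frechet_derivative f (at u) r)) (at u)" for u
  proof -
    have "((\<lambda>u. f (u + of_real h * w)) has_derivative
        (\<lambda>r. frechet_derivative f (at (u + of_real h * w)) r)) (at u)"
    proof -
      have "((\<lambda>u. u + of_real h * w) has_derivative (\<lambda>r. r)) (at u)"
        by (auto intro!: derivative_eq_intros)
      moreover have "(f has_derivative frechet_derivative f (at (u + of_real h * w))) (at (u + of_real h * w))"
        using d by (simp add: frechet_derivative_works)
      ultimately show ?thesis
        by (rule has_derivative_compose)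
    qed
    then show ?thesis
      using d by (auto intro!: derivative_intros simp: frechet_derivative_works)
  qed
  then have Fd: "?F differentiable (at u)" for u
    unfolding differentiable_def by blast
  obtain s where s: "0 < s" "s < h" "L (?F (z + of_real h * v)) - L (?F z)
      = h * L (frechet_derivative ?F (at (z + of_real s * v)) v)"
    using mvt_along[of ?F h L z v] Fd h L by blast
  have e: "frechet_derivative ?F (at (z + of_real s * v)) v
      = g (z + of_real s * v + of_real h * w) - g (z + of_real s * v)"
    unfolding frechet_derivative_at[OF F, symmetric] by (simp add: g)
  obtain t where t: "0 < t" "t < h"
    "L (g (z + of_real s * v + of_real h * w)) - L (g (z + of_real s * v))
      = h * L (frechet_derivative g (at (z + of_real s * v + of_real t * w)) w)"
    using mvt_along[of g h L "z + of_real s * v" w] dg h L by blast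
  note lin = linear_diff[OF bounded_linear.linear[OF L]]
  show ?thesis
    using s(1,2) t(1,2) s(3)[unfolded e lin t(3)]
    by (intro exI[of _ s] exI[of _ t]) simp
qed

text \<open>The same second difference, evaluated in both orders, equates the two mixed derivatives
  at two different points near \<open>z\<close>. By continuity a gap at \<open>z\<close> would
  persist on a small square.\<close>

lemma partial_commute_component:
  assumes f: "smooth f" and L: "bounded_linear (L :: complex \<Rightarrow> real)"
  shows "L (partial_y (partial_x f) z) = L (partial_x (partial_y f) z)"
proof (rule ccontr)
  let ?a = "\<lambda>z. L (partial_y (partial_x f) z)" and ?b = "\<lambda>z. L (partial_x (partial_y f) z)"
  assume ne: "?a z \<noteq> ?b z"
  define e where "e = \<bar>?a z - ?b z\<bar> / 2"
  have e: "e > 0" using ne by (simp add: e_def)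
  have "isCont ?a z" "isCont ?b z"
    using f smooth_continuous[of "partial_y (partial_x f)"] smooth_continuous[of "partial_x (partial_y f)"]
    by (auto intro!: bounded_linear.continuous[OF L] smooth_partial
        simp: continuous_on_eq_continuous_at)
  then obtain d1 d2 where d: "d1 > 0" "\<And>u. dist u z < d1 \<Longrightarrow> dist (?a u) (?a z) < e"
      "d2 > 0" "\<And>u. dist u z < d2 \<Longrightarrow> dist (?b u) (?b z) < e"
    unfolding continuous_at_eps_delta using e by metis
  \<comment> \<open>The intermediate points are reached by one step shorter than \<open>h\<close> in
    each direction, so they lie within \<open>2 * h\<close> of \<open>z\<close>.\<close>
  define h where "h = min d1 d2 / 2"
  have h: "h > 0" "2 * h \<le> d1" "2 * h \<le> d2" using d by (auto simp: h_def)
  have near: "dist (z + of_real p * v + of_real q * w) z < 2 * h"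
    if "0 < p" "p < h" "0 < q" "q < h" "norm v = 1" "norm w = 1" for p q :: real and v w :: complex
  proof -
    have "dist (z + of_real p * v + of_real q * w) z \<le> norm (of_real p * v) + norm (of_real q * w)"
      unfolding dist_norm using norm_triangle_ineq[of "of_real p * v" "of_real q * w"]
      by (simp add: algebra_simps)
    also have "\<dots> < 2 * h"
      using that by (simp add: norm_mult)
    finally show ?thesis .
  qed
  obtain s t where st: "0 < s" "s < h" "0 < t" "t < h"
    "L (f (z + of_real h * 1 + of_real h * \<i>)) - L (f (z + of_real h * \<i>))
      - L (f (z + of_real h * 1)) + L (f z) = h * (h * ?a (z + of_real s * 1 + of_real t * \<i>))"
    using second_difference[of f "partial_x f" 1 L h z \<i>] f L h
    by (auto simp: smooth_differentiable smooth_partial partial_x_def partial_y_def[of "partial_x f"])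
  obtain s' t' where st': "0 < s'" "s' < h" "0 < t'" "t' < h"
    "L (f (z + of_real h * \<i> + of_real h * 1)) - L (f (z + of_real h * 1))
      - L (f (z + of_real h * \<i>)) + L (f z) = h * (h * ?b (z + of_real s' * \<i> + of_real t' * 1))"
    using second_difference[of f "partial_y f" \<i> L h z 1] f L h
    by (auto simp: smooth_differentiable smooth_partial partial_y_def partial_x_def[of "partial_y f"])
  have "h * (h * ?a (z + of_real s * 1 + of_real t * \<i>)) = h * (h * ?b (z + of_real s' * \<i> + of_real t' * 1))"
    unfolding st(5)[symmetric] st'(5)[symmetric] by (simp add: algebra_simps)
  then have "?a (z + of_real s * 1 + of_real t * \<i>) = ?b (z + of_real s' * \<i> + of_real t' * 1)"
    using h by simp
  moreover have "dist (?a (z + of_real s * 1 + of_real t * \<i>)) (?a z) < e"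
    using near[of s t 1 \<i>] st h by (intro d(2)) auto
  moreover have "dist (?b (z + of_real s' * \<i> + of_real t' * 1)) (?b z) < e"
    using near[of s' t' \<i> 1] st' h by (intro d(4)) auto
  ultimately show False
    unfolding e_def dist_real_def by (auto simp: abs_if split: if_splits)
qed

lemma partial_commute:
  assumes "smooth f"
  shows "partial_y (partial_x f) z = partial_x (partial_y f) z"
  using partial_commute_component[OF assms bounded_linear_Re]
    partial_commute_component[OF assms bounded_linear_Im]
  by (simp add: complex_eq_iff)

lemma partial_linear_comb:
  assumes "f differentiable (at z)" "g differentiable (at z)"
  shows "partial_x (\<lambda>z. a * f z + b * g z) z = a * partial_x f z + b * partial_x g z"
    and "partial_y (\<lambda>z. a * f z + b * g z) z = a * partial_y f z + b * partial_y g z"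
proof -
  note w = has_wirt_add[OF has_wirt_mult[OF has_wirt_const differentiable_has_wirt[OF assms(1)]]
    has_wirt_mult[OF has_wirt_const differentiable_has_wirt[OF assms(2)]]]
  show "partial_x (\<lambda>z. a * f z + b * g z) z = a * partial_x f z + b * partial_x g z"
    and "partial_y (\<lambda>z. a * f z + b * g z) z = a * partial_y f z + b * partial_y g z"
    unfolding has_wirt_partial[OF w] by (auto simp: wirt_def wirt_bar_def field_simps)
qed

lemma wirt_commute:
  assumes f: "smooth f"
  shows "wirt_bar (wirt f) z = wirt (wirt_bar f) z"
proof -
  have 1: "wirt f = (\<lambda>z. (1/2) * partial_x f z + (- \<i>/2) * partial_y f z)"
    by (rule ext) (simp add: wirt_def field_simps)
  have 2: "wirt_bar f = (\<lambda>z. (1/2) * partial_x f z + (\<i>/2) * partial_y f z)"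
    by (rule ext) (simp add: wirt_bar_def field_simps)
  have d: "partial_x f differentiable (at z)" "partial_y f differentiable (at z)"
    using f by (auto intro: smooth_differentiable smooth_partial)
  show ?thesis
    unfolding wirt_def[of "wirt_bar f"] wirt_bar_def[of "wirt f"] unfolding 1 2
    by (simp only: partial_linear_comb[OF d] partial_commute[OF f]) (simp add: field_simps)
qed

section \<open>The creation operator\<close>

lemma has_wirt_gauss:
  fixes z :: complex
  shows "has_wirt (\<lambda>z. complex_of_real (exp (- \<nu> * (norm z)\<^sup>2)))
     (- \<nu> * cnj z * exp (- \<nu> * (norm z)\<^sup>2)) (- \<nu> * z * exp (- \<nu> * (norm z)\<^sup>2)) z"
proof -
  have "((\<lambda>r. exp (- \<nu> * r)) has_real_derivative - \<nu> * exp (- \<nu> * (norm z)\<^sup>2)) (at ((norm z)\<^sup>2))"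
    by (auto intro!: derivative_eq_intros)
  from has_wirt_radial[OF this] show ?thesis
    by (rule has_wirt_unique) (simp_all add: mult_ac)
qed

text \<open>Up to sign, \<open>nabla \<nu> 0\<close> is \<open>wirt\<close> conjugated by the
  Gaussian weight. Iterating this turns the Rodrigues-type formula of \<open>I_poly\<close> into a
  power of \<open>nabla \<nu> 0\<close>.\<close>

lemma wirt_gauss_mult:
  assumes "smooth g"
  shows "wirt (\<lambda>w. complex_of_real (exp (- \<nu> * (norm w)\<^sup>2)) * g w) z
    = - complex_of_real (exp (- \<nu> * (norm z)\<^sup>2)) * nabla \<nu> 0 g z"
  unfolding has_wirt_eqs[OF has_wirt_mult[OF has_wirt_gauss smooth_has_wirt[OF assms]]]
  by (simp add: nabla_def algebra_simps)

lemma smooth_cmult: "smooth g \<Longrightarrow> smooth (\<lambda>z. c * g z)"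
  by (intro smooth_mult smooth_const)

lemma nabla_cmult:
  assumes "smooth g"
  shows "nabla \<nu> \<gamma> (\<lambda>z. c * g z) z = c * nabla \<nu> \<gamma> g z"
  using has_wirt_eqs(1)[OF has_wirt_mult[OF has_wirt_const[of c] smooth_has_wirt[OF assms]]]
  by (simp add: nabla_def algebra_simps)

lemma nabla_funpow_cmult:
  assumes "smooth g"
  shows "(nabla \<nu> \<gamma> ^^ n) (\<lambda>z. c * g z) = (\<lambda>z. c * (nabla \<nu> \<gamma> ^^ n) g z)"
proof (induction n)
  case (Suc n)
  show ?case
    unfolding funpow.simps o_def Suc nabla_cmult[OF smooth_nabla_funpow[OF assms]] ..
qed simp

lemma has_wirt_exp_square:
  "has_wirt (\<lambda>z. exp (c * z\<^sup>2)) (2 * c * z * exp (c * z\<^sup>2)) 0 z"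
  by (intro has_wirt_holomorphic) (auto intro!: derivative_eq_intros)

lemma smooth_exp_square: "smooth (\<lambda>z. exp (c * z\<^sup>2))"
  by (intro smooth_holomorphic holomorphic_intros)

text \<open>The term -2\<gamma>z is the logarithmic derivative of exp (-\<gamma> z^2), so
  conjugation removes it and only \<open>nabla \<nu> 0\<close> has to be studied.\<close>

lemma nabla_funpow_conjugate:
  assumes "smooth g"
  shows "(nabla \<nu> \<gamma> ^^ n) g =
    (\<lambda>z. exp (- complex_of_real \<gamma> * z\<^sup>2) *
      (nabla \<nu> 0 ^^ n) (\<lambda>z. exp (complex_of_real \<gamma> * z\<^sup>2) * g z) z)"
proof (induction n)
  case 0
  have "exp (- complex_of_real \<gamma> * z\<^sup>2) * exp (complex_of_real \<gamma> * z\<^sup>2) = 1" for z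
    by (simp flip: exp_add)
  then show ?case
    by (simp add: fun_eq_iff flip: mult.assoc)
next
  case (Suc n)
  let ?G = "(nabla \<nu> 0 ^^ n) (\<lambda>z. exp (complex_of_real \<gamma> * z\<^sup>2) * g z)"
  have G: "smooth ?G"
    using assms by (intro smooth_nabla_funpow smooth_mult smooth_exp_square)
  have "nabla \<nu> \<gamma> (\<lambda>z. exp (- complex_of_real \<gamma> * z\<^sup>2) * ?G z) z
      = exp (- complex_of_real \<gamma> * z\<^sup>2) * nabla \<nu> 0 ?G z" for z
    unfolding nabla_def has_wirt_eqs[OF has_wirt_mult[OF has_wirt_exp_square smooth_has_wirt[OF G]]]
    by (simp add: algebra_simps)
  then show ?case
    unfolding funpow.simps o_def Suc by (rule ext)
qed

lemma wirt_funpow_gauss: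
  assumes "smooth g"
  shows "(wirt ^^ n) (\<lambda>w. complex_of_real (exp (- \<nu> * (norm w)\<^sup>2)) * g w)
    = (\<lambda>z. (-1) ^ n * (complex_of_real (exp (- \<nu> * (norm z)\<^sup>2)) * (nabla \<nu> 0 ^^ n) g z))"
proof (induction n)
  case (Suc n)
  let ?G = "(nabla \<nu> 0 ^^ n) g" and ?e = "\<lambda>z. complex_of_real (exp (- \<nu> * (norm z)\<^sup>2))"
  have G: "smooth ?G"
    using assms by (rule smooth_nabla_funpow)
  have "wirt (\<lambda>z. (-1) ^ n * (?e z * ?G z)) z = (-1) ^ n * wirt (\<lambda>z. ?e z * ?G z) z" for z
    using has_wirt_eqs(1)[OF has_wirt_mult[OF has_wirt_const has_wirt_mult[OF has_wirt_gauss smooth_has_wirt[OF G]]]]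
      has_wirt_eqs(1)[OF has_wirt_mult[OF has_wirt_gauss smooth_has_wirt[OF G]]]
    by simp
  then show ?case
    unfolding funpow.simps o_def Suc wirt_gauss_mult[OF G] by (simp add: fun_eq_iff)
qed simp

text \<open>The second coefficient is the commutation relation \<open>D A = A D + \<nu>\<close>
  behind all ladder arguments; it rests on the symmetry of mixed derivatives. The first says that
  \<open>A\<close> commutes with \<open>wirt\<close>, since \<open>cnj z\<close> is constant for
  \<open>wirt\<close>.\<close>

lemma has_wirt_nabla:
  assumes "smooth f"
  shows "has_wirt (nabla \<nu> 0 f) (nabla \<nu> 0 (wirt f) z) (nabla \<nu> 0 (wirt_bar f) z + \<nu> * f z) z"
proof -
  have "nabla \<nu> 0 f = (\<lambda>z. - wirt f z + complex_of_real \<nu> * (cnj z * f z))"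
    by (rule ext) (simp add: nabla_def)
  moreover have "has_wirt (\<lambda>z. - wirt f z + complex_of_real \<nu> * (cnj z * f z))
      (- wirt (wirt f) z + \<nu> * (cnj z * wirt f z))
      (- wirt_bar (wirt f) z + \<nu> * (f z + cnj z * wirt_bar f z)) z"
    by (rule has_wirt_unique,
        rule has_wirt_add[OF has_wirt_minus[OF smooth_has_wirt[OF smooth_wirt[OF assms]]]
          has_wirt_mult[OF has_wirt_const has_wirt_mult[OF has_wirt_cnj[OF has_wirt_id] smooth_has_wirt[OF assms]]]])
      simp_all
  ultimately show ?thesis
    by (auto simp: nabla_def wirt_commute[OF assms] algebra_simps elim!: has_wirt_unique)
qed

lemmas wirt_nabla = has_wirt_eqs(1)[OF has_wirt_nabla]
  and wirt_bar_nabla = has_wirt_eqs(2)[OF has_wirt_nabla]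

lemma wirt_nabla_funpow:
  assumes "smooth f"
  shows "wirt ((nabla \<nu> 0 ^^ n) f) = (nabla \<nu> 0 ^^ n) (wirt f)"
proof (induction n)
  case (Suc n)
  show ?case
    unfolding funpow.simps o_def fun_eq_iff wirt_nabla[OF smooth_nabla_funpow[OF assms]] Suc by blast
qed simp

lemma wirt_holomorphic:
  assumes "h holomorphic_on UNIV"
  shows "wirt h = deriv h"
  using has_wirt_eqs(1)[OF has_wirt_holomorphic[OF holomorphic_derivI[OF assms]]] by auto

text \<open>As \<open>A\<close> commutes with \<open>wirt\<close>, the derivative can be moved
  inside onto \<open>h\<close>. The recursion then only needs complex derivatives of entire
  functions, which pass through locally uniform limits.\<close>

lemma nabla_funpow_Suc_holomorphic:
  assumes "h holomorphic_on UNIV"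
  shows "(nabla \<nu> 0 ^^ Suc n) h z =
    \<nu> * cnj z * (nabla \<nu> 0 ^^ n) h z - (nabla \<nu> 0 ^^ n) (deriv h) z"
  using fun_cong[OF wirt_nabla_funpow[OF smooth_holomorphic[OF assms], where \<nu>=\<nu> and n=n], of z]
  by (simp add: nabla_def[of _ _ "(nabla \<nu> 0 ^^ n) h"] wirt_holomorphic[OF assms])

section \<open>Locally uniformly convergent series of entire functions\<close>

text \<open>A Weierstrass majorant on every disc: it gives absolute convergence at each point and is
  inherited by the derivatives.\<close>

definition entire_family :: "(nat \<Rightarrow> complex \<Rightarrow> complex) \<Rightarrow> bool" where
  "entire_family h \<longleftrightarrow> (\<forall>m. h m holomorphic_on UNIV) \<and>
     (\<forall>R. \<exists>M. summable M \<and> (\<forall>m z. norm z \<le> R \<longrightarrow> norm (h m z) \<le> M m))"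

lemma entire_familyD:
  assumes "entire_family h"
  shows "h m holomorphic_on UNIV"
    and "\<exists>M. summable M \<and> (\<forall>m z. norm z \<le> R \<longrightarrow> norm (h m z) \<le> M m)"
  using assms unfolding entire_family_def by blast+

lemma entire_family_summable:
  assumes "entire_family h"
  shows "summable (\<lambda>m. norm (h m z))"
proof -
  obtain M where "summable M" "\<And>m w. norm w \<le> norm z \<Longrightarrow> norm (h m w) \<le> M m"
    using entire_familyD(2)[OF assms, of "norm z"] by blast
  then show ?thesis
    by (intro summable_comparison_test'[of M 0 "\<lambda>m. norm (h m z)"]) auto
qed

lemma entire_family_uniform_limit:
  assumes "entire_family h"
  shows "uniform_limit (ball 0 R) (\<lambda>N z. \<Sum>m<N. h m z) (\<lambda>z. \<Sum>m. h m z) sequentially"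
proof -
  obtain M where "summable M" "\<And>m w. norm w \<le> R \<Longrightarrow> norm (h m w) \<le> M m"
    using entire_familyD(2)[OF assms, of R] by blast
  then show ?thesis
    by (intro Weierstrass_m_test[of _ _ M]) auto
qed

lemma entire_family_deriv:
  assumes h: "entire_family h"
  shows "entire_family (\<lambda>m. deriv (h m))"
    and "(\<lambda>z. \<Sum>m. h m z) holomorphic_on UNIV"
    and "deriv (\<lambda>z. \<Sum>m. h m z) = (\<lambda>z. \<Sum>m. deriv (h m) z)"
proof -
  note hol = entire_familyD(1)[OF h]
  show *: "entire_family (\<lambda>m. deriv (h m))"
    unfolding entire_family_def
  proof (intro conjI allI)
    show "deriv (h m) holomorphic_on UNIV" for m
      using hol by (intro holomorphic_deriv) auto
    fix R :: real
    \<comment> \<open>Cauchy's estimate on the unit circle around a point of the disc of radius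
      \<open>R\<close> uses values in the disc of radius \<open>R + 1\<close>, so the same majorant
      bounds the derivatives.\<close>
    obtain M where M: "summable M" "\<And>m w. norm w \<le> R + 1 \<Longrightarrow> norm (h m w) \<le> M m"
      using entire_familyD(2)[OF h, of "R + 1"] by blast
    have "norm (deriv (h m) z) \<le> M m" if "norm z \<le> R" for m z
    proof -
      have "norm ((deriv ^^ 1) (h m) z) \<le> fact 1 * M m / 1 ^ 1"
      proof (rule Cauchy_inequality)
        show "norm (h m w) \<le> M m" if "norm (z - w) = 1" for w
        proof (rule M(2))
          have "norm w \<le> norm z + norm (z - w)"
            using norm_triangle_ineq4[of z "z - w"] by simp
          with that \<open>norm z \<le> R\<close> show "norm w \<le> R + 1" by simp
        qed
      qed (use hol in \<open>auto intro: holomorphic_on_subset holomorphic_on_imp_continuous_on continuous_on_subset\<close>)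
      then show ?thesis by simp
    qed
    with M(1) show "\<exists>M. summable M \<and> (\<forall>m z. norm z \<le> R \<longrightarrow> norm (deriv (h m) z) \<le> M m)"
      by blast
  qed
  show "(\<lambda>z. \<Sum>m. h m z) holomorphic_on UNIV"
  proof (rule holomorphic_uniform_sequence)
    show "(\<lambda>z. \<Sum>m<N. h m z) holomorphic_on UNIV" for N
      using hol by (intro holomorphic_intros)
    fix x :: complex
    have "uniform_limit (cball x 1) (\<lambda>N z. \<Sum>m<N. h m z) (\<lambda>z. \<Sum>m. h m z) sequentially"
    proof (rule uniform_limit_on_subset[OF entire_family_uniform_limit[OF h]])
      show "cball x 1 \<subseteq> ball 0 (norm x + 2)"
      proof
        fix w assume "w \<in> cball x 1"
        then have "norm w \<le> norm x + 1"
          using norm_triangle_ineq4[of x "x - w"] by (simp add: dist_norm)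
        then show "w \<in> ball 0 (norm x + 2)" by simp
      qed
    qed
    then show "\<exists>d>0. cball x d \<subseteq> UNIV \<and>
        uniform_limit (cball x d) (\<lambda>N z. \<Sum>m<N. h m z) (\<lambda>z. \<Sum>m. h m z) sequentially"
      by (intro exI[of _ 1]) auto
  qed auto
  show "deriv (\<lambda>z. \<Sum>m. h m z) = (\<lambda>z. \<Sum>m. deriv (h m) z)"
  proof
    fix z
    have "(\<lambda>N. (deriv ^^ 1) (\<lambda>z. \<Sum>m<N. h m z) z) \<longlonglongrightarrow> (deriv ^^ 1) (\<lambda>z. \<Sum>m. h m z) z"
      using hol by (intro higher_deriv_complex_uniform_limit[OF entire_family_uniform_limit[OF h, of "norm z + 1"]])
        (auto intro!: always_eventually holomorphic_intros intro: holomorphic_on_subset)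
    moreover have "(deriv ^^ 1) (\<lambda>z. \<Sum>m<N. h m z) z = (\<Sum>m<N. deriv (h m) z)" for N
    proof -
      have "((\<lambda>z. \<Sum>m<N. h m z) has_field_derivative (\<Sum>m<N. deriv (h m) z)) (at z)"
        using hol by (intro DERIV_sum holomorphic_derivI) auto
      then show ?thesis by (simp add: DERIV_imp_deriv)
    qed
    ultimately have "(\<lambda>m. deriv (h m) z) sums deriv (\<lambda>z. \<Sum>m. h m z) z"
      by (simp add: sums_def)
    then show "deriv (\<lambda>z. \<Sum>m. h m z) z = (\<Sum>m. deriv (h m) z)"
      by (rule sums_unique)
  qed
qed

text \<open>The induction runs over all families at once, because the recursion for the next power
  also involves the family of derivatives.\<close>

lemma nabla_funpow_entire_family:
  assumes "entire_family h"
  shows "summable (\<lambda>m. norm ((nabla \<nu> 0 ^^ n) (h m) z))"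
    and "(nabla \<nu> 0 ^^ n) (\<lambda>z. \<Sum>m. h m z) z = (\<Sum>m. (nabla \<nu> 0 ^^ n) (h m) z)"
  using assms
proof (induction n arbitrary: h)
  case 0
  {
    case 1
    then show ?case by (simp add: entire_family_summable)
  next
    case 2
    then show ?case by simp
  }
next
  case (Suc n)
  let ?A = "nabla \<nu> 0 ^^ n"
  have rec: "(nabla \<nu> 0 ^^ Suc n) (h m) z = \<nu> * cnj z * ?A (h m) z - ?A (deriv (h m)) z"
    if "entire_family h" for m h
    using entire_familyD(1)[OF that] by (rule nabla_funpow_Suc_holomorphic)
  have s: "summable (\<lambda>m. norm (?A (h m) z))" "summable (\<lambda>m. norm (?A (deriv (h m)) z))"
    if "entire_family h" for h
    using that Suc.IH(1) entire_family_deriv(1) by blast+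
  {
    case 1
    have b: "norm ((nabla \<nu> 0 ^^ Suc n) (h m) z)
        \<le> norm (\<nu> * cnj z) * norm (?A (h m) z) + norm (?A (deriv (h m)) z)" for m
      unfolding rec[OF 1] norm_mult[symmetric] by (rule norm_triangle_ineq4)
    have "summable (\<lambda>m. norm (\<nu> * cnj z) * norm (?A (h m) z) + norm (?A (deriv (h m)) z))"
      using s[OF 1] by (intro summable_add summable_mult)
    then show ?case
      by (rule summable_comparison_test') (use b in simp)
  next
    case 2
    have s': "summable (\<lambda>m. ?A (h m) z)" "summable (\<lambda>m. ?A (deriv (h m)) z)"
      using s[OF 2] by (auto intro: summable_norm_cancel)
    have "(nabla \<nu> 0 ^^ Suc n) (\<lambda>z. \<Sum>m. h m z) z
        = \<nu> * cnj z * ?A (\<lambda>z. \<Sum>m. h m z) z - ?A (\<lambda>z. \<Sum>m. deriv (h m) z) z"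
      using nabla_funpow_Suc_holomorphic[OF entire_family_deriv(2)[OF 2]]
        entire_family_deriv(3)[OF 2] by metis
    also have "\<dots> = \<nu> * cnj z * (\<Sum>m. ?A (h m) z) - (\<Sum>m. ?A (deriv (h m)) z)"
      using Suc.IH(2)[OF 2] Suc.IH(2)[OF entire_family_deriv(1)[OF 2]] by simp
    also have "\<dots> = (\<Sum>m. (nabla \<nu> 0 ^^ Suc n) (h m) z)"
      unfolding rec[OF 2] suminf_mult[OF s'(1), symmetric]
      by (rule suminf_diff[OF summable_mult[OF s'(1)] s'(2)])
    finally show ?case .
  }
qed

section \<open>Hermite polynomials\<close>

text \<open>Formal power series give the recurrence of the Hermite polynomials over any field of
  characteristic 0, hence for real and complex arguments together.\<close>

definition exp_neg_square_fps :: "'a::field_char_0 fps" where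
  "exp_neg_square_fps = Abs_fps (\<lambda>n. if even n then (-1) ^ (n div 2) / fact (n div 2) else 0)"

lemma exp_neg_square_fps_nth:
  "fps_nth exp_neg_square_fps n = (if even n then (-1) ^ (n div 2) / fact (n div 2) else 0)"
  by (simp add: exp_neg_square_fps_def)

lemma hermite_fps_nth:
  fixes z :: "'a::field_char_0"
  shows "fps_nth (exp_neg_square_fps * fps_exp (2 * z)) m = hermite m z / fact m"
proof -
  have "fps_nth (exp_neg_square_fps * fps_exp (2 * z)) m
      = (\<Sum>i\<le>m. fps_nth exp_neg_square_fps i * ((2 * z) ^ (m - i) / fact (m - i)))"
    by (simp add: fps_mult_nth fps_exp_def atLeast0AtMost)
  also have "\<dots> = (\<Sum>i\<in>(\<lambda>k. 2 * k) ` {..m div 2}.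
      fps_nth exp_neg_square_fps i * ((2 * z) ^ (m - i) / fact (m - i)))"
    by (rule sum.mono_neutral_right)
      (auto simp: exp_neg_square_fps_nth image_iff elim!: evenE)
  also have "\<dots> = (\<Sum>k\<le>m div 2. (-1) ^ k / fact k * ((2 * z) ^ (m - 2 * k) / fact (m - 2 * k)))"
    by (subst sum.reindex) (auto simp: inj_on_def exp_neg_square_fps_nth)
  finally show ?thesis
    by (simp add: hermite_def)
qed

lemma fps_deriv_exp_neg_square:
  "fps_deriv exp_neg_square_fps = - (2 * fps_X * (exp_neg_square_fps :: 'a::field_char_0 fps))"
proof (rule fps_ext)
  fix n
  consider "n = 0" | k where "n = Suc (2 * k)" | k where "n = Suc (Suc (2 * k))"
    by (metis evenE oddE Suc_eq_plus1 nat.exhaust even_Suc add_2_eq_Suc' mult_Suc_right)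
  then show "fps_nth (fps_deriv exp_neg_square_fps) n
      = fps_nth (- (2 * fps_X * (exp_neg_square_fps :: 'a fps))) n"
  proof cases
    case 1
    then show ?thesis
      by (simp add: exp_neg_square_fps_nth mult.assoc numeral_fps_const)
  next
    case (2 k)
    then show ?thesis
      by (simp add: exp_neg_square_fps_nth mult.assoc numeral_fps_const divide_simps del: of_nat_Suc)
        (simp add: algebra_simps)
  next
    case (3 k)
    then show ?thesis
      by (simp add: exp_neg_square_fps_nth mult.assoc numeral_fps_const)
  qed
qed

lemma hermite_0: "hermite 0 z = 1"
  by (simp add: hermite_def)

lemma hermite_1: "hermite (Suc 0) z = 2 * z"
  by (simp add: hermite_def)

text \<open>Compares coefficients in the formal differential equation c' = 2 z c - 2 X c of the
  generating series.\<close>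

lemma hermite_rec:
  fixes z :: "'a::field_char_0"
  shows "hermite (Suc (Suc m)) z = 2 * z * hermite (Suc m) z - 2 * of_nat (Suc m) * hermite m z"
proof -
  let ?c = "exp_neg_square_fps * fps_exp (2 * z)"
  have "fps_deriv ?c = fps_const (2 * z) * ?c - fps_const 2 * (fps_X * ?c)"
    by (simp add: fps_deriv_exp_neg_square algebra_simps numeral_fps_const)
  then have "fps_nth (fps_deriv ?c) (Suc m)
      = fps_nth (fps_const (2 * z) * ?c - fps_const 2 * (fps_X * ?c)) (Suc m)"
    by (rule arg_cong)
  then have "fps_nth (fps_deriv ?c) (Suc m) = 2 * z * fps_nth ?c (Suc m) - 2 * fps_nth ?c m"
    by (simp only: fps_sub_nth fps_mult_left_const_nth fps_X_mult_nth) simp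
  then have "of_nat (Suc (Suc m)) * (hermite (Suc (Suc m)) z / fact (Suc (Suc m)))
      = 2 * z * (hermite (Suc m) z / fact (Suc m)) - 2 * (hermite m z / fact m)"
    by (simp only: fps_deriv_nth hermite_fps_nth Suc_eq_plus1 add.assoc)
  moreover have "fact (Suc (Suc m)) = of_nat (Suc (Suc m)) * (of_nat (Suc m) * fact m :: 'a)"
    "fact (Suc m) = (of_nat (Suc m) * fact m :: 'a)"
    by (simp_all only: fact_Suc)
  moreover have "of_nat (Suc (Suc m)) \<noteq> (0::'a)" "of_nat (Suc m) \<noteq> (0::'a)"
    by (simp_all only: of_nat_eq_0_iff)
  ultimately show ?thesis
    by (simp only:) (simp add: field_simps del: of_nat_Suc)
qed

lemma hermite_of_real: "hermite m (of_real x) = (of_real (hermite m x) :: 'a::{real_field})"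
  by (simp add: hermite_def)

text \<open>Complete induction along the three-term recurrence. At \<open>m = 0\<close> the
  truncated index \<open>m - 1\<close> is harmless because of the factor
  \<open>of_nat m\<close>.\<close>

lemma hermite_has_field_derivative:
  fixes z :: "'a::real_normed_field"
  shows "(hermite m has_field_derivative 2 * of_nat m * hermite (m - 1) z) (at z)"
proof (induction m arbitrary: z rule: less_induct)
  case (less m)
  consider "m = 0" | "m = 1" | k where "m = Suc (Suc k)"
    by (metis One_nat_def not0_implies_Suc)
  then show ?case
  proof cases
    case 1
    then show ?thesis
      by (simp add: hermite_0 [abs_def])
  next
    case 2
    have "hermite 1 = (\<lambda>z::'a. 2 * z)"
      by (simp add: hermite_1 fun_eq_iff)
    with 2 show ?thesis
      by (auto intro!: derivative_eq_intros simp: hermite_0)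
  next
    case (3 k)
    have e: "hermite (Suc (Suc k)) = (\<lambda>z::'a. 2 * z * hermite (Suc k) z - 2 * of_nat (Suc k) * hermite k z)"
      by (simp add: fun_eq_iff hermite_rec del: of_nat_Suc)
    have "((\<lambda>z::'a. 2 * z * hermite (Suc k) z - 2 * of_nat (Suc k) * hermite k z) has_field_derivative
        2 * hermite (Suc k) z + 2 * z * (2 * of_nat (Suc k) * hermite k z)
        - 2 * of_nat (Suc k) * (2 * of_nat k * hermite (k - 1) z)) (at z)"
      using less[of "Suc k" z] less[of k z] 3
      by (auto intro!: derivative_eq_intros simp del: of_nat_Suc)
    moreover have "2 * of_nat k * hermite (k - 1) z = 2 * z * hermite k z - hermite (Suc k) z"
      by (cases k) (simp_all add: hermite_0 hermite_1 hermite_rec)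
    then have "2 * hermite (Suc k) z + 2 * z * (2 * of_nat (Suc k) * hermite k z)
        - 2 * of_nat (Suc k) * (2 * of_nat k * hermite (k - 1) z)
        = 2 * of_nat (Suc (Suc k)) * hermite (Suc k) z"
      by (simp only:) (simp add: algebra_simps)
    ultimately show ?thesis
      unfolding 3 e by simp
  qed
qed

text \<open>The subtracted term is the derivative of \<open>hermite m\<close>, so this is the
  raising relation; unlike \<open>hermite_rec\<close> it also covers the lowest index.\<close>

lemma hermite_Suc_deriv:
  fixes z :: "'a::real_normed_field"
  shows "hermite (Suc m) z = 2 * z * hermite m z - 2 * of_nat m * hermite (m - 1) z"
  by (cases m) (simp_all add: hermite_0 hermite_1 hermite_rec)

lemma hermite_holomorphic: "hermite m holomorphic_on A"
  by (rule holomorphic_onI)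
    (meson field_differentiable_at_within field_differentiable_def hermite_has_field_derivative)

lemma hermite_continuous: "continuous_on A (hermite m :: 'a::real_normed_field \<Rightarrow> 'a)"
  by (meson DERIV_isCont continuous_at_imp_continuous_on hermite_has_field_derivative)

text \<open>Cauchy product of the absolutely convergent series of exp (- w^2), padded with zeros at
  odd indices, and of exp (2 z w); its coefficients are those of the formal product.\<close>

lemma hermite_generating_function:
  fixes z w :: complex
  shows "(\<lambda>m. hermite m z / fact m * w ^ m) sums exp (2 * z * w - w\<^sup>2)"
proof -
  let ?a = "\<lambda>n. fps_nth exp_neg_square_fps n * w ^ n :: complex"
  let ?b = "\<lambda>n. (2 * z * w) ^ n / fact n"
  have m: "strict_mono (\<lambda>k::nat. 2 * k)"
    by (simp add: strict_mono_def)
  have r: "fps_nth exp_neg_square_fps n = (0::complex)" if "n \<notin> range (\<lambda>k. 2 * k)" for n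
    using that by (auto simp: exp_neg_square_fps_nth)
  have e: "?a (2 * k) = (- (w\<^sup>2)) ^ k /\<^sub>R fact k" for k
    unfolding power_minus[of "w\<^sup>2"] power_mult[symmetric]
    by (simp add: exp_neg_square_fps_nth scaleR_conv_of_real divide_inverse)
  have e': "norm (?a (2 * k)) = ((norm w)\<^sup>2) ^ k /\<^sub>R fact k" for k
    unfolding power_mult[symmetric]
    by (simp add: exp_neg_square_fps_nth norm_mult norm_divide norm_power norm_inverse divide_inverse)
  have "(\<lambda>k. ?a (2 * k)) sums exp (- (w\<^sup>2))"
    unfolding e by (rule exp_converges)
  then have a: "?a sums exp (- (w\<^sup>2))"
    using sums_mono_reindex[OF m, of ?a] r by simp
  have "(\<lambda>k. norm (?a (2 * k))) sums exp ((norm w)\<^sup>2)"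
    unfolding e' by (rule exp_converges)
  then have na: "summable (\<lambda>n. norm (?a n))"
    using sums_mono_reindex[OF m, of "\<lambda>n. norm (?a n)"] r by (auto simp: sums_iff)
  have b: "?b sums exp (2 * z * w)"
    using exp_converges[of "2 * z * w"] by (simp add: scaleR_conv_of_real field_simps)
  have nb: "summable (\<lambda>n. norm (?b n))"
    using summable_norm_exp[of "2 * z * w"] by (simp add: scaleR_conv_of_real field_simps norm_mult norm_divide norm_power)
  have "(\<lambda>m. \<Sum>i\<le>m. ?a i * ?b (m - i)) sums (exp (- (w\<^sup>2)) * exp (2 * z * w))"
    using Cauchy_product_sums[OF na nb] a b by (simp add: sums_iff)
  moreover have "(\<Sum>i\<le>m. ?a i * ?b (m - i)) = hermite m z / fact m * w ^ m" for m
  proof -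
    have "?a i * ?b (m - i) = fps_nth exp_neg_square_fps i * fps_nth (fps_exp (2 * z)) (m - i) * w ^ m"
      if "i \<le> m" for i
    proof -
      have "w ^ m = w ^ i * w ^ (m - i)"
        using that by (simp flip: power_add)
      then show ?thesis
        by (simp add: power_mult_distrib)
    qed
    then have "(\<Sum>i\<le>m. ?a i * ?b (m - i))
        = (\<Sum>i\<le>m. fps_nth exp_neg_square_fps i * fps_nth (fps_exp (2 * z)) (m - i)) * w ^ m"
      unfolding sum_distrib_right by (intro sum.cong) auto
    also have "\<dots> = fps_nth (exp_neg_square_fps * fps_exp (2 * z)) m * w ^ m"
      by (simp add: fps_mult_nth atLeast0AtMost)
    finally show ?thesis
      unfolding hermite_fps_nth .
  qed
  moreover have "exp (- (w\<^sup>2)) * exp (2 * z * w) = exp (2 * z * w - w\<^sup>2)"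
    by (simp flip: exp_add)
  ultimately show ?thesis
    by simp
qed

text \<open>The normalised Hermite polynomials satisfy a recurrence with coefficients close to those of
  \<open>h (m + 2) = h m\<close>, so they grow subexponentially, locally uniformly.\<close>

definition hermite_growth :: "real \<Rightarrow> nat \<Rightarrow> real" where
  "hermite_growth R m = (\<Prod>k<m. 1 + R * sqrt (2 / real (Suc k)))"

lemma hermite_growth_nonneg: "0 \<le> R \<Longrightarrow> 0 \<le> hermite_growth R m"
  unfolding hermite_growth_def by (intro prod_nonneg) auto

text \<open>Divided by \<open>sqrt (2 ^ m * fact m)\<close>, the recurrence has coefficients z *
  sqrt (2 / (m + 2)) and sqrt ((m + 1) / (m + 2)). The second is at most 1, and the first produces
  the factors of \<open>hermite_growth\<close>.\<close>

lemma hermite_bound: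
  fixes z :: complex
  assumes "norm z \<le> R"
  shows "norm (hermite m z) \<le> sqrt (2 ^ m * fact m) * hermite_growth R m"
proof (induction m rule: less_induct)
  case (less m)
  have R: "0 \<le> R" using assms norm_ge_zero[of z] by linarith
  consider "m = 0" | "m = 1" | k where "m = Suc (Suc k)"
    by (metis One_nat_def not0_implies_Suc)
  then show ?case
  proof cases
    case 1
    then show ?thesis by (simp add: hermite_0 hermite_growth_def)
  next
    case 2
    have "2 * norm z \<le> sqrt 2 * (1 + R * sqrt 2)"
    proof -
      have "sqrt 2 * (1 + R * sqrt 2) = sqrt 2 + R * (sqrt 2 * sqrt 2)"
        by (simp only: algebra_simps)
      also have "\<dots> = sqrt 2 + R * 2"
        by simp
      finally show ?thesis
        using assms real_sqrt_ge_zero[of 2] by linarith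
    qed
    with 2 show ?thesis by (simp add: hermite_1 hermite_growth_def norm_mult)
  next
    case (3 k)
    let ?s = "\<lambda>m. sqrt (2 ^ m * fact m)" and ?P = "hermite_growth R"
    have s: "?s (Suc j) = sqrt (2 * real (Suc j)) * ?s j" for j
      unfolding real_sqrt_mult[symmetric] by (simp add: mult_ac del: of_nat_Suc)
    have P: "?P (Suc j) = ?P j * (1 + R * sqrt (2 / real (Suc j)))" for j
      by (simp add: hermite_growth_def)
    have Pmono: "?P k \<le> ?P (Suc k)"
    proof -
      have "?P k * 1 \<le> ?P k * (1 + R * sqrt (2 / real (Suc k)))"
        using R by (intro mult_left_mono hermite_growth_nonneg) auto
      then show ?thesis by (simp add: P)
    qed
    have "norm (hermite m z) \<le> 2 * norm z * norm (hermite (Suc k) z) + 2 * real (Suc k) * norm (hermite k z)"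
      unfolding 3 hermite_rec
      by (rule order_trans[OF norm_triangle_ineq4]) (simp add: norm_mult del: of_nat_Suc)
    also have "\<dots> \<le> 2 * R * (?s (Suc k) * ?P (Suc k)) + 2 * real (Suc k) * (?s k * ?P k)"
      using less[of "Suc k"] less[of k] 3 assms R by (intro add_mono mult_mono) auto
    also have "2 * R * (?s (Suc k) * ?P (Suc k)) = ?s m * ?P (Suc k) * (R * sqrt (2 / real (Suc (Suc k))))"
    proof -
      have "sqrt (2 * real (Suc (Suc k))) * sqrt (2 / real (Suc (Suc k))) = sqrt (2 * 2)"
        by (subst real_sqrt_mult[symmetric]) (simp del: of_nat_Suc)
      then have "sqrt (2 * real (Suc (Suc k))) * sqrt (2 / real (Suc (Suc k))) = 2"
        by (simp only: real_sqrt_mult_self) simp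
      then have "2 * R * (?s (Suc k) * ?P (Suc k)) = (sqrt (2 * real (Suc (Suc k))) * sqrt (2 / real (Suc (Suc k)))) * R * (?s (Suc k) * ?P (Suc k))"
        by simp
      then show ?thesis
        unfolding 3 s[of "Suc k"] by (simp only: mult_ac)
    qed
    also have "2 * real (Suc k) * (?s k * ?P k) \<le> ?s m * ?P (Suc k)"
    proof -
      have "2 * real (Suc k) * (?s k * ?P k) = sqrt (2 * real (Suc k)) * (?s (Suc k) * ?P k)"
        unfolding s by (simp flip: mult.assoc)
      also have "\<dots> \<le> sqrt (2 * real (Suc (Suc k))) * (?s (Suc k) * ?P (Suc k))"
        using Pmono R by (intro mult_mono) (auto simp: hermite_growth_nonneg)
      finally show ?thesis
        unfolding 3 s[of "Suc k"] by (simp only: mult_ac)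
    qed
    finally show ?thesis
      unfolding 3 P[of "Suc k"] by (simp add: algebra_simps)
  qed
qed

lemma hermite_growth_summable:
  assumes "0 \<le> u" "u < 1" "0 \<le> R"
  shows "summable (\<lambda>m. u ^ m * (hermite_growth R m)\<^sup>2)"
proof -
  have "(\<lambda>m. u * (1 + R * sqrt (2 / real (Suc m)))\<^sup>2) \<longlonglongrightarrow> u * (1 + R * sqrt 0)\<^sup>2"
    by (intro tendsto_intros filterlim_compose[OF lim_const_over_n filterlim_Suc])
  \<comment> \<open>The ratio of consecutive terms tends to \<open>u\<close>, and the midpoint of
    \<open>u\<close> and 1 is a convenient bound strictly between them.\<close>
  then have "eventually (\<lambda>m. u * (1 + R * sqrt (2 / real (Suc m)))\<^sup>2 < (u + 1) / 2) sequentially"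
    using assms by (intro order_tendstoD) auto
  then obtain N where N: "\<And>m. m \<ge> N \<Longrightarrow> u * (1 + R * sqrt (2 / real (Suc m)))\<^sup>2 < (u + 1) / 2"
    by (auto simp: eventually_sequentially)
  show ?thesis
  proof (rule summable_ratio_test[where N = N and c = "(u + 1) / 2"])
    show "norm (u ^ Suc m * (hermite_growth R (Suc m))\<^sup>2)
      \<le> (u + 1) / 2 * norm (u ^ m * (hermite_growth R m)\<^sup>2)" if "N \<le> m" for m
    proof -
      have "norm (u ^ Suc m * (hermite_growth R (Suc m))\<^sup>2)
          = u * (1 + R * sqrt (2 / real (Suc m)))\<^sup>2 * (u ^ m * (hermite_growth R m)\<^sup>2)"
        using assms by (simp add: hermite_growth_def power_mult_distrib del: of_nat_Suc)
      also have "\<dots> \<le> (u + 1) / 2 * (u ^ m * (hermite_growth R m)\<^sup>2)"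
        using N[OF that] assms by (intro mult_right_mono) auto
      finally show ?thesis
        using assms by simp
    qed
  qed (use assms in auto)
qed

section \<open>Mehler's formula\<close>

definition mehler_term :: "real \<Rightarrow> complex \<Rightarrow> nat \<Rightarrow> complex \<Rightarrow> complex" where
  "mehler_term u X m z = of_real (u ^ m / (2 ^ m * fact m)) * hermite m X * hermite m z"

lemma mehler_term_bound:
  assumes "0 \<le> u" "norm X \<le> R" "norm z \<le> R"
  shows "norm (mehler_term u X m z) \<le> u ^ m * (hermite_growth R m)\<^sup>2"
proof -
  let ?s = "sqrt (2 ^ m * fact m)"
  have R: "0 \<le> R" using assms norm_ge_zero[of z] by linarith
  have s: "?s * ?s = 2 ^ m * fact m"
    by simp
  have "norm (mehler_term u X m z) = u ^ m / (?s * ?s) * (norm (hermite m X) * norm (hermite m z))"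
    unfolding mehler_term_def s using assms by (simp add: norm_mult norm_divide norm_power)
  also have "\<dots> \<le> u ^ m / (?s * ?s) * ((?s * hermite_growth R m) * (?s * hermite_growth R m))"
    using assms R by (intro mult_left_mono mult_mono hermite_bound) (auto simp: hermite_growth_nonneg)
  also have "\<dots> = u ^ m * (hermite_growth R m)\<^sup>2"
  proof -
    have "?s \<noteq> 0" by simp
    then show ?thesis by (simp add: power2_eq_square divide_simps del: real_sqrt_mult_self)
  qed
  finally show ?thesis .
qed

lemma mehler_entire_family:
  assumes "0 \<le> u" "u < 1"
  shows "entire_family (mehler_term u X)"
  unfolding entire_family_def
proof (intro conjI allI)
  show "mehler_term u X m holomorphic_on UNIV" for m
    unfolding mehler_term_def[abs_def] by (intro holomorphic_intros hermite_holomorphic)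
  fix R :: real
  let ?R = "max R (norm X)"
  show "\<exists>M. summable M \<and> (\<forall>m z. norm z \<le> R \<longrightarrow> norm (mehler_term u X m z) \<le> M m)"
    using assms
    by (intro exI[of _ "\<lambda>m. u ^ m * (hermite_growth ?R m)\<^sup>2"] conjI allI impI
        hermite_growth_summable mehler_term_bound) (auto intro: order_trans[OF norm_ge_zero max.cobounded2])
qed

definition mehler :: "real \<Rightarrow> complex \<Rightarrow> complex \<Rightarrow> complex" where
  "mehler u X z = (\<Sum>m. mehler_term u X m z)"

lemma mehler_term_commute: "mehler_term u X m z = mehler_term u z m X"
  by (simp add: mehler_term_def)

lemma mehler_commute: "mehler u X z = mehler u z X"
  unfolding mehler_def by (rule arg_cong[of _ _ suminf]) (simp add: fun_eq_iff mehler_term_commute[of u X])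

text \<open>Differentiating in \<open>z\<close> lowers one index, and after a shift this gives
  \<open>u\<close> times the series \<open>N\<close> in which the other index is raised. The raising
  relation yields \<open>N X z = 2 X M - u N z X\<close> with \<open>M\<close> the Mehler sum. With
  the same identity for exchanged arguments this is a linear system for \<open>N\<close>, solvable
  since \<open>u\<close> is below 1; the result is a first-order differential equation.\<close>

lemma mehler_DERIV:
  assumes u: "0 \<le> u" "u < 1"
  shows "(mehler u X has_field_derivative
    of_real (2 * u / (1 - u\<^sup>2)) * (X - of_real u * z) * mehler u X z) (at z)"
proof -
  define N where "N = (\<lambda>X z. \<Sum>m. of_real (u ^ m / (2 ^ m * fact m)) * hermite (Suc m) X * hermite m z :: complex)"
  have d: "deriv (mehler_term u X m) z
      = of_real (u ^ m / (2 ^ m * fact m)) * hermite m X * (2 * of_nat m * hermite (m - 1) z)" for X z m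
    unfolding mehler_term_def[abs_def]
    by (intro DERIV_imp_deriv DERIV_cmult hermite_has_field_derivative)
  have sd: "summable (\<lambda>m. deriv (mehler_term u X m) z)" for X z
    using entire_family_summable[OF entire_family_deriv(1)[OF mehler_entire_family[OF u]]]
    by (rule summable_norm_cancel)
  have sm: "summable (\<lambda>m. mehler_term u X m z)" for X z
    using entire_family_summable[OF mehler_entire_family[OF u]] by (rule summable_norm_cancel)
  have d': "(\<Sum>m. deriv (mehler_term u X m) z) = of_real u * N X z"
    and sN: "u \<noteq> 0 \<Longrightarrow> summable (\<lambda>m. of_real (u ^ m / (2 ^ m * fact m)) * hermite (Suc m) X * hermite m z)"
    for X z
  proof -
    have e: "deriv (mehler_term u X (Suc m)) z
        = of_real u * (of_real (u ^ m / (2 ^ m * fact m)) * hermite (Suc m) X * hermite m z)" for m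
      unfolding d by (simp add: divide_simps del: of_nat_Suc)
    have s: "summable (\<lambda>m. of_real u * (of_real (u ^ m / (2 ^ m * fact m)) * hermite (Suc m) X * hermite m z))"
      using sd[of X z] unfolding e[symmetric] by (subst summable_Suc_iff)
    then show sN: "u \<noteq> 0 \<Longrightarrow> summable (\<lambda>m. of_real (u ^ m / (2 ^ m * fact m)) * hermite (Suc m) X * hermite m z)"
      by (subst (asm) summable_cmult_iff) auto
    have "(\<Sum>m. deriv (mehler_term u X m) z) = (\<Sum>m. deriv (mehler_term u X (Suc m)) z)"
      using suminf_split_head[OF sd[of X z]] by (simp add: d)
    also have "\<dots> = of_real u * N X z"
      unfolding e N_def
    \<comment> \<open>Summability of the series for \<open>N\<close> was obtained by dividing by
      \<open>u\<close>; for \<open>u = 0\<close> both sides vanish.\<close>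
    proof (cases "u = 0")
      case False
      show "(\<Sum>m. of_real u * (of_real (u ^ m / (2 ^ m * fact m)) * hermite (Suc m) X * hermite m z))
          = of_real u * (\<Sum>m. of_real (u ^ m / (2 ^ m * fact m)) * hermite (Suc m) X * hermite m z)"
        by (rule suminf_mult[OF sN[OF False]])
    qed simp
    finally show "(\<Sum>m. deriv (mehler_term u X m) z) = of_real u * N X z" .
  qed
  have "N X z = 2 * X * mehler u X z - of_real u * N z X" for X z
  proof -
    have "N X z = (\<Sum>m. 2 * X * mehler_term u X m z - deriv (mehler_term u z m) X)"
      unfolding N_def d hermite_Suc_deriv by (simp add: mehler_term_def algebra_simps)
    also have "\<dots> = 2 * X * mehler u X z - of_real u * N z X"
      unfolding mehler_def d'[symmetric] suminf_mult[OF sm, symmetric]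
      by (rule suminf_diff[symmetric, OF summable_mult[OF sm] sd])
    finally show ?thesis .
  qed
  from this[of X z] this[of z X] have "N X z * (1 - of_real u ^ 2) = 2 * (X - of_real u * z) * mehler u X z"
    by (simp add: algebra_simps power2_eq_square mehler_commute[of u z X])
  moreover have "1 - complex_of_real u ^ 2 \<noteq> 0"
  proof -
    have "u\<^sup>2 < 1" using u by (simp add: abs_square_less_1)
    then have "complex_of_real (1 - u\<^sup>2) \<noteq> 0"
      by (simp only: of_real_eq_0_iff)
    then show ?thesis by simp
  qed
  ultimately have "N X z = 2 * (X - of_real u * z) * mehler u X z / (1 - of_real u ^ 2)"
    by (simp add: nonzero_eq_divide_eq)
  then have N: "of_real u * N X z = of_real (2 * u / (1 - u\<^sup>2)) * (X - of_real u * z) * mehler u X z"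
    by (simp only:) (simp add: mult_ac)
  have "mehler u X = (\<lambda>z. \<Sum>m. mehler_term u X m z)"
    by (simp add: fun_eq_iff mehler_def)
  then have "(mehler u X has_field_derivative (\<Sum>m. deriv (mehler_term u X m) z)) (at z)"
    using holomorphic_derivI[OF entire_family_deriv(2)[OF mehler_entire_family[OF u]] open_UNIV UNIV_I]
      entire_family_deriv(3)[OF mehler_entire_family[OF u]] by auto
  then show ?thesis
    unfolding d' N .
qed

text \<open>The product with the reciprocal exponential has derivative zero by the differential
  equation, so it keeps its value at 0.\<close>

lemma mehler_right:
  assumes u: "0 \<le> u" "u < 1"
  shows "mehler u X z = mehler u X 0 * exp (of_real (2 * u / (1 - u\<^sup>2)) * (X * z - of_real u * z\<^sup>2 / 2))"
proof -
  let ?c = "complex_of_real (2 * u / (1 - u\<^sup>2))"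
  let ?e = "\<lambda>z. exp (- (?c * (X * z - of_real u * z\<^sup>2 / 2)))"
  have "((\<lambda>z. mehler u X z * ?e z) has_field_derivative 0) (at z within UNIV)" for z
    by (rule derivative_eq_intros mehler_DERIV[OF u] refl | simp)+
  then obtain k where k: "\<And>z. mehler u X z * ?e z = k"
    using has_field_derivative_zero_constant[of UNIV "\<lambda>z. mehler u X z * ?e z"] by auto
  from k[of z] k[of 0] have "mehler u X z * ?e z = mehler u X 0"
    by simp
  then show ?thesis
    by (simp add: exp_minus field_simps)
qed

text \<open>At 0 the odd Hermite polynomials vanish. Consecutive even terms have the ratio u^2 (2k +
  1) / (2k + 2), the one of the binomial series with exponent -1/2 at -u^2.\<close>

lemma mehler_0_0:
  assumes u: "0 \<le> u" "u < 1"
  shows "mehler u 0 0 = of_real ((1 - u\<^sup>2) powr (- 1 / 2))"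
proof -
  have odd: "hermite (Suc (2 * k)) (0::complex) = 0" for k
    by (induction k) (simp_all add: hermite_1 hermite_rec)
  have even: "mehler_term u 0 (2 * k) 0 = of_real (((- 1 / 2) gchoose k) * (- (u\<^sup>2)) ^ k)" for k
  proof (induction k)
    case 0
    then show ?case by (simp add: mehler_term_def hermite_0)
  next
    case (Suc k)
    have h: "hermite (2 * Suc k) (0::complex) = - 2 * of_nat (Suc (2 * k)) * hermite (2 * k) 0"
      by (simp add: hermite_rec algebra_simps)
    have f: "fact (2 * Suc k) = real (2 * Suc k) * (real (Suc (2 * k)) * fact (2 * k))"
      by (simp add: algebra_simps)
    have g: "((- 1 / 2) gchoose Suc k) = (- 1 / 2 - real k) / real (Suc k) * ((- 1 / 2) gchoose k)"
      using gbinomial_mult_1[of "- 1 / 2 :: real" k] by (simp add: field_simps del: of_nat_Suc)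
    have "mehler_term u 0 (2 * Suc k) 0
        = of_real (u\<^sup>2 * (real (Suc (2 * k)) / real (2 * Suc k))) * mehler_term u 0 (2 * k) 0"
      unfolding mehler_term_def h f
      by (simp add: divide_simps power2_eq_square del: of_nat_Suc)
    also have "\<dots> = of_real (u\<^sup>2 * (real (Suc (2 * k)) / real (2 * Suc k)) * (((- 1 / 2) gchoose k) * (- (u\<^sup>2)) ^ k))"
      unfolding Suc by simp
    also have "u\<^sup>2 * (real (Suc (2 * k)) / real (2 * Suc k)) * (((- 1 / 2) gchoose k) * (- (u\<^sup>2)) ^ k)
        = ((- 1 / 2) gchoose Suc k) * (- (u\<^sup>2)) ^ Suc k"
      unfolding g by (simp add: field_simps)
    finally show ?case .
  qed
  have "\<bar>- (u\<^sup>2)\<bar> < 1" using u by (simp add: abs_square_less_1)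
  then have "(\<lambda>k. ((- 1 / 2) gchoose k) * (- (u\<^sup>2)) ^ k) sums (1 + - (u\<^sup>2)) powr (- 1 / 2)"
    by (rule gen_binomial_real)
  then have "(\<lambda>k. mehler_term u 0 (2 * k) 0) sums of_real ((1 - u\<^sup>2) powr (- 1 / 2))"
    unfolding even by (subst sums_of_real_iff) simp
  moreover have "mehler_term u 0 n 0 = 0" if "n \<notin> range (\<lambda>k. 2 * k)" for n
  proof -
    have "odd n" using that by auto
    then show ?thesis by (auto simp: mehler_term_def odd elim!: oddE)
  qed
  ultimately have "(\<lambda>n. mehler_term u 0 n 0) sums of_real ((1 - u\<^sup>2) powr (- 1 / 2))"
    using sums_mono_reindex[of "\<lambda>k. 2 * k" "\<lambda>n. mehler_term u 0 n 0"] by (auto simp: strict_mono_def)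
  then show ?thesis
    unfolding mehler_def by (simp add: sums_iff)
qed

text \<open>Solving the differential equation in \<open>z\<close> reduces to \<open>z = 0\<close>;
  by symmetry the same solution in \<open>X\<close> then reduces to the value at the origin.\<close>

theorem mehler_formula:
  assumes u: "0 \<le> u" "u < 1"
  shows "mehler u X z = of_real ((1 - u\<^sup>2) powr (- 1 / 2))
    * exp ((2 * of_real u * X * z - of_real (u\<^sup>2) * (X\<^sup>2 + z\<^sup>2)) / of_real (1 - u\<^sup>2))"
proof -
  have "u\<^sup>2 < 1" using u by (simp add: abs_square_less_1)
  then have nz: "complex_of_real (1 - u\<^sup>2) \<noteq> 0"
    by (simp only: of_real_eq_0_iff)
  have "mehler u X 0 = mehler u 0 0 * exp (of_real (2 * u / (1 - u\<^sup>2)) * (0 * X - of_real u * X\<^sup>2 / 2))"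
    unfolding mehler_commute[of u X 0] by (rule mehler_right[OF u])
  then have "mehler u X z = mehler u 0 0 *
    exp (of_real (2 * u / (1 - u\<^sup>2)) * (0 * X - of_real u * X\<^sup>2 / 2)
      + of_real (2 * u / (1 - u\<^sup>2)) * (X * z - of_real u * z\<^sup>2 / 2))"
    unfolding exp_add using mehler_right[OF u, of X z] by simp
  also have "of_real (2 * u / (1 - u\<^sup>2)) * (0 * X - of_real u * X\<^sup>2 / 2)
      + of_real (2 * u / (1 - u\<^sup>2)) * (X * z - of_real u * z\<^sup>2 / 2)
    = (2 * of_real u * X * z - of_real (u\<^sup>2) * (X\<^sup>2 + z\<^sup>2)) / of_real (1 - u\<^sup>2)"
    unfolding of_real_divide using nz by (simp add: divide_simps) (simp add: algebra_simps power2_eq_square)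
  finally show ?thesis
    unfolding mehler_0_0[OF u] .
qed

section \<open>Integration by parts with a cutoff\<close>

lemma integrable_lborel_support:
  fixes g :: "complex \<Rightarrow> 'a::{banach, second_countable_topology}"
  assumes "continuous_on UNIV g" "\<And>z. norm z > R \<Longrightarrow> g z = 0"
  shows "integrable lborel g"
proof -
  have "integrable lborel (\<lambda>z. indicator (cball 0 R) z *\<^sub>R g z)"
    using assms by (intro borel_integrable_compact) (auto intro: continuous_on_subset)
  moreover have "(\<lambda>z. indicator (cball 0 R) z *\<^sub>R g z) = g"
    using assms(2) by (auto simp: fun_eq_iff indicator_def)
  ultimately show ?thesis by simp
qed

lemma integral_lborel_translation:
  fixes g :: "complex \<Rightarrow> 'a::{banach, second_countable_topology}"
  assumes "g \<in> borel_measurable borel"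
  shows "(LINT z|lborel. g (c + z)) = (LINT z|lborel. g z)"
proof -
  have "(LINT z|lborel. g z) = (LINT z|distr lborel borel ((+) c). g z)"
    by (simp add: lborel_distr_plus)
  also have "\<dots> = (LINT z|lborel. g (c + z))"
    using assms by (intro integral_distr) auto
  finally show ?thesis by simp
qed

text \<open>The difference quotients integrate to \<open>0\<close> by translation invariance.\<close>

lemma integral_directional_derivative:
  fixes g a b :: "complex \<Rightarrow> complex"
  assumes g: "\<And>z. has_wirt g (a z) (b z) z"
    and cont: "continuous_on UNIV a" "continuous_on UNIV b"
    and supp: "\<And>z. norm z > R \<Longrightarrow> g z = 0" "\<And>z. norm z > R \<Longrightarrow> a z = 0" "\<And>z. norm z > R \<Longrightarrow> b z = 0"
    and v: "norm v = 1"
  shows "(LINT z|lborel. a z * v + b z * cnj v) = 0"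
proof -
  have "continuous_on UNIV g"
    using g unfolding has_wirt_def
    by (intro continuous_at_imp_continuous_on ballI has_derivative_continuous)
  note gc = this
  have gm: "g \<in> borel_measurable borel"
    using gc by (rule borel_measurable_continuous_onI)
  have gi: "integrable lborel g"
    using gc supp(1) by (rule integrable_lborel_support)
  obtain K where K: "\<And>z. norm (a z) + norm (b z) \<le> K" "K \<ge> 0"
  proof -
    have "compact ((\<lambda>z. norm (a z) + norm (b z)) ` cball 0 R)"
      using cont by (intro compact_continuous_image continuous_intros) (auto intro: continuous_on_subset)
    then have "bounded ((\<lambda>z. norm (a z) + norm (b z)) ` cball 0 R)"
      by (rule compact_imp_bounded)
    then obtain K where K: "\<And>z. z \<in> cball 0 R \<Longrightarrow> norm (norm (a z) + norm (b z)) \<le> K"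
      unfolding bounded_iff by blast
    have "norm (a z) + norm (b z) \<le> max K 0" for z
      using K[of z] supp(2,3)[of z] by (cases "norm z > R") auto
    then show ?thesis
      by (intro that[of "max K 0"]) auto
  qed
  \<comment> \<open>This Lipschitz constant bounds all difference quotients uniformly, which
    provides the dominating function.\<close>
  have lip: "norm (g y - g x) \<le> K * norm (y - x)" for x y
  proof (rule differentiable_bound[of UNIV])
    show "(g has_derivative (\<lambda>h. a z * h + b z * cnj h)) (at z within UNIV)" for z
      using g[of z] by (simp add: has_wirt_def)
    show "onorm (\<lambda>h. a z * h + b z * cnj h) \<le> K" for z
    proof (rule onorm_le)
      fix h
      have "norm (a z * h + b z * cnj h) \<le> (norm (a z) + norm (b z)) * norm h"
        by (rule order_trans[OF norm_triangle_ineq]) (simp add: norm_mult algebra_simps)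
      also have "\<dots> \<le> K * norm h"
        by (intro mult_right_mono K) auto
      finally show "norm (a z * h + b z * cnj h) \<le> K * norm h" .
    qed
  qed auto
  \<comment> \<open>The steps have length at most 1, so all quotients vanish outside the disc of
    radius \<open>R + 1\<close>.\<close>
  define q where "q = (\<lambda>k z. (g (of_real (1 / real (Suc k)) * v + z) - g z) * of_nat (Suc k))"
  have "(\<lambda>k. LINT z|lborel. q k z) \<longlonglongrightarrow> (LINT z|lborel. a z * v + b z * cnj v)"
  proof (rule integral_dominated_convergence)
    show "(\<lambda>z. a z * v + b z * cnj v) \<in> borel_measurable lborel"
      using cont by (simp, intro borel_measurable_continuous_onI continuous_intros)
    show "q k \<in> borel_measurable lborel" for k
      unfolding q_def using gm by measurable
    show "integrable lborel (\<lambda>z::complex. K * indicator (cball 0 (R + 1)) z :: real)"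
      using emeasure_bounded_finite[of "cball 0 (R + 1) :: complex set"]
      by (intro integrable_mult_right integrable_real_indicator) auto
    show "AE z in lborel. (\<lambda>k. q k z) \<longlonglongrightarrow> a z * v + b z * cnj v"
    proof (intro always_eventually allI)
      fix z
      let ?t = "\<lambda>k. 1 / real (Suc k)"
      let ?d = "a z * v + b z * cnj v" and ?G = "\<lambda>t. g (z + of_real t * v)"
      have 1: "((\<lambda>t. z + of_real t * v) has_derivative (\<lambda>r. of_real r * v)) (at 0)"
        by (auto intro!: derivative_eq_intros)
      have 2: "(g has_derivative (\<lambda>h. a z * h + b z * cnj h)) (at (z + of_real 0 * v))"
        using g[of z] by (simp add: has_wirt_def)
      have "(\<lambda>r. a z * (of_real r * v) + b z * cnj (of_real r * v)) = (\<lambda>r. r *\<^sub>R ?d)"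
        by (simp add: fun_eq_iff scaleR_conv_of_real algebra_simps)
      with has_derivative_compose[OF 1 2] have "(?G has_derivative (\<lambda>r. r *\<^sub>R ?d)) (at 0)"
        by simp
      then have L: "((\<lambda>t. norm (?G (0 + t) - ?G 0 - t *\<^sub>R ?d) / norm t) \<longlongrightarrow> 0) (at 0)"
        by (simp only: has_derivative_at)
      have "norm (?G (0 + t) - ?G 0 - t *\<^sub>R ?d) / norm t = norm ((?G t - ?G 0) /\<^sub>R t - ?d)"
        if "t \<noteq> 0" for t
      proof -
        have "(?G t - ?G 0) /\<^sub>R t - ?d = (?G t - ?G 0 - t *\<^sub>R ?d) /\<^sub>R t"
          using that by (simp add: scaleR_diff_right)
        then show ?thesis
          by (simp only: norm_scaleR) (simp add: divide_inverse)
      qed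
      then have "((\<lambda>t. norm ((?G t - ?G 0) /\<^sub>R t - ?d)) \<longlongrightarrow> 0) (at 0)"
        by (intro Lim_transform_eventually[OF L]) (simp add: eventually_at_filter)
      then have "((\<lambda>t. (g (z + of_real t * v) - g z) /\<^sub>R t) \<longlongrightarrow> ?d) (at 0)"
        by (simp add: tendsto_norm_zero_iff LIM_zero_iff)
      then have lim: "((\<lambda>k. (g (z + of_real (?t k) * v) - g z) /\<^sub>R ?t k) \<longlonglongrightarrow> a z * v + b z * cnj v)"
      proof (rule filterlim_compose)
        show "filterlim ?t (at 0) sequentially"
          using LIMSEQ_inverse_real_of_nat by (simp add: filterlim_at inverse_eq_divide)
      qed
      moreover have "(g (z + of_real (?t k) * v) - g z) /\<^sub>R ?t k = q k z" for k
        by (simp add: q_def scaleR_conv_of_real add.commute mult.commute)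
      ultimately show "(\<lambda>k. q k z) \<longlonglongrightarrow> a z * v + b z * cnj v"
        by simp
    qed
    show "AE z in lborel. norm (q k z) \<le> K * indicator (cball 0 (R + 1)) z" for k
    proof (intro always_eventually allI)
      fix z
      define t where "t = 1 / real (Suc k)"
      have t: "0 < t" "t \<le> 1" "t * real (Suc k) = 1"
        by (simp_all add: t_def)
      let ?h = "of_real t * v"
      have nh: "norm ?h = t"
        using t by (simp add: norm_mult v)
      have q: "q k z = (g (?h + z) - g z) * of_nat (Suc k)"
        by (simp only: q_def t_def)
      show "norm (q k z) \<le> K * indicator (cball 0 (R + 1)) z"
      proof (cases "norm z \<le> R + 1")
        case True
        have "norm (q k z) \<le> K * norm ?h * real (Suc k)"
          unfolding q norm_mult[of "g (?h + z) - g z"] norm_of_nat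
          using lip[of "?h + z" z] by (intro mult_right_mono) auto
        also have "\<dots> = K"
          unfolding nh mult.assoc t(3) by simp
        finally show ?thesis using True by simp
      next
        case False
        have "norm (?h + z) > R"
          using False norm_diff_ineq[of z ?h] nh t by (simp add: add.commute)
        with False show ?thesis
          by (simp add: q supp(1))
      qed
    qed
  qed
  moreover have "(LINT z|lborel. q k z) = 0" for k
  proof -
    let ?h = "of_real (1 / real (Suc k)) * v"
    have gi': "integrable lborel (\<lambda>z. g (?h + z))"
    proof (rule integrable_lborel_support)
      show "continuous_on UNIV (\<lambda>z. g (?h + z))"
        by (rule continuous_on_compose2[OF gc]) (auto intro!: continuous_intros)
      show "g (?h + z) = 0" if "norm z > R + norm ?h" for z
        using that norm_diff_ineq[of z ?h] by (intro supp(1)) (simp add: add.commute)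
    qed
    show ?thesis
      unfolding q_def using gi gi' integral_lborel_translation[OF gm, of ?h] by simp
  qed
  ultimately show ?thesis
    by (simp add: LIMSEQ_const_iff)
qed

text \<open>The directions 1 and \<open>\<i>\<close> show that the sum and the difference of the two
  integrals vanish.\<close>

lemma integral_wirt_zero:
  fixes g a b :: "complex \<Rightarrow> complex"
  assumes g: "\<And>z. has_wirt g (a z) (b z) z"
    and cont: "continuous_on UNIV a" "continuous_on UNIV b"
    and supp: "\<And>z. norm z > R \<Longrightarrow> g z = 0" "\<And>z. norm z > R \<Longrightarrow> a z = 0" "\<And>z. norm z > R \<Longrightarrow> b z = 0"
  shows "(LINT z|lborel. a z) = 0" "(LINT z|lborel. b z) = 0"
proof -
  have i: "integrable lborel a" "integrable lborel b"
    using cont supp by (auto intro: integrable_lborel_support)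
  have "(LINT z|lborel. a z * 1 + b z * cnj 1) = 0" "(LINT z|lborel. a z * \<i> + b z * cnj \<i>) = 0"
    using integral_directional_derivative[OF g cont supp, where v = 1]
      integral_directional_derivative[OF g cont supp, where v = \<i>] by simp_all
  then have "(LINT z|lborel. a z) + (LINT z|lborel. b z) = 0"
    "(LINT z|lborel. a z) * \<i> + (LINT z|lborel. b z) * cnj \<i> = 0"
    using i by (simp_all only: Bochner_Integration.integral_add[OF integrable_mult_left integrable_mult_left]
        integral_mult_left_zero) simp_all
  then have "(LINT z|lborel. a z) + (LINT z|lborel. b z) = 0"
    "((LINT z|lborel. a z) - (LINT z|lborel. b z)) * \<i> = 0"
    by (simp_all add: algebra_simps)
  then show "(LINT z|lborel. a z) = 0" "(LINT z|lborel. b z) = 0"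
    by (simp_all add: add_eq_0_iff)
qed

text \<open>The square makes the cutoff continuously differentiable across the circle of radius
  \<open>R\<close>. It also bounds the gradient by a multiple of \<open>sqrt (cutoff R z)\<close>
  (see \<open>cutoff_deriv_bound\<close>), the property that lets the error be absorbed in
  \<open>caccioppoli\<close>.\<close>

definition cutoff :: "real \<Rightarrow> complex \<Rightarrow> real" where
  "cutoff R z = (max 0 (1 - (norm z)\<^sup>2 / R\<^sup>2))\<^sup>2"

text \<open>The derivative of the profile with respect to the squared norm; the Wirtinger
  derivatives carry the further factors \<open>cnj z\<close> and z.\<close>

definition cutoff_deriv :: "real \<Rightarrow> complex \<Rightarrow> real" where
  "cutoff_deriv R z = - (2 / R\<^sup>2) * max 0 (1 - (norm z)\<^sup>2 / R\<^sup>2)"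

lemma max_square_has_real_derivative:
  "((\<lambda>x. (max 0 x)\<^sup>2) has_real_derivative 2 * max 0 x) (at (x::real))"
proof -
  consider "x > 0" | "x < 0" | "x = 0" by linarith
  then show ?thesis
  proof cases
    case 1
    have "((\<lambda>x. x\<^sup>2) has_real_derivative 2 * max 0 x) (at x)"
      using 1 by (auto intro!: derivative_eq_intros)
    then show ?thesis
      by (rule has_field_derivative_transform_within_open[of _ _ _ "{0<..}"]) (use 1 in auto)
  next
    case 2
    have "((\<lambda>x. 0) has_real_derivative 2 * max 0 x) (at x)"
      using 2 by simp
    then show ?thesis
      by (rule has_field_derivative_transform_within_open[of _ _ _ "{..<0}"]) (use 2 in auto)
  next
    case 3
    have "((\<lambda>h::real. (max 0 h)\<^sup>2 / h) \<longlongrightarrow> 0) (at 0)"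
    proof (rule Lim_null_comparison)
      show "\<forall>\<^sub>F h::real in at 0. norm ((max 0 h)\<^sup>2 / h) \<le> \<bar>h\<bar>"
        by (intro always_eventually allI) (auto simp: max_def power2_eq_square)
      show "((\<lambda>h::real. \<bar>h\<bar>) \<longlongrightarrow> 0) (at 0)"
        by (intro tendsto_rabs_zero tendsto_ident_at)
    qed
    then show ?thesis
      using 3 by (simp add: DERIV_def)
  qed
qed

lemma has_wirt_cutoff:
  fixes z :: complex
  shows "has_wirt (\<lambda>z. complex_of_real (cutoff R z)) (cutoff_deriv R z * cnj z) (cutoff_deriv R z * z) z"
proof -
  have "((\<lambda>r. (max 0 (1 - r / R\<^sup>2))\<^sup>2) has_real_derivative
      2 * max 0 (1 - (norm z)\<^sup>2 / R\<^sup>2) * (- 1 / R\<^sup>2)) (at ((norm z)\<^sup>2))"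
    by (rule DERIV_chain2[OF max_square_has_real_derivative])
      (use DERIV_diff[OF DERIV_const DERIV_cdivide[OF DERIV_ident]] in simp)
  from has_wirt_radial[OF this] show ?thesis
    unfolding cutoff_def cutoff_deriv_def by (rule has_wirt_unique) simp_all
qed

lemma cutoff_nonneg: "0 \<le> cutoff R z" and cutoff_le_1: "cutoff R z \<le> 1"
proof -
  show "0 \<le> cutoff R z" by (simp add: cutoff_def)
  have "max 0 (1 - (norm z)\<^sup>2 / R\<^sup>2) \<le> 1" by simp
  then show "cutoff R z \<le> 1"
    unfolding cutoff_def by (intro power_le_one) auto
qed

lemma cutoff_continuous: "continuous_on A (cutoff R)" "continuous_on A (cutoff_deriv R)"
  unfolding cutoff_def cutoff_deriv_def by (auto intro!: continuous_intros simp: divide_inverse)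

lemma cutoff_support:
  assumes "0 < R" "norm z > R"
  shows "cutoff R z = 0" "cutoff_deriv R z = 0"
proof -
  have "R\<^sup>2 < (norm z)\<^sup>2" using assms by (intro power_strict_mono) auto
  then have "max 0 (1 - (norm z)\<^sup>2 / R\<^sup>2) = 0"
    using assms by (simp add: field_simps)
  then show "cutoff R z = 0" "cutoff_deriv R z = 0"
    by (simp_all add: cutoff_def cutoff_deriv_def)
qed

lemma cutoff_deriv_bound:
  assumes "0 < R"
  shows "\<bar>cutoff_deriv R z\<bar> * norm z \<le> 2 / R * sqrt (cutoff R z)"
proof (cases "norm z > R")
  case True
  then show ?thesis using assms cutoff_support by simp
next
  case False
  let ?m = "max 0 (1 - (norm z)\<^sup>2 / R\<^sup>2)"
  have "\<bar>cutoff_deriv R z\<bar> * norm z = 2 / R * ?m * (norm z / R)"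
    by (simp add: cutoff_deriv_def abs_mult power2_eq_square)
  also have "\<dots> \<le> 2 / R * ?m * 1"
    using False assms by (intro mult_left_mono mult_nonneg_nonneg) (auto simp del: max_def)
  also have "?m = sqrt (cutoff R z)"
    by (simp add: cutoff_def)
  finally show ?thesis by simp
qed

lemma cutoff_mono:
  assumes "0 < R" "R \<le> S"
  shows "cutoff R z \<le> cutoff S z"
proof -
  have "(norm z)\<^sup>2 / S\<^sup>2 \<le> (norm z)\<^sup>2 / R\<^sup>2"
    using assms by (intro divide_left_mono power_mono mult_pos_pos) auto
  then show ?thesis
    unfolding cutoff_def by (intro power_mono) auto
qed

text \<open>The radii start at 2, which keeps them positive and within the range of the a priori
  bound in \<open>caccioppoli\<close>.\<close>

lemma cutoff_tendsto: "(\<lambda>k. cutoff (real (k + 2)) z) \<longlonglongrightarrow> 1"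
proof -
  have "(\<lambda>k. 1 / real (k + 2)) \<longlonglongrightarrow> 0"
    using LIMSEQ_Suc[OF LIMSEQ_inverse_real_of_nat] by (simp add: inverse_eq_divide)
  then have "(\<lambda>k. (max 0 (1 - (norm z)\<^sup>2 * (1 / real (k + 2))\<^sup>2))\<^sup>2) \<longlonglongrightarrow> (max 0 (1 - (norm z)\<^sup>2 * 0\<^sup>2))\<^sup>2"
    by (intro tendsto_intros)
  then show ?thesis
    by (simp add: cutoff_def power_divide)
qed

lemma integrable_cutoff:
  fixes f :: "complex \<Rightarrow> 'a::{banach, second_countable_topology}"
  assumes "continuous_on UNIV f" "0 < R"
  shows "integrable lborel (\<lambda>z. cutoff R z *\<^sub>R f z)" "integrable lborel (\<lambda>z. cutoff_deriv R z *\<^sub>R f z)"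
  by (rule integrable_lborel_support[of _ R];
      use assms cutoff_support in \<open>auto intro!: continuous_intros cutoff_continuous\<close>)+

lemma cutoff_integral_tendsto:
  assumes "integrable lborel f" and "\<And>z. 0 \<le> f z"
  shows "(\<lambda>k. LINT z|lborel. cutoff (real (k + 2)) z * f z) \<longlonglongrightarrow> (LINT z|lborel. f z)"
proof (rule integral_dominated_convergence)
  have "cutoff R \<in> borel_measurable borel" for R
    by (intro borel_measurable_continuous_onI cutoff_continuous)
  then show "(\<lambda>z. cutoff (real (k + 2)) z * f z) \<in> borel_measurable lborel" for k
    using assms(1) by (intro borel_measurable_times) auto
  show "AE z in lborel. (\<lambda>k. cutoff (real (k + 2)) z * f z) \<longlonglongrightarrow> f z"
    by (intro always_eventually allI) (use tendsto_mult_right[OF cutoff_tendsto] in simp)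
  show "AE z in lborel. norm (cutoff (real (k + 2)) z * f z) \<le> f z" for k
    by (intro always_eventually allI)
      (simp add: abs_mult cutoff_nonneg assms(2) mult_left_le_one_le cutoff_le_1)
qed (use assms in auto)

text \<open>Monotone convergence in the growing cutoffs. Here integrability is a conclusion, whereas
  \<open>cutoff_integral_tendsto\<close> starts from it.\<close>

lemma cutoff_integral_limit:
  assumes c: "continuous_on UNIV f" and p: "\<And>z. 0 \<le> f z"
    and L: "(\<lambda>k. LINT z|lborel. cutoff (real (k + 2)) z * f z) \<longlonglongrightarrow> L"
  shows "integrable lborel f" "(LINT z|lborel. f z) = L"
proof -
  have i: "integrable lborel (\<lambda>z. cutoff (real (k + 2)) z * f z)" for k
    using integrable_cutoff(1)[OF c, of "real (k + 2)"] by simp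
  have m: "AE z in lborel. mono (\<lambda>k. cutoff (real (k + 2)) z * f z)"
    by (intro always_eventually allI monoI mult_right_mono cutoff_mono p) auto
  have l: "AE z in lborel. (\<lambda>k. cutoff (real (k + 2)) z * f z) \<longlonglongrightarrow> f z"
    by (intro always_eventually allI) (use tendsto_mult_right[OF cutoff_tendsto] in simp)
  have "f \<in> borel_measurable lborel"
    using c by (simp add: borel_measurable_continuous_onI)
  note hb = has_bochner_integral_monotone_convergence[OF i m l L this]
  show "integrable lborel f"
    using hb by (rule integrable.intros)
  show "(LINT z|lborel. f z) = L"
    using hb by (rule has_bochner_integral_integral_eq)
qed

text \<open>The function spaces are built on the completed measure \<open>lebesgue\<close>; for
  continuous integrands all computations can be done over \<open>lborel\<close>.\<close>

lemma density_lebesgue_continuous: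
  fixes f :: "'b::euclidean_space \<Rightarrow> 'a::{banach, second_countable_topology}"
  assumes f: "continuous_on UNIV f" and w: "continuous_on UNIV w" "\<And>x. 0 \<le> w x"
  shows "integrable (density lebesgue (\<lambda>x. ennreal (w x))) f \<longleftrightarrow> integrable lborel (\<lambda>x. w x *\<^sub>R f x)"
    and "(LINT x|density lebesgue (\<lambda>x. ennreal (w x)). f x) = (LINT x|lborel. w x *\<^sub>R f x)"
proof -
  have m: "f \<in> borel_measurable borel" "w \<in> borel_measurable borel"
    using f w by (auto intro: borel_measurable_continuous_onI)
  then have ml: "f \<in> borel_measurable lebesgue" "w \<in> borel_measurable lebesgue"
    "(\<lambda>x. w x *\<^sub>R f x) \<in> borel_measurable lborel"
    by (auto intro: measurable_completion)
  show "integrable (density lebesgue (\<lambda>x. ennreal (w x))) f \<longleftrightarrow> integrable lborel (\<lambda>x. w x *\<^sub>R f x)"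
    using ml w(2) by (subst integrable_density) (auto simp: integrable_completion)
  show "(LINT x|density lebesgue (\<lambda>x. ennreal (w x)). f x) = (LINT x|lborel. w x *\<^sub>R f x)"
    using ml w(2) by (subst integral_density) (auto simp: integral_completion)
qed

lemma density_lebesgue_measurable:
  fixes f :: "'b::euclidean_space \<Rightarrow> 'a::topological_space"
  shows "f \<in> borel_measurable borel \<Longrightarrow> f \<in> borel_measurable (density lebesgue w)"
  by (simp add: measurable_completion)

section \<open>Ladder operators between the eigenspaces\<close>

definition gauss :: "real \<Rightarrow> complex \<Rightarrow> real" where
  "gauss \<nu> z = exp (- \<nu> * (norm z)\<^sup>2)"

definition fock_norm2 :: "real \<Rightarrow> (complex \<Rightarrow> complex) \<Rightarrow> real" where
  "fock_norm2 \<nu> F = (LINT z|lborel. (norm (F z))\<^sup>2 * gauss \<nu> z)"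

lemma gauss_pos: "0 < gauss \<nu> z"
  by (simp add: gauss_def)

lemma gauss_continuous: "continuous_on A (gauss \<nu>)"
  unfolding gauss_def by (intro continuous_intros)

lemma Fock_iff:
  "F \<in> Fock \<nu> n \<longleftrightarrow> smooth F \<and> integrable lborel (\<lambda>z. (norm (F z))\<^sup>2 * gauss \<nu> z) \<and>
     (\<forall>z. nabla \<nu> 0 (wirt_bar F) z = of_nat n * complex_of_real \<nu> * F z)"
proof -
  have ml: "magnetic_laplacian \<nu> F = nabla \<nu> 0 (wirt_bar F)"
    by (rule ext) (simp add: magnetic_laplacian_def nabla_def)
  have "F \<in> L2 (gauss_complex \<nu>) \<longleftrightarrow> integrable lborel (\<lambda>z. (norm (F z))\<^sup>2 * gauss \<nu> z)" if "smooth F"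
  proof -
    have d: "gauss_complex \<nu> = density lebesgue (\<lambda>z. ennreal (gauss \<nu> z))"
      by (simp add: gauss_complex_def gauss_def)
    have c: "continuous_on UNIV F" using that by (rule smooth_continuous)
    then have "F \<in> borel_measurable (gauss_complex \<nu>)"
      unfolding d by (intro density_lebesgue_measurable borel_measurable_continuous_onI)
    moreover have "continuous_on UNIV (\<lambda>z. (norm (F z))\<^sup>2)"
      using c by (intro continuous_intros)
    ultimately show ?thesis
      unfolding L2_def d
      by (simp add: density_lebesgue_continuous(1) gauss_continuous less_imp_le[OF gauss_pos] mult.commute)
  qed
  then show ?thesis
    unfolding Fock_def ml mem_Collect_eq by (cases "smooth F") simp_all
qed

text \<open>The \<open>wirt\<close> derivative of \<open>F * cnj G\<close> times weight and cutoff
  has integral zero. Differentiating the Gaussian supplies the term \<nu> \<open>cnj z\<close> of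
  \<open>nabla\<close>, so \<open>A\<close> is adjoint to \<open>D\<close> up to a term with the
  derivative of the cutoff.\<close>

lemma cutoff_adjoint:
  assumes F: "smooth F" and G: "smooth G" and R: "0 < R"
  shows "(LINT z|lborel. cutoff R z *\<^sub>R (nabla \<nu> 0 F z * cnj (G z) * gauss \<nu> z))
    = (LINT z|lborel. cutoff R z *\<^sub>R (F z * cnj (wirt_bar G z) * gauss \<nu> z))
    + (LINT z|lborel. cutoff_deriv R z *\<^sub>R (cnj z * F z * cnj (G z) * gauss \<nu> z))"
proof -
  let ?W = "\<lambda>z. complex_of_real (gauss \<nu> z)" and ?c = "\<lambda>z. complex_of_real (cutoff R z)"
  let ?d = "\<lambda>z. complex_of_real (cutoff_deriv R z)"
  note cont = smooth_continuous[OF F] smooth_continuous[OF G] smooth_continuous[OF smooth_wirt[OF F]]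
    smooth_continuous[OF smooth_wirt[OF G]]
    smooth_continuous[OF smooth_wirt_bar[OF F]] smooth_continuous[OF smooth_wirt_bar[OF G]]
    gauss_continuous cutoff_continuous smooth_continuous[OF smooth_nabla[OF F]]
  let ?a = "\<lambda>z. ?c z * (F z * cnj (wirt_bar G z) * ?W z) + ?d z * (cnj z * F z * cnj (G z) * ?W z)
      - ?c z * (nabla \<nu> 0 F z * cnj (G z) * ?W z)"
  let ?b = "\<lambda>z. ?c z * (wirt_bar F z * cnj (G z) * ?W z) + ?c z * (F z * cnj (wirt G z) * ?W z)
      + ?d z * (z * F z * cnj (G z) * ?W z) - complex_of_real \<nu> * z * ?c z * (F z * cnj (G z) * ?W z)"
  have "has_wirt (\<lambda>z. ?W z * (F z * (cnj (G z) * ?c z))) (?a z) (?b z) z" for z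
    unfolding gauss_def
    by (rule has_wirt_unique,
        rule has_wirt_mult[OF has_wirt_gauss has_wirt_mult[OF smooth_has_wirt[OF F]
            has_wirt_mult[OF has_wirt_cnj[OF smooth_has_wirt[OF G]] has_wirt_cutoff]]])
      (simp_all add: nabla_def algebra_simps)
  then have "(LINT z|lborel. ?a z) = 0"
    by (rule integral_wirt_zero(1)[where R = R])
      (auto intro!: continuous_intros cont simp: cutoff_support[OF R])
  moreover have "integrable lborel (\<lambda>z. ?c z * (F z * cnj (wirt_bar G z) * ?W z))"
    "integrable lborel (\<lambda>z. ?c z * (nabla \<nu> 0 F z * cnj (G z) * ?W z))"
    "integrable lborel (\<lambda>z. ?d z * (cnj z * F z * cnj (G z) * ?W z))"
    by (rule integrable_lborel_support[of _ R];
        use cutoff_support[OF R] in \<open>auto intro!: continuous_intros cont\<close>)+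
  ultimately show ?thesis
    by (simp add: scaleR_conv_of_real)
qed

lemma integral_cutoff_square:
  "(LINT z|lborel. cutoff R z *\<^sub>R (F z * cnj (F z) * complex_of_real (gauss \<nu> z)))
    = complex_of_real (LINT z|lborel. cutoff R z * ((norm (F z))\<^sup>2 * gauss \<nu> z))"
  unfolding integral_complex_of_real[symmetric]
  by (rule Bochner_Integration.integral_cong)
    (auto simp: scaleR_conv_of_real complex_norm_square mult.assoc simp del: of_real_power)

text \<open>Caccioppoli argument: the cutoff error is absorbed since the cutoff dominates the square of its
  own gradient up to the factor \<open>4 / R\<^sup>2\<close>.\<close>

lemma caccioppoli:
  assumes F: "continuous_on UNIV F" and G: "continuous_on UNIV G"
    and iF: "integrable lborel (\<lambda>z. (norm (F z))\<^sup>2 * gauss \<nu> z)" and "0 \<le> c"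
    and est: "\<And>R. 0 < R \<Longrightarrow>
      norm ((LINT z|lborel. cutoff R z *\<^sub>R (G z * cnj (G z) * complex_of_real (gauss \<nu> z)))
        - complex_of_real c * (LINT z|lborel. cutoff R z *\<^sub>R (F z * cnj (F z) * complex_of_real (gauss \<nu> z))))
      \<le> (LINT z|lborel. \<bar>cutoff_deriv R z\<bar> * (norm z * norm (F z) * norm (G z) * gauss \<nu> z))"
  shows "integrable lborel (\<lambda>z. (norm (G z))\<^sup>2 * gauss \<nu> z)"
    and "fock_norm2 \<nu> G = c * fock_norm2 \<nu> F"
proof -
  define J where "J R = (LINT z|lborel. cutoff R z * ((norm (G z))\<^sup>2 * gauss \<nu> z))" for R
  define K where "K R = (LINT z|lborel. cutoff R z * ((norm (F z))\<^sup>2 * gauss \<nu> z))" for R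
  let ?N = "fock_norm2 \<nu> F"
  have icF: "integrable lborel (\<lambda>z. cutoff R z * ((norm (F z))\<^sup>2 * gauss \<nu> z))"
    and icG: "integrable lborel (\<lambda>z. cutoff R z * ((norm (G z))\<^sup>2 * gauss \<nu> z))"
    and icFG: "integrable lborel (\<lambda>z. \<bar>cutoff_deriv R z\<bar> * (norm z * norm (F z) * norm (G z) * gauss \<nu> z))"
    if "0 < R" for R
    by (rule integrable_lborel_support[of _ R];
        use cutoff_support[OF that] F G in
          \<open>auto intro!: continuous_intros gauss_continuous cutoff_continuous\<close>)+
  have KN: "K R \<le> ?N" if "0 < R" for R
    unfolding K_def fock_norm2_def
    by (intro integral_mono icF that iF mult_left_le_one_le)
      (auto simp: cutoff_nonneg cutoff_le_1 less_imp_le[OF gauss_pos])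
  have J0: "0 \<le> J R" for R
    unfolding J_def
    by (intro Bochner_Integration.integral_nonneg mult_nonneg_nonneg) (auto simp: cutoff_nonneg less_imp_le[OF gauss_pos])
  have N0: "0 \<le> ?N"
    unfolding fock_norm2_def
    by (intro Bochner_Integration.integral_nonneg mult_nonneg_nonneg) (auto simp: less_imp_le[OF gauss_pos])
  have err: "\<bar>J R - c * K R\<bar> \<le> (?N + J R) / R" if R: "0 < R" for R
  proof -
    have "(LINT z|lborel. \<bar>cutoff_deriv R z\<bar> * (norm z * norm (F z) * norm (G z) * gauss \<nu> z))
        \<le> (LINT z|lborel. ((norm (F z))\<^sup>2 * gauss \<nu> z + cutoff R z * ((norm (G z))\<^sup>2 * gauss \<nu> z)) / R)"
    proof (rule integral_mono)
      show "integrable lborel (\<lambda>z. ((norm (F z))\<^sup>2 * gauss \<nu> z + cutoff R z * ((norm (G z))\<^sup>2 * gauss \<nu> z)) / R)"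
        using iF icG[OF R] by (intro integrable_divide Bochner_Integration.integrable_add)
      fix z
      have "\<bar>cutoff_deriv R z\<bar> * (norm z * norm (F z) * norm (G z) * gauss \<nu> z)
          = (\<bar>cutoff_deriv R z\<bar> * norm z) * (norm (F z) * norm (G z) * gauss \<nu> z)"
        by simp
      also have "\<dots> \<le> (2 / R * sqrt (cutoff R z)) * (norm (F z) * norm (G z) * gauss \<nu> z)"
        using cutoff_deriv_bound[OF R] gauss_pos[of \<nu> z] by (intro mult_right_mono) auto
      also have "\<dots> = (2 * norm (F z) * (sqrt (cutoff R z) * norm (G z))) * gauss \<nu> z / R"
        by simp
      \<comment> \<open>The square root of the cutoff is attached to \<open>G\<close>, so the
        inequality 2ab \<le> a^2 + b^2 produces the cut-off norm of \<open>G\<close>, which is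
        finite a priori.\<close>
      also have "\<dots> \<le> ((norm (F z))\<^sup>2 + (sqrt (cutoff R z) * norm (G z))\<^sup>2) * gauss \<nu> z / R"
        using gauss_pos[of \<nu> z] R by (intro divide_right_mono mult_right_mono sum_squares_bound) auto
      finally show "\<bar>cutoff_deriv R z\<bar> * (norm z * norm (F z) * norm (G z) * gauss \<nu> z)
          \<le> ((norm (F z))\<^sup>2 * gauss \<nu> z + cutoff R z * ((norm (G z))\<^sup>2 * gauss \<nu> z)) / R"
        by (simp add: power_mult_distrib cutoff_nonneg algebra_simps)
    qed (rule icFG[OF R])
    also have "\<dots> = (?N + J R) / R"
      using iF icG[OF R] by (simp add: fock_norm2_def J_def)
    finally show ?thesis
      using est[OF R] unfolding integral_cutoff_square J_def[symmetric] K_def[symmetric]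
        of_real_mult[symmetric] of_real_diff[symmetric] norm_of_real by linarith
  qed
  \<comment> \<open>For \<open>R\<close> at least 2, no more than half of \<open>J R\<close> occurs
    on the right of \<open>err\<close>. Moving it to the left gives a bound independent of
    \<open>R\<close>.\<close>
  have JB: "J R \<le> 2 * (c * ?N) + ?N" if "2 \<le> R" for R
  proof -
    have R0: "0 < R" using that by simp
    have "(?N + J R) / R \<le> (?N + J R) / 2"
      using that J0[of R] N0 by (intro divide_left_mono) auto
    moreover have "c * K R \<le> c * ?N"
      using KN[of R] that \<open>0 \<le> c\<close> by (intro mult_left_mono) auto
    ultimately show ?thesis
      using order_trans[OF abs_le_D1[OF err[OF R0]]] by fastforce
  qed
  have inv0: "(\<lambda>k. 1 / real (k + 2)) \<longlonglongrightarrow> 0"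
    using LIMSEQ_Suc[OF LIMSEQ_inverse_real_of_nat] by (simp add: inverse_eq_divide)
  have K_lim: "(\<lambda>k. K (real (k + 2))) \<longlonglongrightarrow> ?N"
    unfolding K_def fock_norm2_def
    by (rule cutoff_integral_tendsto[OF iF]) (simp add: less_imp_le[OF gauss_pos])
  \<comment> \<open>Since \<open>J\<close> is bounded, the error (N + J) / R tends to 0, and
    \<open>J\<close> has the same limit as \<open>c * K\<close>.\<close>
  have J_lim: "(\<lambda>k. J (real (k + 2))) \<longlonglongrightarrow> c * ?N"
  proof (rule Lim_transform)
    show "(\<lambda>k. c * K (real (k + 2))) \<longlonglongrightarrow> c * ?N"
      using K_lim by (rule tendsto_mult_left)
    show "(\<lambda>k. J (real (k + 2)) - c * K (real (k + 2))) \<longlonglongrightarrow> 0"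
    proof (rule Lim_null_comparison)
      show "(\<lambda>k. (?N + (2 * (c * ?N) + ?N)) * (1 / real (k + 2))) \<longlonglongrightarrow> 0"
        using tendsto_mult_left[OF inv0] by simp
      show "\<forall>\<^sub>F k in sequentially. norm (J (real (k + 2)) - c * K (real (k + 2)))
          \<le> (?N + (2 * (c * ?N) + ?N)) * (1 / real (k + 2))"
      proof (intro always_eventually allI)
        fix k
        let ?R = "real (k + 2)"
        have "\<bar>J ?R - c * K ?R\<bar> \<le> (?N + J ?R) / ?R"
          by (rule err) simp
        also have "\<dots> \<le> (?N + (2 * (c * ?N) + ?N)) / ?R"
          using JB[of ?R] by (intro divide_right_mono add_left_mono) auto
        finally show "norm (J ?R - c * K ?R) \<le> (?N + (2 * (c * ?N) + ?N)) * (1 / ?R)"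
          by simp
      qed
    qed
  qed
  have p: "0 \<le> (norm (G z))\<^sup>2 * gauss \<nu> z" for z
    by (simp add: less_imp_le[OF gauss_pos])
  have c: "continuous_on UNIV (\<lambda>z. (norm (G z))\<^sup>2 * gauss \<nu> z)"
    using G by (intro continuous_intros gauss_continuous)
  show "integrable lborel (\<lambda>z. (norm (G z))\<^sup>2 * gauss \<nu> z)"
    and "fock_norm2 \<nu> G = c * fock_norm2 \<nu> F"
    using cutoff_integral_limit[OF c p J_lim[unfolded J_def]] by (simp_all add: fock_norm2_def)
qed

lemma cutoff_deriv_integral_bound:
  "norm (LINT z|lborel. cutoff_deriv R z *\<^sub>R (cnj z * F z * cnj (G z) * complex_of_real (gauss \<nu> z)))
    \<le> (LINT z|lborel. \<bar>cutoff_deriv R z\<bar> * (norm z * norm (F z) * norm (G z) * gauss \<nu> z))"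
  by (rule order_trans[OF integral_norm_bound])
    (simp add: norm_mult abs_mult less_imp_le[OF gauss_pos] mult.assoc)

text \<open>By \<open>D A = A D + \<nu>\<close>, the eigenvalue k\<nu> of \<open>A D\<close> becomes
  (k + 1)\<nu> for \<open>D A\<close>.\<close>

lemma creation_eigen:
  assumes F: "F \<in> Fock \<nu> k"
  shows "wirt_bar (nabla \<nu> 0 F) z = of_nat (Suc k) * complex_of_real \<nu> * F z"
  using F wirt_bar_nabla[of F] unfolding Fock_iff by (simp add: algebra_simps)

lemma nabla_cmult_fun:
  assumes "smooth g"
  shows "nabla \<nu> \<gamma> (\<lambda>z. c * g z) = (\<lambda>z. c * nabla \<nu> \<gamma> g z)"
  using nabla_cmult[OF assms] by blast

text \<open>Formally the squared norm of \<open>A F\<close> is the pairing of \<open>F\<close> with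
  \<open>D A F\<close>, and \<open>creation_eigen\<close> evaluates it; \<open>caccioppoli\<close>
  makes this rigorous and yields integrability.\<close>

lemma creation_Fock:
  assumes F: "F \<in> Fock \<nu> k" and \<nu>: "0 < \<nu>"
  shows "nabla \<nu> 0 F \<in> Fock \<nu> (Suc k)"
    and "fock_norm2 \<nu> (nabla \<nu> 0 F) = real (Suc k) * \<nu> * fock_norm2 \<nu> F"
proof -
  have sF: "smooth F" and iF: "integrable lborel (\<lambda>z. (norm (F z))\<^sup>2 * gauss \<nu> z)"
    using F unfolding Fock_iff by blast+
  have sA: "smooth (nabla \<nu> 0 F)" using sF by (rule smooth_nabla)
  let ?A = "nabla \<nu> 0 F" and ?c = "real (Suc k) * \<nu>"
  have est: "norm ((LINT z|lborel. cutoff R z *\<^sub>R (?A z * cnj (?A z) * complex_of_real (gauss \<nu> z)))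
        - complex_of_real ?c * (LINT z|lborel. cutoff R z *\<^sub>R (F z * cnj (F z) * complex_of_real (gauss \<nu> z))))
      \<le> (LINT z|lborel. \<bar>cutoff_deriv R z\<bar> * (norm z * norm (F z) * norm (?A z) * gauss \<nu> z))"
    if R: "0 < R" for R
  proof -
    have "(LINT z|lborel. cutoff R z *\<^sub>R (F z * cnj (wirt_bar ?A z) * complex_of_real (gauss \<nu> z)))
        = (LINT z|lborel. complex_of_real ?c * (cutoff R z *\<^sub>R (F z * cnj (F z) * complex_of_real (gauss \<nu> z))))"
      unfolding creation_eigen[OF F] by (simp add: scaleR_conv_of_real mult_ac)
    then show ?thesis
      using cutoff_adjoint[OF sF sA R, of \<nu>] cutoff_deriv_integral_bound[of R F ?A \<nu>]
      by (simp only: integral_mult_right_zero add_diff_cancel_left')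
  qed
  note c = caccioppoli[OF smooth_continuous[OF sF] smooth_continuous[OF sA] iF _ est]
  show "fock_norm2 \<nu> ?A = ?c * fock_norm2 \<nu> F"
    using c(2) \<nu> by simp
  have "wirt_bar ?A = (\<lambda>z. (of_nat (Suc k) * complex_of_real \<nu>) * F z)"
    using creation_eigen[OF F] by blast
  then have "nabla \<nu> 0 (wirt_bar ?A) z = of_nat (Suc k) * complex_of_real \<nu> * ?A z" for z
    by (simp only: nabla_cmult_fun[OF sF])
  then show "?A \<in> Fock \<nu> (Suc k)"
    unfolding Fock_iff using sA c(1) \<nu> by simp
qed

text \<open>The counterpart for \<open>D\<close>: the squared norm of \<open>D F\<close> is formally
  the pairing of \<open>A D F\<close> with \<open>F\<close>, where the eigenvalue equation
  applies.\<close>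

lemma annihilation_norm:
  assumes F: "F \<in> Fock \<nu> k" and \<nu>: "0 < \<nu>"
  shows "integrable lborel (\<lambda>z. (norm (wirt_bar F z))\<^sup>2 * gauss \<nu> z)"
    and "fock_norm2 \<nu> (wirt_bar F) = real k * \<nu> * fock_norm2 \<nu> F"
proof -
  have sF: "smooth F" and iF: "integrable lborel (\<lambda>z. (norm (F z))\<^sup>2 * gauss \<nu> z)"
    and eF: "\<And>z. nabla \<nu> 0 (wirt_bar F) z = of_nat k * complex_of_real \<nu> * F z"
    using F unfolding Fock_iff by blast+
  let ?D = "wirt_bar F" and ?c = "real k * \<nu>"
  have sD: "smooth ?D" using sF by (rule smooth_wirt_bar)
  have est: "norm ((LINT z|lborel. cutoff R z *\<^sub>R (?D z * cnj (?D z) * complex_of_real (gauss \<nu> z)))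
        - complex_of_real ?c * (LINT z|lborel. cutoff R z *\<^sub>R (F z * cnj (F z) * complex_of_real (gauss \<nu> z))))
      \<le> (LINT z|lborel. \<bar>cutoff_deriv R z\<bar> * (norm z * norm (F z) * norm (?D z) * gauss \<nu> z))"
    if R: "0 < R" for R
  proof -
    have "(LINT z|lborel. cutoff R z *\<^sub>R (nabla \<nu> 0 ?D z * cnj (F z) * complex_of_real (gauss \<nu> z)))
        = (LINT z|lborel. complex_of_real ?c * (cutoff R z *\<^sub>R (F z * cnj (F z) * complex_of_real (gauss \<nu> z))))"
      unfolding eF by (simp add: scaleR_conv_of_real mult_ac)
    \<comment> \<open>The cutoff error of \<open>cutoff_adjoint\<close> now stands on the side of
      \<open>D F\<close>, so its sign changes; only its norm matters.\<close>
    moreover have "norm (a - b) = norm e" if "b = a + e" for a b e :: complex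
      using that by simp
    ultimately show ?thesis
      using cutoff_adjoint[OF sD sF R, of \<nu>] cutoff_deriv_integral_bound[of R ?D F \<nu>]
      by (simp only: integral_mult_right_zero mult.assoc mult.left_commute[of "norm (F _)"])
  qed
  note c = caccioppoli[OF smooth_continuous[OF sF] smooth_continuous[OF sD] iF _ est]
  show "integrable lborel (\<lambda>z. (norm (wirt_bar F z))\<^sup>2 * gauss \<nu> z)"
    and "fock_norm2 \<nu> (wirt_bar F) = real k * \<nu> * fock_norm2 \<nu> F"
    using c \<nu> by simp_all
qed

text \<open>Apply \<open>D\<close> to the eigenvalue equation: \<open>D A D F\<close> equals
  \<open>A D D F + \<nu> D F\<close>, which lowers the eigenvalue by \<nu>.\<close>

lemma annihilation_Fock:
  assumes F: "F \<in> Fock \<nu> (Suc k)" and \<nu>: "0 < \<nu>"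
  shows "wirt_bar F \<in> Fock \<nu> k"
proof -
  have sF: "smooth F"
    and eF: "\<And>z. nabla \<nu> 0 (wirt_bar F) z = of_nat (Suc k) * complex_of_real \<nu> * F z"
    using F unfolding Fock_iff by blast+
  have "nabla \<nu> 0 (wirt_bar F) = (\<lambda>z. (of_nat (Suc k) * complex_of_real \<nu>) * F z)"
    using eF by blast
  then have "wirt_bar (nabla \<nu> 0 (wirt_bar F)) z = (of_nat (Suc k) * complex_of_real \<nu>) * wirt_bar F z" for z
    using has_wirt_eqs(2)[OF has_wirt_mult[OF has_wirt_const smooth_has_wirt[OF sF]]] by simp
  then have "nabla \<nu> 0 (wirt_bar (wirt_bar F)) z = of_nat k * complex_of_real \<nu> * wirt_bar F z" for z
    using wirt_bar_nabla[OF smooth_wirt_bar[OF sF], of \<nu> z] by (simp add: algebra_simps)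
  then show ?thesis
    unfolding Fock_iff using annihilation_norm(1)[OF assms] smooth_wirt_bar[OF sF] by blast
qed

text \<open>Upgrades vanishing almost everywhere to vanishing everywhere: for continuous
  \<open>f\<close> the set of nonzeros is open, and if nonempty it contains a box of positive
  volume.\<close>

lemma lborel_nonneg_integral_zero:
  fixes f :: "complex \<Rightarrow> real"
  assumes c: "continuous_on UNIV f" and i: "integrable lborel f" and p: "\<And>z. 0 \<le> f z"
    and z: "(LINT z|lborel. f z) = 0"
  shows "f z = 0"
proof (rule ccontr)
  assume "f z \<noteq> 0"
  have "AE z in lborel. f z = 0"
    using integral_nonneg_eq_0_iff_AE[OF i] p z by auto
  moreover have op: "open {z. f z \<noteq> 0}"
    using c by (rule open_Collect_neq) auto
  ultimately have "{z. f z \<noteq> 0} \<in> null_sets lborel"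
    by (subst (asm) AE_iff_null) (auto intro: borel_open)
  then have "emeasure lborel {z. f z \<noteq> 0} = 0"
    by auto
  moreover obtain a b where "z \<in> box a b" "box a b \<subseteq> {z. f z \<noteq> 0}"
    and ab: "\<And>i. i \<in> Basis \<Longrightarrow> a \<bullet> i < b \<bullet> i"
    by (rule open_contains_box[OF op, of z]) (use \<open>f z \<noteq> 0\<close> in auto)
  moreover have "emeasure lborel (box a b) \<noteq> 0"
  proof -
    have "emeasure lborel (box a b) = ennreal (\<Prod>i\<in>Basis. (b - a) \<bullet> i)"
      by (rule emeasure_lborel_box) (use ab in \<open>auto intro: less_imp_le\<close>)
    moreover have "0 < (\<Prod>i\<in>Basis. (b - a) \<bullet> i)"
      by (rule prod_pos) (use ab in \<open>auto simp: inner_diff_left\<close>)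
    ultimately show ?thesis by (simp add: ennreal_eq_0_iff not_le)
  qed
  ultimately show False
    using emeasure_mono[of "box a b" "{z. f z \<noteq> 0}" lborel] op by (auto intro: borel_open)
qed

text \<open>The equation \<open>A D h = 0\<close> alone does not make \<open>h\<close> holomorphic.
  Square-integrability enters through \<open>annihilation_norm\<close>, which for
  \<open>k = 0\<close> says that \<open>D h\<close> has norm zero.\<close>

lemma Fock_0_iff:
  assumes \<nu>: "0 < \<nu>"
  shows "h \<in> Fock \<nu> 0 \<longleftrightarrow> h holomorphic_on UNIV \<and> integrable lborel (\<lambda>z. (norm (h z))\<^sup>2 * gauss \<nu> z)"
proof
  assume h: "h \<in> Fock \<nu> 0"
  then have s: "smooth h" by (simp add: Fock_iff)
  have "(norm (wirt_bar h z))\<^sup>2 * gauss \<nu> z = 0" for z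
  proof (rule lborel_nonneg_integral_zero)
    show "continuous_on UNIV (\<lambda>z. (norm (wirt_bar h z))\<^sup>2 * gauss \<nu> z)"
      using s by (intro continuous_intros gauss_continuous smooth_continuous smooth_wirt_bar)
    show "(LINT z|lborel. (norm (wirt_bar h z))\<^sup>2 * gauss \<nu> z) = 0"
      using annihilation_norm(2)[OF h \<nu>] by (simp add: fock_norm2_def)
  qed (use annihilation_norm(1)[OF h \<nu>] in \<open>auto simp: less_imp_le[OF gauss_pos]\<close>)
  then have z: "wirt_bar h z = 0" for z
    using gauss_pos[of \<nu>] by (simp add: less_le)
  have "(h has_field_derivative wirt h z) (at z)" for z
    using smooth_has_wirt[OF s, of z] z[of z] by (simp add: has_wirt_def has_field_derivative_def)
  then have "h holomorphic_on UNIV"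
    by (auto simp: holomorphic_on_open)
  then show "h holomorphic_on UNIV \<and> integrable lborel (\<lambda>z. (norm (h z))\<^sup>2 * gauss \<nu> z)"
    using h by (simp add: Fock_iff)
next
  assume h: "h holomorphic_on UNIV \<and> integrable lborel (\<lambda>z. (norm (h z))\<^sup>2 * gauss \<nu> z)"
  have "wirt_bar h = (\<lambda>z. 0)"
    using h has_wirt_eqs(2)[OF has_wirt_holomorphic[OF holomorphic_derivI[OF _ open_UNIV UNIV_I]]] by blast
  then have "nabla \<nu> 0 (wirt_bar h) z = 0" for z
    using has_wirt_eqs(1)[OF has_wirt_const] by (simp add: nabla_def)
  with h show "h \<in> Fock \<nu> 0"
    by (simp add: Fock_iff smooth_holomorphic)
qed

lemma Fock_funpow:
  assumes "h \<in> Fock \<nu> 0" "0 < \<nu>"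
  shows "(nabla \<nu> 0 ^^ n) h \<in> Fock \<nu> n \<and> fock_norm2 \<nu> ((nabla \<nu> 0 ^^ n) h) = fact n * \<nu> ^ n * fock_norm2 \<nu> h"
proof (induction n)
  case (Suc n)
  then show ?case
    using creation_Fock[of "(nabla \<nu> 0 ^^ n) h" \<nu> n] assms by (simp add: algebra_simps)
qed (use assms in simp)

lemma Fock_cmult:
  assumes F: "F \<in> Fock \<nu> n"
  shows "(\<lambda>z. c * F z) \<in> Fock \<nu> n"
proof -
  have s: "smooth F" using F by (simp add: Fock_iff)
  have "wirt_bar (\<lambda>z. c * F z) = (\<lambda>z. c * wirt_bar F z)"
    using has_wirt_eqs(2)[OF has_wirt_mult[OF has_wirt_const smooth_has_wirt[OF s]]] by auto
  then have "nabla \<nu> 0 (wirt_bar (\<lambda>z. c * F z)) z = c * nabla \<nu> 0 (wirt_bar F) z" for z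
    using nabla_cmult[OF smooth_wirt_bar[OF s]] by simp
  moreover have "integrable lborel (\<lambda>z. (norm c)\<^sup>2 * ((norm (F z))\<^sup>2 * gauss \<nu> z))"
    using F by (intro integrable_mult_right) (simp add: Fock_iff)
  ultimately show ?thesis
    using F unfolding Fock_iff by (simp add: smooth_cmult norm_mult power_mult_distrib mult.assoc)
qed

text \<open>At level n + 1 the eigenvalue equation itself writes \<open>F\<close> as
  \<open>A (D F)\<close> divided by (n + 1)\<nu>, and \<open>D F\<close> lies one level
  lower.\<close>

lemma Fock_surj:
  assumes "F \<in> Fock \<nu> n" "0 < \<nu>"
  shows "\<exists>h\<in>Fock \<nu> 0. F = (nabla \<nu> 0 ^^ n) h"
  using assms(1)
proof (induction n arbitrary: F)
  case (Suc n)
  obtain h where h: "h \<in> Fock \<nu> 0" "wirt_bar F = (nabla \<nu> 0 ^^ n) h"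
    using Suc.IH annihilation_Fock[OF Suc.prems \<open>0 < \<nu>\<close>] by blast
  let ?c = "complex_of_real (real (Suc n) * \<nu>)"
  have sh: "smooth h" using h by (simp add: Fock_iff)
  have c: "?c \<noteq> 0" using \<open>0 < \<nu>\<close> by (simp only: of_real_eq_0_iff) simp
  have e: "(nabla \<nu> 0 ^^ Suc n) h z = ?c * F z" for z
    using Suc.prems unfolding Fock_iff h(2) by simp
  have "F = (\<lambda>z. inverse ?c * (nabla \<nu> 0 ^^ Suc n) h z)"
    unfolding e mult.assoc[symmetric] left_inverse[OF c] by simp
  also have "\<dots> = (nabla \<nu> 0 ^^ Suc n) (\<lambda>z. inverse ?c * h z)"
    by (rule nabla_funpow_cmult[OF sh, symmetric])
  finally show ?case
    using Fock_cmult[OF h(1)] by blast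
qed auto

section \<open>Power series expansions of the Fock space of entire functions\<close>

lemma real_gauss_integral:
  fixes c :: real
  assumes c: "0 < c"
  shows "has_bochner_integral lborel (\<lambda>x. exp (- c * x\<^sup>2)) (sqrt (pi / c))"
proof -
  let ?s = "sqrt (1 / (2 * c))"
  have s: "0 < ?s" "?s\<^sup>2 = 1 / (2 * c)" using c by auto
  have e: "exp (- c * x\<^sup>2) = sqrt (pi / c) * normal_density 0 ?s x" for x
    unfolding normal_density_def s(2) using c by (simp add: field_simps real_sqrt_divide)
  have "has_bochner_integral lborel (\<lambda>x. sqrt (pi / c) * normal_density 0 ?s x) (sqrt (pi / c) * 1)"
    using s(1) by (intro has_bochner_integral_mult_right)
      (simp add: has_bochner_integral_iff integral_normal_density integrable_normal_density)
  then show ?thesis unfolding e by simp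
qed

lemma gauss_integral:
  assumes \<nu>: "0 < \<nu>"
  shows "integrable lborel (gauss \<nu>)" "(LINT z|lborel. gauss \<nu> z) = pi / \<nu>"
proof -
  have B: "(Basis :: complex set) = {1, \<i>}" by (simp add: Basis_complex_def)
  have g: "ennreal (gauss \<nu> z) = (\<Prod>b\<in>Basis. ennreal (exp (- \<nu> * (z \<bullet> b)\<^sup>2)))" for z
    unfolding gauss_def B
    by (simp add: cmod_power2 algebra_simps flip: ennreal_mult' exp_add)
  have "(\<integral>\<^sup>+x. ennreal (exp (- \<nu> * x\<^sup>2)) \<partial>lborel) = ennreal (sqrt (pi / \<nu>))"
    using real_gauss_integral[OF \<nu>]
    by (subst nn_integral_eq_integral) (auto simp: has_bochner_integral_iff)
  then have "(\<integral>\<^sup>+z. ennreal (gauss \<nu> z) \<partial>lborel) = (\<Prod>b\<in>(Basis::complex set). ennreal (sqrt (pi / \<nu>)))"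
    unfolding g by (subst nn_integral_lborel_prod[of "\<lambda>b x. ennreal (exp (- \<nu> * x\<^sup>2))"]) auto
  also have "\<dots> = ennreal (pi / \<nu>)"
    using \<nu> by (simp add: power2_eq_square flip: ennreal_mult')
  finally have n: "(\<integral>\<^sup>+z. ennreal (gauss \<nu> z) \<partial>lborel) = ennreal (pi / \<nu>)" .
  have m: "gauss \<nu> \<in> borel_measurable lborel"
    using gauss_continuous by (simp add: borel_measurable_continuous_onI)
  show i: "integrable lborel (gauss \<nu>)"
    using m n by (intro integrableI_nonneg) (auto simp: less_imp_le[OF gauss_pos])
  show "(LINT z|lborel. gauss \<nu> z) = pi / \<nu>"
    using n \<nu> nn_integral_eq_integral[OF i] by (simp add: less_imp_le[OF gauss_pos] integral_nonneg_AE)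
qed

text \<open>With the norms from \<open>Fock_funpow\<close> this yields all even moments of the
  Gaussian without polar coordinates.\<close>

lemma creation_funpow_one:
  "(nabla \<nu> 0 ^^ m) (\<lambda>z. 1) = (\<lambda>z. (complex_of_real \<nu> * cnj z) ^ m)"
proof (induction m)
  case (Suc m)
  have "has_wirt (\<lambda>z. cnj ((complex_of_real \<nu> * z) ^ m)) (cnj 0)
      (cnj (of_nat m * (complex_of_real \<nu> * z) ^ (m - 1) * complex_of_real \<nu>)) z" for z
    by (intro has_wirt_cnj has_wirt_holomorphic) (auto intro!: derivative_eq_intros)
  from has_wirt_eqs(1)[OF this] have w: "wirt (\<lambda>z. (complex_of_real \<nu> * cnj z) ^ m) z = 0" for z
    by simp
  show ?case
    unfolding funpow.simps o_def Suc by (simp add: nabla_def w fun_eq_iff)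
qed simp

lemma gauss_moment:
  assumes \<nu>: "0 < \<nu>"
  shows "integrable lborel (\<lambda>z. norm z ^ (2 * m) * gauss \<nu> z)"
    and "(LINT z|lborel. norm z ^ (2 * m) * gauss \<nu> z) = pi * fact m / \<nu> ^ Suc m"
proof -
  have one: "(\<lambda>z. 1) \<in> Fock \<nu> 0" "fock_norm2 \<nu> (\<lambda>z. 1) = pi / \<nu>"
    using gauss_integral[OF \<nu>] by (auto simp: Fock_0_iff[OF \<nu>] fock_norm2_def)
  have e: "(norm ((complex_of_real \<nu> * cnj z) ^ m))\<^sup>2 * gauss \<nu> z = \<nu> ^ (2 * m) * (norm z ^ (2 * m) * gauss \<nu> z)" for z
    using \<nu> by (simp add: norm_power norm_mult power_mult_distrib power_mult[symmetric] mult.commute)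
  have i: "integrable lborel (\<lambda>z. \<nu> ^ (2 * m) * (norm z ^ (2 * m) * gauss \<nu> z))"
    and n: "(LINT z|lborel. \<nu> ^ (2 * m) * (norm z ^ (2 * m) * gauss \<nu> z)) = fact m * \<nu> ^ m * (pi / \<nu>)"
    using Fock_funpow[OF one(1) \<nu>, of m] unfolding creation_funpow_one Fock_iff fock_norm2_def e
    using one(2) by (simp_all add: fock_norm2_def)
  show "integrable lborel (\<lambda>z. norm z ^ (2 * m) * gauss \<nu> z)"
    using i \<nu> by simp
  from n have "\<nu> ^ m * \<nu> ^ m * (LINT z|lborel. norm z ^ (2 * m) * gauss \<nu> z) = fact m * \<nu> ^ m * (pi / \<nu>)"
    unfolding integral_mult_right_zero mult_2 power_add .
  then have "\<nu> ^ m * (\<nu> ^ m * \<nu> * (LINT z|lborel. norm z ^ (2 * m) * gauss \<nu> z) - fact m * pi) = 0"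
    using \<nu> by (simp add: right_diff_distrib field_simps)
  with \<nu> show "(LINT z|lborel. norm z ^ (2 * m) * gauss \<nu> z) = pi * fact m / \<nu> ^ Suc m"
    by (simp add: field_simps)
qed

text \<open>Angular integration: \<open>z \<partial> - cnj z \<partial>\<bar>\<close> annihilates radial functions.\<close>

lemma cutoff_monomials_orthogonal:
  assumes R: "0 < R" and mk: "m \<noteq> k"
  shows "(LINT z|lborel. cutoff R z *\<^sub>R (z ^ m * cnj (z ^ k) * complex_of_real (gauss \<nu> z))) = 0"
proof -
  let ?W = "\<lambda>z. complex_of_real (gauss \<nu> z)" and ?c = "\<lambda>z. complex_of_real (cutoff R z)"
  let ?d = "\<lambda>z. complex_of_real (cutoff_deriv R z)"
  let ?P = "\<lambda>z. ?d z * ?W z - complex_of_real \<nu> * ?W z * ?c z"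
  have rad: "has_wirt (\<lambda>z. ?c z * ?W z) (?P z * cnj z) (?P z * z) z" for z
    unfolding gauss_def
    by (rule has_wirt_unique, rule has_wirt_mult[OF has_wirt_cutoff has_wirt_gauss])
      (simp_all add: algebra_simps)
  have pow: "has_wirt (\<lambda>z. z ^ j) (of_nat j * z ^ (j - 1)) 0 z"
    "has_wirt (\<lambda>z. cnj (z ^ j)) 0 (of_nat j * cnj z ^ (j - 1)) z" for j z
  proof -
    show 1: "has_wirt (\<lambda>z. z ^ j) (of_nat j * z ^ (j - 1)) 0 z"
      by (intro has_wirt_holomorphic) (auto intro!: derivative_eq_intros)
    show "has_wirt (\<lambda>z. cnj (z ^ j)) 0 (of_nat j * cnj z ^ (j - 1)) z"
      by (rule has_wirt_unique, rule has_wirt_cnj[OF 1]) simp_all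
  qed
  let ?h = "\<lambda>z. z ^ m * cnj z ^ k * (?c z * ?W z)"
  \<comment> \<open>Integrating the \<open>wirt\<close> derivative of z times the integrand, and the
    \<open>wirt_bar\<close> derivative of \<open>cnj z\<close> times it, leaves this same remainder
    both times. The difference is (m - k) times the wanted integral.\<close>
  let ?r = "\<lambda>z. z ^ Suc m * cnj z ^ Suc k * ?P z"
  note cont = gauss_continuous cutoff_continuous
  have "has_wirt (\<lambda>z. z ^ Suc m * (cnj (z ^ k) * (?c z * ?W z)))
      (of_nat (Suc m) * ?h z + ?r z)
      (z ^ Suc m * (of_nat k * cnj z ^ (k - 1) * (?c z * ?W z) + cnj z ^ k * (?P z * z))) z" for z
    by (rule has_wirt_unique, rule has_wirt_mult[OF pow(1) has_wirt_mult[OF pow(2) rad]])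
      (simp_all add: algebra_simps)
  then have 1: "(LINT z|lborel. of_nat (Suc m) * ?h z + ?r z) = 0"
    by (rule integral_wirt_zero(1)[where R = R])
      (auto intro!: continuous_intros cont simp: cutoff_support[OF R])
  have "has_wirt (\<lambda>z. z ^ m * (cnj (z ^ Suc k) * (?c z * ?W z)))
      (of_nat m * z ^ (m - 1) * (cnj z ^ Suc k * (?c z * ?W z)) + z ^ m * (cnj z ^ Suc k * (?P z * cnj z)))
      (of_nat (Suc k) * ?h z + ?r z) z" for z
    by (rule has_wirt_unique, rule has_wirt_mult[OF pow(1) has_wirt_mult[OF pow(2) rad]])
      (simp_all add: algebra_simps)
  then have 2: "(LINT z|lborel. of_nat (Suc k) * ?h z + ?r z) = 0"
    by (rule integral_wirt_zero(2)[where R = R])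
      (auto intro!: continuous_intros cont simp: cutoff_support[OF R])
  have i: "integrable lborel ?h" "integrable lborel ?r"
    by (rule integrable_lborel_support[of _ R];
        use cutoff_support[OF R] in \<open>auto intro!: continuous_intros cont\<close>)+
  have "of_nat (Suc m) * (LINT z|lborel. ?h z) + (LINT z|lborel. ?r z) = 0"
    "of_nat (Suc k) * (LINT z|lborel. ?h z) + (LINT z|lborel. ?r z) = 0"
    using 1 2 i by (simp_all only: Bochner_Integration.integral_add[OF integrable_mult_right]
        integral_mult_right_zero)
  moreover have "(a - b) * I = 0" if "a * I + r = 0" "b * I + r = 0" for a b I r :: complex
    using that by algebra
  ultimately have "(of_nat (Suc m) - of_nat (Suc k)) * (LINT z|lborel. ?h z) = 0"
    by blast
  moreover have "of_nat (Suc m) - of_nat (Suc k) \<noteq> (0::complex)"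
    using mk by (simp del: of_nat_Suc)
  ultimately have "(LINT z|lborel. ?h z) = 0"
    by (simp only: mult_eq_0_iff) simp
  then show ?thesis
    by (simp add: scaleR_conv_of_real mult_ac)
qed

section \<open>Norms of polynomials and power series\<close>

lemma cutoff_polynomial_norm:
  assumes R: "0 < R"
  shows "(LINT z|lborel. cutoff R z * ((norm (\<Sum>m<N. a m * z ^ m))\<^sup>2 * gauss \<nu> z))
    = (\<Sum>m<N. (norm (a m))\<^sup>2 * (LINT z|lborel. cutoff R z * (norm z ^ (2 * m) * gauss \<nu> z)))"
proof -
  let ?W = "\<lambda>z. complex_of_real (gauss \<nu> z)"
  let ?I = "\<lambda>m k. LINT z|lborel. cutoff R z *\<^sub>R (z ^ m * cnj (z ^ k) * ?W z)"
  have i: "integrable lborel (\<lambda>z. cutoff R z *\<^sub>R (z ^ m * cnj (z ^ k) * ?W z))" for m k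
    by (intro integrable_cutoff R continuous_intros gauss_continuous)
  have d: "?I m m = complex_of_real (LINT z|lborel. cutoff R z * (norm z ^ (2 * m) * gauss \<nu> z))" for m
  proof -
    have "z ^ m * cnj (z ^ m) = complex_of_real (norm z ^ (2 * m))" for z
      unfolding complex_norm_square[symmetric] norm_power power_mult[symmetric] by (simp add: mult.commute)
    then show ?thesis
      unfolding integral_complex_of_real[symmetric] by (simp add: scaleR_conv_of_real)
  qed
  have "complex_of_real (LINT z|lborel. cutoff R z * ((norm (\<Sum>m<N. a m * z ^ m))\<^sup>2 * gauss \<nu> z))
      = (LINT z|lborel. (\<Sum>m<N. \<Sum>k<N. (a m * cnj (a k)) * (cutoff R z *\<^sub>R (z ^ m * cnj (z ^ k) * ?W z))))"
    unfolding integral_cutoff_square[symmetric]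
  proof (rule Bochner_Integration.integral_cong)
    fix z
    let ?p = "\<Sum>m<N. a m * z ^ m"
    have "?p * cnj ?p = (\<Sum>m<N. \<Sum>k<N. (a m * z ^ m) * cnj (a k * z ^ k))"
      by (simp only: cnj_sum sum_product)
    then show "cutoff R z *\<^sub>R (?p * cnj ?p * ?W z)
        = (\<Sum>m<N. \<Sum>k<N. (a m * cnj (a k)) * (cutoff R z *\<^sub>R (z ^ m * cnj (z ^ k) * ?W z)))"
      by (simp only: sum_distrib_right scaleR_sum_right)
        (intro sum.cong refl, simp add: scaleR_conv_of_real)
  qed simp
  also have "\<dots> = (\<Sum>m<N. \<Sum>k<N. (a m * cnj (a k)) * ?I m k)"
  proof -
    have ii: "integrable lborel (\<lambda>z. (a m * cnj (a k)) * (cutoff R z *\<^sub>R (z ^ m * cnj (z ^ k) * ?W z)))" for m k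
      by (intro integrable_mult_right i)
    show ?thesis
      by (simp only: Bochner_Integration.integral_sum[OF Bochner_Integration.integrable_sum[OF ii]]
          Bochner_Integration.integral_sum[OF ii] integral_mult_right_zero)
  qed
  also have "\<dots> = (\<Sum>m<N. \<Sum>k<N. if k = m then (a m * cnj (a m)) * ?I m m else 0)"
    using cutoff_monomials_orthogonal[OF R] by (intro sum.cong) auto
  also have "\<dots> = (\<Sum>m<N. (a m * cnj (a m)) * ?I m m)"
    by simp
  also have "\<dots> = complex_of_real (\<Sum>m<N. (norm (a m))\<^sup>2 * (LINT z|lborel. cutoff R z * (norm z ^ (2 * m) * gauss \<nu> z)))"
  proof -
    have "a m * cnj (a m) = complex_of_real ((norm (a m))\<^sup>2)" for m
      by (rule complex_norm_square[symmetric])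
    then show ?thesis
      by (simp only: d of_real_sum of_real_mult)
  qed
  finally show ?thesis
    by (simp only: of_real_eq_iff)
qed

lemma power_series_holomorphic_UNIV:
  assumes "\<And>z. (\<lambda>m. a m * z ^ m) sums h (z::complex)"
  shows "h holomorphic_on UNIV"
proof -
  have "h holomorphic_on ball 0 r" for r
    using assms by (intro power_series_holomorphic[of 0 r a]) simp
  then have "h field_differentiable (at z)" for z
    by (rule holomorphic_on_imp_differentiable_at[of _ "ball 0 (norm z + 1)"]) auto
  then show ?thesis
    by (simp add: holomorphic_on_def)
qed

text \<open>With the cutoff in place only the disc of radius \<open>R\<close> matters, where the
  partial sums are uniformly bounded, so the identity for polynomials passes to the limit.\<close>

lemma cutoff_power_series_norm:
  assumes h: "\<And>z. (\<lambda>m. a m * z ^ m) sums h z" and R: "0 < R"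
  shows "(\<lambda>m. (norm (a m))\<^sup>2 * (LINT z|lborel. cutoff R z * (norm z ^ (2 * m) * gauss \<nu> z))) sums
    (LINT z|lborel. cutoff R z * ((norm (h z))\<^sup>2 * gauss \<nu> z))"
  unfolding sums_def cutoff_polynomial_norm[OF R, symmetric]
proof (rule integral_dominated_convergence)
  let ?p = "\<lambda>N z. \<Sum>m<N. a m * z ^ m"
  \<comment> \<open>Convergence at the larger radius \<open>R + 1\<close> gives absolute convergence
    at \<open>R\<close>.\<close>
  have "summable (\<lambda>m. a m * (complex_of_real (R + 1)) ^ m)"
    using h by (rule sums_summable)
  then have sm: "summable (\<lambda>m. norm (a m * (complex_of_real R) ^ m))"
    by (rule powser_insidea) (use R in simp)
  let ?C = "\<Sum>m. norm (a m * (complex_of_real R) ^ m)"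
  have bound: "norm (?p N z) \<le> ?C" if "norm z \<le> R" for N z
  proof -
    have "norm (?p N z) \<le> (\<Sum>m<N. norm (a m * (complex_of_real R) ^ m))"
    proof (rule sum_norm_le)
      show "norm (a m * z ^ m) \<le> norm (a m * (complex_of_real R) ^ m)" for m
        using that R by (auto simp: norm_mult norm_power intro!: mult_left_mono power_mono)
    qed
    also have "\<dots> \<le> ?C"
      using sm by (intro sum_le_suminf) auto
    finally show ?thesis .
  qed
  have hl: "(\<lambda>N. ?p N z) \<longlonglongrightarrow> h z" for z
    using h[of z] by (simp add: sums_def)
  have pm: "(?p N) \<in> borel_measurable borel" for N
    by (intro borel_measurable_continuous_onI continuous_intros)
  have hm: "h \<in> borel_measurable borel"
    by (intro borel_measurable_continuous_onI holomorphic_on_imp_continuous_on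
        power_series_holomorphic_UNIV[OF h])
  have gm: "gauss \<nu> \<in> borel_measurable borel" "cutoff R \<in> borel_measurable borel"
    using gauss_continuous cutoff_continuous by (auto intro: borel_measurable_continuous_onI)
  show "(\<lambda>z. cutoff R z * ((norm (h z))\<^sup>2 * gauss \<nu> z)) \<in> borel_measurable lborel"
    using hm gm by measurable
  show "(\<lambda>z. cutoff R z * ((norm (?p N z))\<^sup>2 * gauss \<nu> z)) \<in> borel_measurable lborel" for N
    using pm gm by measurable
  show "integrable lborel (\<lambda>z. cutoff R z *\<^sub>R (?C\<^sup>2 * gauss \<nu> z))"
    by (intro integrable_cutoff R continuous_intros gauss_continuous)
  show "AE z in lborel. (\<lambda>N. cutoff R z * ((norm (?p N z))\<^sup>2 * gauss \<nu> z)) \<longlonglongrightarrow> cutoff R z * ((norm (h z))\<^sup>2 * gauss \<nu> z)"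
    by (intro always_eventually allI tendsto_intros hl)
  show "AE z in lborel. norm (cutoff R z * ((norm (?p N z))\<^sup>2 * gauss \<nu> z)) \<le> cutoff R z *\<^sub>R (?C\<^sup>2 * gauss \<nu> z)" for N
  proof (intro always_eventually allI)
    fix z
    show "norm (cutoff R z * ((norm (?p N z))\<^sup>2 * gauss \<nu> z)) \<le> cutoff R z *\<^sub>R (?C\<^sup>2 * gauss \<nu> z)"
    proof (cases "norm z \<le> R")
      case True
      then have "cutoff R z * ((norm (?p N z))\<^sup>2 * gauss \<nu> z) \<le> cutoff R z * (?C\<^sup>2 * gauss \<nu> z)"
        by (intro mult_left_mono mult_right_mono power_mono bound cutoff_nonneg less_imp_le[OF gauss_pos]) auto
      then show ?thesis
        by (simp add: abs_mult cutoff_nonneg less_imp_le[OF gauss_pos])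
    next
      case False
      then show ?thesis using cutoff_support[OF R, of z] by simp
    qed
  qed
qed

lemma cutoff_integral_le:
  assumes "integrable lborel f" and "\<And>z. 0 \<le> f z" and c: "continuous_on UNIV f" and R: "0 < R"
  shows "(LINT z|lborel. cutoff R z * f z) \<le> (LINT z|lborel. f z)"
proof (rule integral_mono)
  show "integrable lborel (\<lambda>z. cutoff R z * f z)"
    using integrable_cutoff(1)[OF c R] by simp
qed (use assms in \<open>auto intro: mult_left_le_one_le simp: cutoff_nonneg cutoff_le_1\<close>)

text \<open>Bessel's inequality: for a fixed number of terms the cutoff is removed first, and only
  then is the number of terms increased.\<close>

lemma fock_coefficients_summable:
  assumes h: "\<And>z. (\<lambda>m. a m * z ^ m) sums h z" and \<nu>: "0 < \<nu>"
    and i: "integrable lborel (\<lambda>z. (norm (h z))\<^sup>2 * gauss \<nu> z)"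
  shows "summable (\<lambda>m. (norm (a m))\<^sup>2 * (pi * fact m / \<nu> ^ Suc m))"
    and "(\<Sum>m. (norm (a m))\<^sup>2 * (pi * fact m / \<nu> ^ Suc m)) \<le> fock_norm2 \<nu> h"
proof -
  note hol = power_series_holomorphic_UNIV[OF h]
  have c: "continuous_on UNIV (\<lambda>z. (norm (h z))\<^sup>2 * gauss \<nu> z)"
    using hol by (intro continuous_intros gauss_continuous holomorphic_on_imp_continuous_on)
  have le: "(\<Sum>m<N. (norm (a m))\<^sup>2 * (pi * fact m / \<nu> ^ Suc m)) \<le> fock_norm2 \<nu> h" for N
  proof (rule LIMSEQ_le_const2)
    show "(\<lambda>k. \<Sum>m<N. (norm (a m))\<^sup>2 * (LINT z|lborel. cutoff (real (k + 2)) z * (norm z ^ (2 * m) * gauss \<nu> z)))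
        \<longlonglongrightarrow> (\<Sum>m<N. (norm (a m))\<^sup>2 * (pi * fact m / \<nu> ^ Suc m))"
      unfolding gauss_moment(2)[OF \<nu>, symmetric]
      by (intro tendsto_sum tendsto_mult_left cutoff_integral_tendsto gauss_moment(1)[OF \<nu>])
        (simp add: less_imp_le[OF gauss_pos])
    have "(\<Sum>m<N. (norm (a m))\<^sup>2 * (LINT z|lborel. cutoff R z * (norm z ^ (2 * m) * gauss \<nu> z)))
        \<le> fock_norm2 \<nu> h" if R: "0 < R" for R
    proof -
      let ?t = "\<lambda>m. (norm (a m))\<^sup>2 * (LINT z|lborel. cutoff R z * (norm z ^ (2 * m) * gauss \<nu> z))"
      have s: "?t sums (LINT z|lborel. cutoff R z * ((norm (h z))\<^sup>2 * gauss \<nu> z))"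
        by (rule cutoff_power_series_norm[OF h R])
      have "0 \<le> ?t m" for m
        by (intro mult_nonneg_nonneg Bochner_Integration.integral_nonneg)
          (auto simp: cutoff_nonneg less_imp_le[OF gauss_pos])
      then have "(\<Sum>m<N. ?t m) \<le> (\<Sum>m. ?t m)"
        by (intro sum_le_suminf sums_summable[OF s]) auto
      also have "\<dots> = (LINT z|lborel. cutoff R z * ((norm (h z))\<^sup>2 * gauss \<nu> z))"
        using s by (rule sums_unique[symmetric])
      also have "\<dots> \<le> fock_norm2 \<nu> h"
        unfolding fock_norm2_def
        by (rule cutoff_integral_le[OF i _ c R]) (simp add: less_imp_le[OF gauss_pos])
      finally show ?thesis .
    qed
    then show "\<exists>K. \<forall>k\<ge>K. (\<Sum>m<N. (norm (a m))\<^sup>2 *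
        (LINT z|lborel. cutoff (real (k + 2)) z * (norm z ^ (2 * m) * gauss \<nu> z))) \<le> fock_norm2 \<nu> h"
      by simp
  qed
  have p: "0 \<le> (norm (a m))\<^sup>2 * (pi * fact m / \<nu> ^ Suc m)" for m
    using \<nu> by simp
  show s: "summable (\<lambda>m. (norm (a m))\<^sup>2 * (pi * fact m / \<nu> ^ Suc m))"
    using p le by (rule summableI_nonneg_bounded)
  show "(\<Sum>m. (norm (a m))\<^sup>2 * (pi * fact m / \<nu> ^ Suc m)) \<le> fock_norm2 \<nu> h"
    using s le by (rule suminf_le_const)
qed

text \<open>The coefficients bound all cut-off norms of \<open>h\<close>, so monotone convergence
  gives integrability; the reverse inequality is \<open>fock_coefficients_summable\<close>.\<close>

lemma fock_parseval:
  assumes h: "\<And>z. (\<lambda>m. a m * z ^ m) sums h z" and \<nu>: "0 < \<nu>"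
    and s: "summable (\<lambda>m. (norm (a m))\<^sup>2 * (pi * fact m / \<nu> ^ Suc m))"
  shows "integrable lborel (\<lambda>z. (norm (h z))\<^sup>2 * gauss \<nu> z)"
    and "fock_norm2 \<nu> h = (\<Sum>m. (norm (a m))\<^sup>2 * (pi * fact m / \<nu> ^ Suc m))"
proof -
  note hol = power_series_holomorphic_UNIV[OF h]
  let ?S = "\<Sum>m. (norm (a m))\<^sup>2 * (pi * fact m / \<nu> ^ Suc m)"
  define J where "J k = (LINT z|lborel. cutoff (real (k + 2)) z * ((norm (h z))\<^sup>2 * gauss \<nu> z))" for k
  have c: "continuous_on UNIV (\<lambda>z. (norm (h z))\<^sup>2 * gauss \<nu> z)"
    using hol by (intro continuous_intros gauss_continuous holomorphic_on_imp_continuous_on)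
  have ic: "integrable lborel (\<lambda>z. cutoff (real (k + 2)) z * ((norm (h z))\<^sup>2 * gauss \<nu> z))" for k
    using integrable_cutoff(1)[OF c, of "real (k + 2)"] by simp
  have JS: "J k \<le> ?S" for k
  proof -
    have t: "(\<lambda>m. (norm (a m))\<^sup>2 * (LINT z|lborel. cutoff (real (k + 2)) z * (norm z ^ (2 * m) * gauss \<nu> z))) sums J k"
      unfolding J_def by (rule cutoff_power_series_norm[OF h]) simp
    have "(norm (a m))\<^sup>2 * (LINT z|lborel. cutoff (real (k + 2)) z * (norm z ^ (2 * m) * gauss \<nu> z))
        \<le> (norm (a m))\<^sup>2 * (pi * fact m / \<nu> ^ Suc m)" for m
      unfolding gauss_moment(2)[OF \<nu>, symmetric]
      by (intro mult_left_mono cutoff_integral_le gauss_moment(1)[OF \<nu>] continuous_intros gauss_continuous)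
        (auto simp: less_imp_le[OF gauss_pos])
    then show ?thesis
      by (rule sums_le[OF _ t summable_sums[OF s]])
  qed
  have p: "0 \<le> (norm (h z))\<^sup>2 * gauss \<nu> z" for z
    by (simp add: less_imp_le[OF gauss_pos])
  have "incseq J"
    unfolding J_def by (intro monoI integral_mono ic mult_right_mono cutoff_mono p) simp_all
  then obtain L where L: "J \<longlonglongrightarrow> L"
    using incseq_convergent[of J ?S] JS by blast
  note lim = cutoff_integral_limit[OF c p L[unfolded J_def]]
  show i: "integrable lborel (\<lambda>z. (norm (h z))\<^sup>2 * gauss \<nu> z)"
    by (rule lim(1))
  have "fock_norm2 \<nu> h \<le> ?S"
    unfolding fock_norm2_def lim(2) by (rule LIMSEQ_le_const2[OF L]) (use JS in auto)
  then show "fock_norm2 \<nu> h = ?S"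
    using fock_coefficients_summable(2)[OF h \<nu> i] by simp
qed

text \<open>The reciprocal of the norm of z^m, by \<open>gauss_moment\<close>.\<close>

definition fock_coeff :: "real \<Rightarrow> nat \<Rightarrow> real" where
  "fock_coeff \<nu> m = sqrt (\<nu> ^ Suc m / (pi * fact m))"

lemma fock_coeff_pos: "0 < \<nu> \<Longrightarrow> 0 < fock_coeff \<nu> m"
  by (simp add: fock_coeff_def)

lemma fock_coeff_square: "0 < \<nu> \<Longrightarrow> (fock_coeff \<nu> m)\<^sup>2 * (pi * fact m / \<nu> ^ Suc m) = 1"
  by (simp add: fock_coeff_def)

lemma fock_coeff_summable:
  assumes \<nu>: "0 < \<nu>" and r: "0 \<le> r"
  shows "summable (\<lambda>m. fock_coeff \<nu> m * r ^ m)"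
proof -
  have rec: "fock_coeff \<nu> (Suc m) = sqrt (\<nu> * (1 / real (Suc m))) * fock_coeff \<nu> m" for m
    unfolding fock_coeff_def real_sqrt_mult[symmetric] by (simp add: field_simps)
  have "(\<lambda>m. sqrt (\<nu> * (1 / real (Suc m))) * r) \<longlonglongrightarrow> sqrt (\<nu> * 0) * r"
    using LIMSEQ_inverse_real_of_nat by (intro tendsto_intros) (simp add: inverse_eq_divide)
  then have "eventually (\<lambda>m. sqrt (\<nu> * (1 / real (Suc m))) * r < 1 / 2) sequentially"
    by (rule order_tendstoD) simp
  then obtain N where N: "\<And>m. m \<ge> N \<Longrightarrow> sqrt (\<nu> * (1 / real (Suc m))) * r < 1 / 2"
    by (auto simp: eventually_sequentially)
  show ?thesis
  proof (rule summable_ratio_test[where N = N and c = "1 / 2"])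
    show "norm (fock_coeff \<nu> (Suc m) * r ^ Suc m) \<le> 1 / 2 * norm (fock_coeff \<nu> m * r ^ m)" if "N \<le> m" for m
    proof -
      have "norm (fock_coeff \<nu> (Suc m) * r ^ Suc m)
          = (sqrt (\<nu> * (1 / real (Suc m))) * r) * (fock_coeff \<nu> m * r ^ m)"
        unfolding rec using fock_coeff_pos[OF \<nu>, of m] r \<nu> by (simp add: abs_mult del: of_nat_Suc)
      also have "\<dots> \<le> 1 / 2 * (fock_coeff \<nu> m * r ^ m)"
        using N[OF that] fock_coeff_pos[OF \<nu>, of m] r by (intro mult_right_mono) auto
      finally show ?thesis
        using fock_coeff_pos[OF \<nu>, of m] r by simp
    qed
  qed simp
qed

definition fock_basis :: "real \<Rightarrow> nat \<Rightarrow> complex \<Rightarrow> complex" where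
  "fock_basis \<nu> m z = complex_of_real (fock_coeff \<nu> m) * z ^ m"

lemma fock_entire_family:
  assumes \<nu>: "0 < \<nu>" and c: "\<And>m. norm (c m) \<le> C * q ^ m" and q: "0 \<le> q"
  shows "entire_family (\<lambda>m z. c m * fock_basis \<nu> m z)"
  unfolding entire_family_def
proof (intro conjI allI)
  show "(\<lambda>z. c m * fock_basis \<nu> m z) holomorphic_on UNIV" for m
    unfolding fock_basis_def by (intro holomorphic_intros)
  fix R :: real
  let ?R = "max R 0"
  have "norm (c m * fock_basis \<nu> m z) \<le> C * (fock_coeff \<nu> m * (q * ?R) ^ m)" if "norm z \<le> R" for m z
  proof -
    have "norm (c m * fock_basis \<nu> m z) = norm (c m) * (fock_coeff \<nu> m * norm z ^ m)"
      using fock_coeff_pos[OF \<nu>, of m] by (simp add: fock_basis_def norm_mult norm_power)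
    also have "\<dots> \<le> (C * q ^ m) * (fock_coeff \<nu> m * ?R ^ m)"
      using that fock_coeff_pos[OF \<nu>, of m] c[of m] order_trans[OF norm_ge_zero c[of m]]
      by (intro mult_mono mult_left_mono power_mono) auto
    finally show ?thesis
      by (simp add: power_mult_distrib mult_ac)
  qed
  moreover have "summable (\<lambda>m. C * (fock_coeff \<nu> m * (q * ?R) ^ m))"
    using q by (intro summable_mult fock_coeff_summable \<nu>) auto
  ultimately show "\<exists>M. summable M \<and> (\<forall>m z. norm z \<le> R \<longrightarrow> norm (c m * fock_basis \<nu> m z) \<le> M m)"
    by blast
qed

lemma square_summable_bounded:
  assumes "summable (\<lambda>m. (norm (c m))\<^sup>2)"
  shows "\<exists>C. \<forall>m. norm (c m :: complex) \<le> C"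
proof -
  have "(norm (c m))\<^sup>2 \<le> (\<Sum>m. (norm (c m))\<^sup>2)" for m
    using assms sum_le_suminf[OF assms, of "{m}"] by simp
  then have "norm (c m) \<le> sqrt (\<Sum>m. (norm (c m))\<^sup>2)" for m
    by (rule real_le_rsqrt)
  then show ?thesis by blast
qed

text \<open>An isometry from square-summable sequences into \<open>Fock \<nu> 0\<close>;
  \<open>fock_analysis\<close> shows that it is onto.\<close>

lemma fock_synthesis:
  assumes c: "summable (\<lambda>m. (norm (c m))\<^sup>2)" and \<nu>: "0 < \<nu>"
  shows "entire_family (\<lambda>m z. c m * fock_basis \<nu> m z)"
    and "(\<lambda>z. \<Sum>m. c m * fock_basis \<nu> m z) \<in> Fock \<nu> 0"
    and "fock_norm2 \<nu> (\<lambda>z. \<Sum>m. c m * fock_basis \<nu> m z) = (\<Sum>m. (norm (c m))\<^sup>2)"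
proof -
  obtain C where "\<And>m. norm (c m) \<le> C" using square_summable_bounded[OF c] by blast
  then show e: "entire_family (\<lambda>m z. c m * fock_basis \<nu> m z)"
    by (intro fock_entire_family[OF \<nu>, of c C 1]) auto
  let ?a = "\<lambda>m. c m * complex_of_real (fock_coeff \<nu> m)"
  have h: "(\<lambda>m. ?a m * z ^ m) sums (\<Sum>m. c m * fock_basis \<nu> m z)" for z
    using summable_norm_cancel[OF entire_family_summable[OF e, of z]]
    by (simp add: summable_sums fock_basis_def mult.assoc)
  have n: "(norm (?a m))\<^sup>2 * (pi * fact m / \<nu> ^ Suc m) = (norm (c m))\<^sup>2" for m
  proof -
    have "(norm (?a m))\<^sup>2 * (pi * fact m / \<nu> ^ Suc m) = (norm (c m))\<^sup>2 * ((fock_coeff \<nu> m)\<^sup>2 * (pi * fact m / \<nu> ^ Suc m))"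
      by (simp add: norm_mult power_mult_distrib)
    then show ?thesis
      unfolding fock_coeff_square[OF \<nu>] by simp
  qed
  show "(\<lambda>z. \<Sum>m. c m * fock_basis \<nu> m z) \<in> Fock \<nu> 0"
    unfolding Fock_0_iff[OF \<nu>] using fock_parseval(1)[OF h \<nu>] c entire_family_deriv(2)[OF e]
    unfolding n by blast
  show "fock_norm2 \<nu> (\<lambda>z. \<Sum>m. c m * fock_basis \<nu> m z) = (\<Sum>m. (norm (c m))\<^sup>2)"
    using fock_parseval(2)[OF h \<nu>] c unfolding n by blast
qed

lemma fock_analysis:
  assumes h: "h \<in> Fock \<nu> 0" and \<nu>: "0 < \<nu>"
  shows "\<exists>c. summable (\<lambda>m. (norm (c m))\<^sup>2) \<and> h = (\<lambda>z. \<Sum>m. c m * fock_basis \<nu> m z)"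
proof -
  have hol: "h holomorphic_on UNIV" and i: "integrable lborel (\<lambda>z. (norm (h z))\<^sup>2 * gauss \<nu> z)"
    using h by (auto simp: Fock_0_iff[OF \<nu>])
  define a where "a m = (deriv ^^ m) h 0 / fact m" for m
  have s: "(\<lambda>m. a m * z ^ m) sums h z" for z
    using holomorphic_power_series[of h 0 "norm z + 1" z] hol
    by (auto simp: a_def intro: holomorphic_on_subset)
  let ?c = "\<lambda>m. a m / complex_of_real (fock_coeff \<nu> m)"
  have "(norm (?c m))\<^sup>2 = (norm (a m))\<^sup>2 * (pi * fact m / \<nu> ^ Suc m)" for m
    using fock_coeff_pos[OF \<nu>, of m] fock_coeff_square[OF \<nu>, of m] \<nu>
    by (simp add: norm_divide power_divide field_simps)
  then have "summable (\<lambda>m. (norm (?c m))\<^sup>2)"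
    using fock_coefficients_summable(1)[OF s \<nu> i] by simp
  moreover have "h z = (\<Sum>m. ?c m * fock_basis \<nu> m z)" for z
  proof -
    have "?c m * fock_basis \<nu> m z = a m * z ^ m" for m
      using fock_coeff_pos[OF \<nu>, of m] by (simp add: fock_basis_def)
    then show ?thesis
      using s[of z] by (simp add: sums_iff)
  qed
  ultimately show ?thesis
    by (intro exI[of _ ?c] conjI ext)
qed

section \<open>Orthonormal sequences in spaces of square-integrable functions\<close>

definition l2_sq :: "'a measure \<Rightarrow> ('a \<Rightarrow> complex) \<Rightarrow> real" where
  "l2_sq M f = (LINT x|M. (norm (f x))\<^sup>2)"

lemma l2_sq_nonneg: "0 \<le> l2_sq M f"
  unfolding l2_sq_def by (intro Bochner_Integration.integral_nonneg) auto

lemma l2_inner_self: "l2_inner M f f = complex_of_real (l2_sq M f)"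
  unfolding l2_inner_def l2_sq_def complex_norm_square[symmetric] integral_complex_of_real ..

lemma l2_norm_eq: "l2_norm M f = sqrt (l2_sq M f)"
  by (simp add: l2_norm_def l2_inner_self)

lemma L2_measurable: "f \<in> L2 M \<Longrightarrow> f \<in> borel_measurable M"
  and L2_integrable: "f \<in> L2 M \<Longrightarrow> integrable M (\<lambda>x. (norm (f x))\<^sup>2)"
  by (simp_all add: L2_def)

text \<open>The arithmetic-geometric bound stands in for Cauchy-Schwarz. For normalised
  \<open>g\<close> it depends on \<open>f\<close> alone, as needed in
  \<open>orthonormal_pairing\<close>.\<close>

lemma L2_integrable_mult:
  assumes "f \<in> L2 M" "g \<in> L2 M"
  shows "integrable M (\<lambda>x. norm (f x) * norm (g x))" "integrable M (\<lambda>x. f x * cnj (g x))"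
    and "(LINT x|M. norm (f x) * norm (g x)) \<le> (l2_sq M f + l2_sq M g) / 2"
proof -
  have [measurable]: "f \<in> borel_measurable M" "g \<in> borel_measurable M"
    using assms by (auto dest: L2_measurable)
  have [measurable]: "(\<lambda>x. cnj (g x)) \<in> borel_measurable M"
    by (rule borel_measurable_continuous_on[of cnj]) (auto intro: continuous_intros)
  have i: "integrable M (\<lambda>x. ((norm (f x))\<^sup>2 + (norm (g x))\<^sup>2) / 2)"
    using assms by (intro integrable_divide Bochner_Integration.integrable_add L2_integrable)
  have b: "norm (f x) * norm (g x) \<le> ((norm (f x))\<^sup>2 + (norm (g x))\<^sup>2) / 2" for x
    using sum_squares_bound[of "norm (f x)" "norm (g x)"] by simp
  have i0: "integrable M (\<lambda>x. norm (f x) * norm (g x))"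
    by (rule Bochner_Integration.integrable_bound[OF i]) (use b in auto)
  then show "integrable M (\<lambda>x. norm (f x) * norm (g x))" .
  show "integrable M (\<lambda>x. f x * cnj (g x))"
    by (rule Bochner_Integration.integrable_bound[OF i0]) (auto simp: norm_mult)
  have "(LINT x|M. norm (f x) * norm (g x)) \<le> (LINT x|M. ((norm (f x))\<^sup>2 + (norm (g x))\<^sup>2) / 2)"
    using i0 i b by (intro integral_mono) auto
  also have "\<dots> = (l2_sq M f + l2_sq M g) / 2"
    using assms by (simp add: l2_sq_def L2_integrable)
  finally show "(LINT x|M. norm (f x) * norm (g x)) \<le> (l2_sq M f + l2_sq M g) / 2" .
qed

lemma L2_cmult:
  assumes "f \<in> L2 M"
  shows "(\<lambda>x. c * f x) \<in> L2 M"
  using assms by (auto simp: L2_def norm_mult power_mult_distrib)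

lemma L2_add:
  assumes "f \<in> L2 M" "g \<in> L2 M"
  shows "(\<lambda>x. f x + g x) \<in> L2 M"
proof -
  have m[measurable]: "f \<in> borel_measurable M" "g \<in> borel_measurable M"
    using assms by (auto dest: L2_measurable)
  have i: "integrable M (\<lambda>x. 2 * ((norm (f x))\<^sup>2 + (norm (g x))\<^sup>2))"
    using assms by (intro integrable_mult_right Bochner_Integration.integrable_add L2_integrable)
  have b: "(norm (f x + g x))\<^sup>2 \<le> 2 * ((norm (f x))\<^sup>2 + (norm (g x))\<^sup>2)" for x
  proof -
    have "(norm (f x + g x))\<^sup>2 \<le> (norm (f x) + norm (g x))\<^sup>2"
      by (intro power_mono norm_triangle_ineq) auto
    also have "\<dots> \<le> 2 * ((norm (f x))\<^sup>2 + (norm (g x))\<^sup>2)"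
      using sum_squares_bound[of "norm (f x)" "norm (g x)"] by (simp add: power2_sum)
    finally show ?thesis .
  qed
  have "integrable M (\<lambda>x. (norm (f x + g x))\<^sup>2)"
    by (rule Bochner_Integration.integrable_bound[OF i]) (use b in auto)
  then show ?thesis
    by (simp add: L2_def)
qed

lemma L2_diff:
  assumes "f \<in> L2 M" "g \<in> L2 M"
  shows "(\<lambda>x. f x - g x) \<in> L2 M"
  using L2_add[OF assms(1) L2_cmult[OF assms(2), of "-1"]] by simp

lemma L2_zero: "(\<lambda>x. 0) \<in> L2 M"
  by (simp add: L2_def)

lemma L2_sum:
  assumes "\<And>i. i \<in> I \<Longrightarrow> f i \<in> L2 M"
  shows "(\<lambda>x. \<Sum>i\<in>I. f i x) \<in> L2 M"
  using assms by (induction I rule: infinite_finite_induct) (auto intro: L2_zero L2_add)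

lemma l2_inner_cnj: "l2_inner M g f = cnj (l2_inner M f g)"
  unfolding l2_inner_def Bochner_Integration.integral_cnj[symmetric] by (simp add: mult.commute)

lemma l2_inner_cmult: "l2_inner M (\<lambda>x. c * f x) g = c * l2_inner M f g"
  by (simp add: l2_inner_def mult.assoc)

lemma l2_inner_diff:
  assumes "f \<in> L2 M" "g \<in> L2 M" "h \<in> L2 M"
  shows "l2_inner M (\<lambda>x. f x - g x) h = l2_inner M f h - l2_inner M g h"
  using assms by (simp add: l2_inner_def left_diff_distrib L2_integrable_mult)

lemma l2_inner_sum:
  assumes "\<And>i. i \<in> I \<Longrightarrow> f i \<in> L2 M" "h \<in> L2 M"
  shows "l2_inner M (\<lambda>x. \<Sum>i\<in>I. f i x) h = (\<Sum>i\<in>I. l2_inner M (f i) h)"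
  using assms by (simp add: l2_inner_def sum_distrib_right L2_integrable_mult Bochner_Integration.integral_sum)

lemma l2_sq_cong_AE:
  assumes "f \<in> borel_measurable M" "g \<in> borel_measurable M" "AE x in M. f x - g x = 0"
  shows "l2_sq M f = l2_sq M g"
  unfolding l2_sq_def using assms by (intro integral_cong_AE) auto

text \<open>Totality is stated almost everywhere because \<open>L2\<close> consists of functions,
  not of classes.\<close>

locale orthonormal_sequence =
  fixes M :: "'a measure" and \<phi> :: "nat \<Rightarrow> 'a \<Rightarrow> complex"
  assumes in_L2: "\<phi> m \<in> L2 M"
    and orthonormal: "l2_inner M (\<phi> m) (\<phi> k) = (if m = k then 1 else 0)"
    and total: "f \<in> L2 M \<Longrightarrow> (\<And>m. l2_inner M f (\<phi> m) = 0) \<Longrightarrow> AE x in M. f x = 0"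
begin

definition psum :: "(nat \<Rightarrow> complex) \<Rightarrow> nat \<Rightarrow> 'a \<Rightarrow> complex" where
  "psum c N x = (\<Sum>m<N. c m * \<phi> m x)"

lemma psum_L2: "psum c N \<in> L2 M"
  unfolding psum_def[abs_def] by (intro L2_sum L2_cmult in_L2)

lemma inner_psum:
  assumes "h \<in> L2 M"
  shows "l2_inner M (psum c N) h = (\<Sum>m<N. c m * cnj (l2_inner M h (\<phi> m)))"
  unfolding psum_def[abs_def]
  by (subst l2_inner_sum) (auto simp: assms L2_cmult in_L2 l2_inner_cmult l2_inner_cnj[of M _ h])

lemma coeff_psum: "l2_inner M (psum c N) (\<phi> k) = (if k < N then c k else 0)"
  by (simp add: inner_psum[OF in_L2] orthonormal if_distrib cong: if_cong)

lemma pythagoras: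
  assumes f: "f \<in> L2 M" and c: "\<And>m. m < N \<Longrightarrow> l2_inner M f (\<phi> m) = c m"
  shows "l2_sq M (\<lambda>x. f x - psum c N x) = l2_sq M f - (\<Sum>m<N. (norm (c m))\<^sup>2)"
proof -
  let ?P = "psum c N"
  have S: "(\<Sum>m<N. c m * cnj (c m)) = complex_of_real (\<Sum>m<N. (norm (c m))\<^sup>2)"
    unfolding of_real_sum complex_norm_square ..
  have Pf: "l2_inner M ?P f = complex_of_real (\<Sum>m<N. (norm (c m))\<^sup>2)"
    unfolding S[symmetric] inner_psum[OF f] using c by simp
  have PP: "l2_inner M ?P ?P = complex_of_real (\<Sum>m<N. (norm (c m))\<^sup>2)"
    unfolding S[symmetric] inner_psum[OF psum_L2] by (simp add: coeff_psum)
  note L = f psum_L2 L2_diff[OF f psum_L2]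
  have fP: "l2_inner M f ?P = complex_of_real (\<Sum>m<N. (norm (c m))\<^sup>2)"
    unfolding l2_inner_cnj[of M f ?P] Pf by simp
  have "complex_of_real (l2_sq M (\<lambda>x. f x - ?P x))
      = l2_inner M f (\<lambda>x. f x - ?P x) - l2_inner M ?P (\<lambda>x. f x - ?P x)"
    unfolding l2_inner_self[symmetric] by (intro l2_inner_diff L)
  also have "l2_inner M f (\<lambda>x. f x - ?P x) = cnj (l2_inner M f f - l2_inner M ?P f)"
    unfolding l2_inner_cnj[of M f "\<lambda>x. f x - ?P x"] by (simp add: l2_inner_diff L)
  also have "l2_inner M ?P (\<lambda>x. f x - ?P x) = cnj (l2_inner M f ?P - l2_inner M ?P ?P)"
    unfolding l2_inner_cnj[of M ?P "\<lambda>x. f x - ?P x"] by (simp add: l2_inner_diff L)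
  also have "cnj (l2_inner M f f - l2_inner M ?P f) - cnj (l2_inner M f ?P - l2_inner M ?P ?P)
      = complex_of_real (l2_sq M f - (\<Sum>m<N. (norm (c m))\<^sup>2))"
    unfolding Pf PP fP unfolding l2_inner_self by simp
  finally show ?thesis
    by (simp only: of_real_eq_iff)
qed

lemma bessel:
  assumes f: "f \<in> L2 M"
  shows "(\<Sum>m<N. (norm (l2_inner M f (\<phi> m)))\<^sup>2) \<le> l2_sq M f"
    and "summable (\<lambda>m. (norm (l2_inner M f (\<phi> m)))\<^sup>2)"
    and "(norm (l2_inner M f (\<phi> m)))\<^sup>2 \<le> l2_sq M f"
proof -
  show *: "(\<Sum>m<N. (norm (l2_inner M f (\<phi> m)))\<^sup>2) \<le> l2_sq M f" for N
    using pythagoras[OF f, of N "\<lambda>m. l2_inner M f (\<phi> m)"]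
      l2_sq_nonneg[of M "\<lambda>x. f x - psum (\<lambda>m. l2_inner M f (\<phi> m)) N x"] by simp
  then show s: "summable (\<lambda>m. (norm (l2_inner M f (\<phi> m)))\<^sup>2)"
    by (intro summableI_nonneg_bounded) auto
  have "(norm (l2_inner M f (\<phi> m)))\<^sup>2 \<le> (\<Sum>m<Suc m. (norm (l2_inner M f (\<phi> m)))\<^sup>2)"
    by (simp add: sum_nonneg)
  then show "(norm (l2_inner M f (\<phi> m)))\<^sup>2 \<le> l2_sq M f"
    using *[of "Suc m"] by simp
qed

lemma psum_diff:
  assumes "a \<le> b" and s: "summable (\<lambda>m. (norm (c m))\<^sup>2)"
  shows "l2_sq M (\<lambda>x. psum c b x - psum c a x) \<le> (\<Sum>m. (norm (c (m + a)))\<^sup>2)"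
proof -
  have "l2_sq M (psum c b) = (\<Sum>m<b. (norm (c m))\<^sup>2)"
  proof -
    have "l2_inner M (psum c b) (psum c b) = complex_of_real (\<Sum>m<b. (norm (c m))\<^sup>2)"
      unfolding inner_psum[OF psum_L2] of_real_sum complex_norm_square by (simp add: coeff_psum)
    then show ?thesis
      unfolding l2_inner_self by (simp only: of_real_eq_iff)
  qed
  then have "l2_sq M (\<lambda>x. psum c b x - psum c a x) = (\<Sum>m<b. (norm (c m))\<^sup>2) - (\<Sum>m<a. (norm (c m))\<^sup>2)"
    using pythagoras[OF psum_L2, of a c b c] assms by (simp add: coeff_psum)
  also have "\<dots> \<le> (\<Sum>m. (norm (c m))\<^sup>2) - (\<Sum>m<a. (norm (c m))\<^sup>2)"
    using sum_le_suminf[OF s, of "{..<b}"] by simp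
  also have "\<dots> = (\<Sum>m. (norm (c (m + a)))\<^sup>2)"
    using suminf_split_initial_segment[OF s, of a] by simp
  finally show ?thesis .
qed

text \<open>Riesz--Fischer: along a subsequence whose increments have rapidly decreasing norms, the partial
  sums converge almost everywhere, and Fatou's lemma controls the distance to the limit.\<close>

lemma riesz_fischer:
  assumes c: "summable (\<lambda>m. (norm (c m))\<^sup>2)"
  shows "\<exists>f\<in>L2 M. (\<forall>m. l2_inner M f (\<phi> m) = c m) \<and> l2_sq M f = (\<Sum>m. (norm (c m))\<^sup>2)"
proof -
  let ?t = "\<lambda>a. \<Sum>m. (norm (c (m + a)))\<^sup>2"
  have "\<exists>K. \<forall>n\<ge>K. norm (?t n) < (1 / 4) ^ k" for k
    by (rule suminf_exist_split) (use c in auto)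
  then obtain K where K: "\<And>k n. n \<ge> K k \<Longrightarrow> norm (?t n) < (1 / 4) ^ k"
    by metis
  \<comment> \<open>Nondecreasing, at least \<open>k\<close>, and beyond the threshold
    \<open>K k\<close>: the three properties used below.\<close>
  define r where "r k = k + (\<Sum>j\<le>k. K j)" for k
  have r_mono: "r j \<le> r k" if "j \<le> k" for j k
    unfolding r_def using that by (intro add_mono sum_mono2) auto
  have r_ge: "k \<le> r k" for k by (simp add: r_def)
  have tr: "?t (r k) \<le> (1 / 4) ^ k" for k
  proof -
    have "K k \<le> (\<Sum>j\<le>k. K j)"
      by (rule member_le_sum) auto
    then have "norm (?t (r k)) < (1 / 4) ^ k"
      by (intro K) (simp add: r_def)
    then show ?thesis by simp
  qed
  define Q where "Q k = psum c (r k)" for k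
  have QL: "Q k \<in> L2 M" for k unfolding Q_def by (rule psum_L2)
  have [measurable]: "Q k \<in> borel_measurable M" for k using QL by (rule L2_measurable)
  have dist: "l2_sq M (\<lambda>x. Q j x - Q k x) \<le> (1 / 4) ^ k" if "k \<le> j" for j k
    unfolding Q_def using psum_diff[OF r_mono[OF that] c] tr[of k] by simp
  have nn: "(\<integral>\<^sup>+x. ennreal ((norm (Q j x - Q k x))\<^sup>2) \<partial>M) \<le> ennreal ((1 / 4) ^ k)" if "k \<le> j" for j k
    using L2_integrable[OF L2_diff[OF QL QL]] dist[OF that]
    by (subst nn_integral_eq_integral) (auto simp: l2_sq_def intro: ennreal_leI)
  \<comment> \<open>Squared increments have integral at most 4^-k. The weight 2^k leaves the
    summable bound 2^-k, and wherever the weighted sum is finite the increments decay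
    geometrically.\<close>
  let ?g = "\<lambda>k x. 2 ^ k * (norm (Q (Suc k) x - Q k x))\<^sup>2"
  have "(\<integral>\<^sup>+x. (\<Sum>k. ennreal (?g k x)) \<partial>M) = (\<Sum>k. \<integral>\<^sup>+x. ennreal (?g k x) \<partial>M)"
    by (rule nn_integral_suminf) simp
  also have "\<dots> \<le> (\<Sum>k. ennreal ((1 / 2) ^ k))"
  proof (rule suminf_le)
    fix k
    have "(\<integral>\<^sup>+x. ennreal (?g k x) \<partial>M) = ennreal (2 ^ k) * (\<integral>\<^sup>+x. ennreal ((norm (Q (Suc k) x - Q k x))\<^sup>2) \<partial>M)"
      by (simp add: ennreal_mult nn_integral_cmult)
    also have "\<dots> \<le> ennreal (2 ^ k) * ennreal ((1 / 4) ^ k)"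
      by (intro mult_left_mono nn) auto
    also have "\<dots> = ennreal ((1 / 2) ^ k)"
      by (simp add: power_mult_distrib[symmetric] flip: ennreal_mult)
    finally show "(\<integral>\<^sup>+x. ennreal (?g k x) \<partial>M) \<le> ennreal ((1 / 2) ^ k)" .
  qed auto
  also have "\<dots> < \<infinity>"
    by (subst suminf_ennreal2) auto
  finally have "AE x in M. (\<Sum>k. ennreal (?g k x)) \<noteq> \<infinity>"
    by (intro nn_integral_PInf_AE) auto
  then have conv: "AE x in M. convergent (\<lambda>k. Q k x)"
  proof (rule AE_mp, intro AE_I2 impI)
    fix x assume "(\<Sum>k. ennreal (?g k x)) \<noteq> \<infinity>"
    then have s: "summable (\<lambda>k. ?g k x)"
      by (intro summable_suminf_not_top) auto
    define T where "T = (\<Sum>k. ?g k x)"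
    have b: "norm (Q (Suc k) x - Q k x) \<le> sqrt T * sqrt (1 / 2) ^ k" for k
    proof -
      have "?g k x \<le> T"
        using sum_le_suminf[OF s, of "{k}"] by (simp add: T_def)
      then have "(norm (Q (Suc k) x - Q k x))\<^sup>2 \<le> T * (1 / 2) ^ k"
        by (simp add: power_divide field_simps)
      then have "norm (Q (Suc k) x - Q k x) \<le> sqrt (T * (1 / 2) ^ k)"
        by (rule real_le_rsqrt)
      then show ?thesis
        by (simp only: real_sqrt_mult real_sqrt_power)
    qed
    have "summable (\<lambda>k. sqrt T * sqrt (1 / 2) ^ k)"
      by (intro summable_mult summable_geometric) (simp add: real_sqrt_divide)
    then have "summable (\<lambda>k. Q (Suc k) x - Q k x)"
      by (rule summable_comparison_test') (rule b)
    moreover have "(\<Sum>k<n. Q (Suc k) x - Q k x) = Q n x - Q 0 x" for n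
      by (rule sum_lessThan_telescope)
    ultimately show "convergent (\<lambda>k. Q k x)"
      by (simp only: summable_iff_convergent convergent_diff_const_right_iff)
  qed
  \<comment> \<open>Where the subsequence diverges, a null set, \<open>lim\<close> is a default
    value; \<open>F\<close> is measurable all the same.\<close>
  define F where "F x = lim (\<lambda>k. Q k x)" for x
  have [measurable]: "F \<in> borel_measurable M"
    unfolding F_def by measurable
  have lim: "AE x in M. (\<lambda>k. Q k x) \<longlonglongrightarrow> F x"
    using conv by eventually_elim (simp add: F_def convergent_LIMSEQ_iff)
  have fatou: "(\<integral>\<^sup>+x. ennreal ((norm (F x - Q k x))\<^sup>2) \<partial>M) \<le> ennreal ((1 / 4) ^ k)" for k
  proof -
    have "(\<integral>\<^sup>+x. ennreal ((norm (F x - Q k x))\<^sup>2) \<partial>M)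
        = (\<integral>\<^sup>+x. liminf (\<lambda>j. ennreal ((norm (Q j x - Q k x))\<^sup>2)) \<partial>M)"
    proof (rule nn_integral_cong_AE, use lim in eventually_elim)
      fix x assume "(\<lambda>j. Q j x) \<longlonglongrightarrow> F x"
      then have "(\<lambda>j. ennreal ((norm (Q j x - Q k x))\<^sup>2)) \<longlonglongrightarrow> ennreal ((norm (F x - Q k x))\<^sup>2)"
        by (intro tendsto_ennrealI tendsto_intros)
      then show "ennreal ((norm (F x - Q k x))\<^sup>2) = liminf (\<lambda>j. ennreal ((norm (Q j x - Q k x))\<^sup>2))"
        by (intro lim_imp_Liminf[symmetric]) auto
    qed
    also have "\<dots> \<le> liminf (\<lambda>j. \<integral>\<^sup>+x. ennreal ((norm (Q j x - Q k x))\<^sup>2) \<partial>M)"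
      by (rule nn_integral_liminf) measurable
    also have "\<dots> \<le> ennreal ((1 / 4) ^ k)"
    proof -
      have "\<forall>\<^sub>F j in sequentially. (\<integral>\<^sup>+x. ennreal ((norm (Q j x - Q k x))\<^sup>2) \<partial>M) \<le> ennreal ((1 / 4) ^ k)"
        using eventually_ge_at_top[of k] by eventually_elim (rule nn)
      then have "limsup (\<lambda>j. \<integral>\<^sup>+x. ennreal ((norm (Q j x - Q k x))\<^sup>2) \<partial>M) \<le> ennreal ((1 / 4) ^ k)"
        by (rule Limsup_bounded)
      then show ?thesis
        using Liminf_le_Limsup[of sequentially "\<lambda>j. \<integral>\<^sup>+x. ennreal ((norm (Q j x - Q k x))\<^sup>2) \<partial>M"] by simp
    qed
    finally show ?thesis .
  qed
  have dL: "(\<lambda>x. F x - Q k x) \<in> L2 M" for k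
  proof -
    have "integrable M (\<lambda>x. (norm (F x - Q k x))\<^sup>2)"
      using fatou[of k] by (intro integrableI_bounded) (auto simp: less_top[symmetric] top_unique le_less_trans)
    then show ?thesis by (simp add: L2_def)
  qed
  have dn: "l2_sq M (\<lambda>x. F x - Q k x) \<le> (1 / 4) ^ k" for k
  proof -
    have "ennreal (l2_sq M (\<lambda>x. F x - Q k x)) \<le> ennreal ((1 / 4) ^ k)"
      using fatou[of k] L2_integrable[OF dL[of k]]
      by (subst (asm) nn_integral_eq_integral) (auto simp: l2_sq_def)
    then show ?thesis by simp
  qed
  have FL: "F \<in> L2 M"
    using L2_add[OF dL[of 0] QL[of 0]] by simp
  have p0: "(\<lambda>k. (1 / 4 :: real) ^ k) \<longlonglongrightarrow> 0"
    by (intro LIMSEQ_power_zero) simp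
  have cF: "l2_inner M F (\<phi> m) = c m" for m
  proof -
    \<comment> \<open>Once \<open>r k\<close> exceeds \<open>m\<close>, the coefficient of
      \<open>Q k\<close> is \<open>c m\<close>, so Bessel's inequality for \<open>F - Q k\<close>
      bounds the discrepancy.\<close>
    have "(norm (l2_inner M F (\<phi> m) - c m))\<^sup>2 \<le> (1 / 4) ^ k" if "Suc m \<le> k" for k
    proof -
      have "l2_inner M (\<lambda>x. F x - Q k x) (\<phi> m) = l2_inner M F (\<phi> m) - c m"
        using that r_ge[of k] by (simp add: l2_inner_diff FL QL in_L2) (simp add: Q_def coeff_psum)
      then show ?thesis
        using bessel(3)[OF dL[of k], of m] dn[of k] by simp
    qed
    then have "(norm (l2_inner M F (\<phi> m) - c m))\<^sup>2 \<le> 0"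
      by (intro LIMSEQ_le_const[OF p0]) blast
    then show ?thesis by simp
  qed
  have "l2_sq M F = (\<Sum>m. (norm (c m))\<^sup>2)"
  proof (rule LIMSEQ_unique)
    have e: "l2_sq M F - (\<Sum>m<r k. (norm (c m))\<^sup>2) = l2_sq M (\<lambda>x. F x - Q k x)" for k
      unfolding Q_def using pythagoras[OF FL, of "r k" c] cF by simp
    have "(\<lambda>k. l2_sq M F - (\<Sum>m<r k. (norm (c m))\<^sup>2)) \<longlonglongrightarrow> 0"
      unfolding e by (rule tendsto_sandwich[OF _ _ tendsto_const p0]) (auto simp: l2_sq_nonneg dn)
    then show "(\<lambda>k. \<Sum>m<r k. (norm (c m))\<^sup>2) \<longlonglongrightarrow> l2_sq M F"
      using tendsto_diff[OF tendsto_const[of "l2_sq M F"]] by fastforce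
    have "filterlim r at_top sequentially"
      using r_ge by (intro filterlim_at_top_mono[OF filterlim_ident]) auto
    then show "(\<lambda>k. \<Sum>m<r k. (norm (c m))\<^sup>2) \<longlonglongrightarrow> (\<Sum>m. (norm (c m))\<^sup>2)"
      using filterlim_compose[OF summable_LIMSEQ[OF c]] by blast
  qed
  with FL cF show ?thesis by blast
qed

text \<open>Riesz-Fischer produces a function with the coefficients of \<open>f\<close> and the
  expected norm; totality identifies it with \<open>f\<close> almost everywhere.\<close>

lemma parseval:
  assumes f: "f \<in> L2 M"
  shows "l2_sq M f = (\<Sum>m. (norm (l2_inner M f (\<phi> m)))\<^sup>2)"
proof -
  obtain g where g: "g \<in> L2 M" "\<And>m. l2_inner M g (\<phi> m) = l2_inner M f (\<phi> m)"
    "l2_sq M g = (\<Sum>m. (norm (l2_inner M f (\<phi> m)))\<^sup>2)"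
    using riesz_fischer[OF bessel(2)[OF f]] by blast
  have "AE x in M. f x - g x = 0"
    by (rule total) (use f g in \<open>auto intro: L2_diff simp: l2_inner_diff in_L2\<close>)
  then have "l2_sq M f = l2_sq M g"
    by (intro l2_sq_cong_AE L2_measurable f g)
  with g show ?thesis by simp
qed

end

text \<open>Exchanges the integral with the kernel series. The integrals of the absolute values are
  at most (|f|^2 + 1) / 2 times the norm of \<open>e m\<close>. The sequence \<open>e\<close> is
  arbitrary so that it can be the values of \<open>fock_basis\<close> or of their images under
  powers of \<open>A\<close>.\<close>

lemma orthonormal_pairing:
  assumes f: "f \<in> L2 M" and \<phi>: "\<And>m. \<phi> m \<in> L2 M" "\<And>m. l2_sq M (\<phi> m) = 1"
    and e: "summable (\<lambda>m. norm (e m))" and s: "\<And>x. summable (\<lambda>m. norm (cnj (\<phi> m x) * e m))"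
  shows "integrable M (\<lambda>x. f x * (\<Sum>m. cnj (\<phi> m x) * e m))"
    and "(LINT x|M. f x * (\<Sum>m. cnj (\<phi> m x) * e m)) = (\<Sum>m. l2_inner M f (\<phi> m) * e m)"
proof -
  let ?u = "\<lambda>m x. f x * cnj (\<phi> m x) * e m"
  have i: "integrable M (?u m)" for m
    by (intro integrable_mult_left L2_integrable_mult f \<phi>)
  have a: "AE x in M. summable (\<lambda>m. norm (?u m x))"
  proof (rule AE_I2)
    fix x
    have "norm (?u m x) = norm (f x) * norm (cnj (\<phi> m x) * e m)" for m
      by (simp add: norm_mult mult.assoc)
    then show "summable (\<lambda>m. norm (?u m x))"
      by (simp only: summable_mult[OF s])
  qed
  have "(LINT x|M. norm (?u m x)) \<le> (l2_sq M f + 1) / 2 * norm (e m)" for m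
  proof -
    have "(LINT x|M. norm (?u m x)) = (LINT x|M. norm (f x) * norm (\<phi> m x)) * norm (e m)"
      by (simp add: norm_mult)
    also have "\<dots> \<le> (l2_sq M f + 1) / 2 * norm (e m)"
      using L2_integrable_mult(3)[OF f \<phi>(1), of m] \<phi>(2)[of m] by (intro mult_right_mono) auto
    finally show ?thesis .
  qed
  then have b: "summable (\<lambda>m. LINT x|M. norm (?u m x))"
    by (intro summable_comparison_test'[OF summable_mult[OF e, of "(l2_sq M f + 1) / 2"], of 0]) auto
  have eq: "(\<Sum>m. ?u m x) = f x * (\<Sum>m. cnj (\<phi> m x) * e m)" for x
    using suminf_mult[OF summable_norm_cancel[OF s], of "f x" x] by (simp add: mult.assoc)
  show "integrable M (\<lambda>x. f x * (\<Sum>m. cnj (\<phi> m x) * e m))"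
    using integrable_suminf[OF i a b] unfolding eq .
  show "(LINT x|M. f x * (\<Sum>m. cnj (\<phi> m x) * e m)) = (\<Sum>m. l2_inner M f (\<phi> m) * e m)"
    using integral_suminf[OF i a b] unfolding eq by (simp add: l2_inner_def)
qed

section \<open>Hermite functions as an orthonormal basis\<close>

text \<open>Packages what integration by parts over the whole line needs; all powers of x occur so
  that the class is closed under multiplication by x.\<close>

definition schwartz_like :: "(real \<Rightarrow> real) \<Rightarrow> bool" where
  "schwartz_like p \<longleftrightarrow> (\<forall>j. integrable lborel (\<lambda>x. x ^ j * (p x * exp (- x\<^sup>2))) \<and>
     ((\<lambda>x. x ^ j * (p x * exp (- x\<^sup>2))) \<longlongrightarrow> 0) at_top \<and>
     ((\<lambda>x. x ^ j * (p x * exp (- x\<^sup>2))) \<longlongrightarrow> 0) at_bot)"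

lemma schwartz_likeI:
  assumes "\<And>j. integrable lborel (\<lambda>x. x ^ j * (p x * exp (- x\<^sup>2)))"
    and "\<And>j. ((\<lambda>x. x ^ j * (p x * exp (- x\<^sup>2))) \<longlongrightarrow> 0) at_top"
    and "\<And>j. ((\<lambda>x. x ^ j * (p x * exp (- x\<^sup>2))) \<longlongrightarrow> 0) at_bot"
  shows "schwartz_like p"
  unfolding schwartz_like_def by (intro allI conjI assms)

lemma schwartz_likeD:
  assumes "schwartz_like p"
  shows "integrable lborel (\<lambda>x. x ^ j * (p x * exp (- x\<^sup>2)))"
    and "((\<lambda>x. x ^ j * (p x * exp (- x\<^sup>2))) \<longlongrightarrow> 0) at_top"
    and "((\<lambda>x. x ^ j * (p x * exp (- x\<^sup>2))) \<longlongrightarrow> 0) at_bot"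
proof -
  note h = assms[unfolded schwartz_like_def, rule_format, of j]
  show "integrable lborel (\<lambda>x. x ^ j * (p x * exp (- x\<^sup>2)))"
    by (rule h[THEN conjunct1])
  show "((\<lambda>x. x ^ j * (p x * exp (- x\<^sup>2))) \<longlongrightarrow> 0) at_top"
    by (rule h[THEN conjunct2, THEN conjunct1])
  show "((\<lambda>x. x ^ j * (p x * exp (- x\<^sup>2))) \<longlongrightarrow> 0) at_bot"
    by (rule h[THEN conjunct2, THEN conjunct2])
qed

lemma schwartz_like_1: "schwartz_like (\<lambda>x. 1)"
proof (rule schwartz_likeI)
  show "integrable lborel (\<lambda>x::real. x ^ j * (1 * exp (- x\<^sup>2)))" for j
  proof -
    have "integrable lborel (\<lambda>x. sqrt pi * (normal_density 0 (sqrt (1 / 2)) x * (x - 0) ^ j))"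
      by (intro integrable_mult_right integrable_normal_moment) simp
    moreover have "sqrt pi * (normal_density 0 (sqrt (1 / 2)) x * (x - 0) ^ j) = x ^ j * (1 * exp (- x\<^sup>2))" for x
      by (simp add: normal_density_def)
    ultimately show ?thesis by (simp only:)
  qed
  show top: "((\<lambda>x::real. x ^ j * (1 * exp (- x\<^sup>2))) \<longlongrightarrow> 0) at_top" for j
  proof (rule Lim_null_comparison)
    show "\<forall>\<^sub>F x::real in at_top. norm (x ^ j * (1 * exp (- x\<^sup>2))) \<le> x ^ j / exp x"
      using eventually_ge_at_top[of 1]
    proof eventually_elim
      case (elim x)
      then have "x \<le> x\<^sup>2" by (simp add: power2_eq_square)
      then show ?case
        using elim by (simp add: abs_mult power_abs divide_inverse mult_left_mono flip: exp_minus)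
    qed
  qed (rule tendsto_power_div_exp_0)
  show "((\<lambda>x::real. x ^ j * (1 * exp (- x\<^sup>2))) \<longlongrightarrow> 0) at_bot" for j
  proof -
    have "((\<lambda>x::real. (- 1) ^ j * (x ^ j * (1 * exp (- x\<^sup>2)))) \<longlongrightarrow> (- 1) ^ j * 0) at_top"
      by (intro tendsto_mult_left top)
    moreover have "(- 1) ^ j * (x ^ j * (1 * exp (- x\<^sup>2))) = (- x) ^ j * (1 * exp (- (- x)\<^sup>2))" for x :: real
      by (simp add: power_minus[of x j])
    ultimately show ?thesis
      unfolding filterlim_at_bot_mirror by (simp only: mult_zero_right)
  qed
qed

lemma schwartz_like_mult_id:
  assumes "schwartz_like p"
  shows "schwartz_like (\<lambda>x. x * p x)"
proof -
  have e: "x ^ j * (x * p x * exp (- x\<^sup>2)) = x ^ Suc j * (p x * exp (- x\<^sup>2))" for x j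
    by simp
  show ?thesis
    by (rule schwartz_likeI; unfold e; rule schwartz_likeD[OF assms])
qed

lemma schwartz_like_diff:
  assumes "schwartz_like p" "schwartz_like q"
  shows "schwartz_like (\<lambda>x. a * p x - b * q x)"
proof -
  have e: "x ^ j * ((a * p x - b * q x) * exp (- x\<^sup>2))
      = a * (x ^ j * (p x * exp (- x\<^sup>2))) - b * (x ^ j * (q x * exp (- x\<^sup>2)))" for x j
    by (simp add: algebra_simps)
  have l: "((\<lambda>x. a * f x - b * g x) \<longlongrightarrow> 0) F"
    if "(f \<longlongrightarrow> 0) F" "(g \<longlongrightarrow> 0) F" for f g :: "real \<Rightarrow> real" and F
    using tendsto_diff[OF tendsto_mult_left[OF that(1)] tendsto_mult_left[OF that(2)], of a b] by simp
  show ?thesis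
    by (rule schwartz_likeI; unfold e;
        intro l Bochner_Integration.integrable_diff integrable_mult_right schwartz_likeD assms)
qed

lemma schwartz_like_hermite:
  assumes p: "schwartz_like p"
  shows "schwartz_like (\<lambda>x. hermite m x * p x)"
proof (induction m rule: less_induct)
  case (less m)
  consider "m = 0" | "m = 1" | k where "m = Suc (Suc k)"
    by (metis One_nat_def not0_implies_Suc)
  then show ?case
  proof cases
    case 1
    with p show ?thesis by (simp add: hermite_0)
  next
    case 2
    have "schwartz_like (\<lambda>x. 2 * (x * p x) - 0 * p x)"
      using p by (intro schwartz_like_diff schwartz_like_mult_id)
    with 2 show ?thesis by (simp add: hermite_1 mult.assoc)
  next
    case (3 k)
    have "schwartz_like (\<lambda>x. 2 * (x * (hermite (Suc k) x * p x)) - (2 * real (Suc k)) * (hermite k x * p x))"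
      using less[of "Suc k"] less[of k] 3 by (intro schwartz_like_diff schwartz_like_mult_id) auto
    moreover have "hermite m x * p x = 2 * (x * (hermite (Suc k) x * p x)) - (2 * real (Suc k)) * (hermite k x * p x)" for x
      unfolding 3 hermite_rec by (simp only: left_diff_distrib mult.assoc)
    ultimately show ?thesis by simp
  qed
qed

section \<open>Orthogonality of the Hermite polynomials\<close>

definition hermite_inner :: "nat \<Rightarrow> nat \<Rightarrow> real" where
  "hermite_inner m k = (LINT x|lborel. hermite m x * hermite k x * exp (- x\<^sup>2))"

lemma hermite_product_integrable:
  "integrable lborel (\<lambda>x::real. hermite m x * hermite k x * exp (- x\<^sup>2))"
proof -
  have "schwartz_like (\<lambda>x. hermite m x * (hermite k x * 1))"
    by (intro schwartz_like_hermite schwartz_like_1)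
  from schwartz_likeD(1)[OF this, of 0] show ?thesis by simp
qed

text \<open>The derivative of H_m exp (- x^2) is minus its successor, by the raising relation, so
  integration by parts lowers the index \<open>k\<close>.\<close>

lemma hermite_inner_Suc: "hermite_inner (Suc m) k = 2 * real k * hermite_inner m (k - 1)"
proof -
  let ?F = "\<lambda>x::real. hermite m x * hermite k x * exp (- x\<^sup>2)"
  let ?f = "\<lambda>x::real. 2 * real k * (hermite m x * hermite (k - 1) x * exp (- x\<^sup>2))
    - hermite (Suc m) x * hermite k x * exp (- x\<^sup>2)"
  have "schwartz_like (\<lambda>x. hermite m x * (hermite k x * 1))"
    by (intro schwartz_like_hermite schwartz_like_1)
  from schwartz_likeD(2,3)[OF this, of 0] have lim: "(?F \<longlongrightarrow> 0) at_top" "(?F \<longlongrightarrow> 0) at_bot"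
    by simp_all
  have i: "integrable lborel ?f"
    by (intro Bochner_Integration.integrable_diff integrable_mult_right hermite_product_integrable)
  have d: "(?F has_vector_derivative ?f x) (at x)" for x
  proof -
    have "(?F has_real_derivative ?f x) (at x)"
      by (rule derivative_eq_intros hermite_has_field_derivative refl | simp)+
        (simp add: hermite_Suc_deriv algebra_simps)
    then show ?thesis
      by (simp add: has_real_derivative_iff_has_vector_derivative)
  qed
  have c: "isCont ?f x" for x
    by (intro continuous_intros continuous_on_interior[OF hermite_continuous[of UNIV]]) auto
  have "(LBINT x=-\<infinity>..\<infinity>. ?f x) = 0 - 0"
  proof (rule interval_integral_FTC_integrable)
    show "set_integrable lborel (einterval (-\<infinity>) \<infinity>) ?f"
      using i by (simp add: set_integrable_def einterval_def)
  qed (use d c lim in \<open>auto simp: ereal_tendsto_simps\<close>)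
  then have "(LINT x|lborel. ?f x) = 0"
    by (simp add: interval_lebesgue_integral_def set_lebesgue_integral_def einterval_def)
  moreover have "(LINT x|lborel. ?f x) = 2 * real k * hermite_inner m (k - 1) - hermite_inner (Suc m) k"
    unfolding hermite_inner_def
    by (subst Bochner_Integration.integral_diff)
      (auto intro!: integrable_mult_right hermite_product_integrable)
  ultimately show ?thesis by simp
qed

lemma hermite_inner_commute: "hermite_inner m k = hermite_inner k m"
  by (simp add: hermite_inner_def mult_ac)

lemma hermite_inner_eq: "hermite_inner m k = (if m = k then sqrt pi * (2 ^ m * fact m) else 0)"
proof (induction m arbitrary: k)
  case 0
  show ?case
  proof (cases k)
    case 0
    have "(LINT x|lborel. exp (- x\<^sup>2)) = sqrt pi"
      using has_bochner_integral_integral_eq[OF real_gauss_integral[of 1]] by simp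
    with 0 show ?thesis
      by (simp add: hermite_inner_def hermite_0)
  next
    case (Suc j)
    then show ?thesis
      by (simp add: hermite_inner_commute[of 0] hermite_inner_Suc)
  qed
next
  case (Suc m)
  then show ?case
    by (cases k) (simp_all add: hermite_inner_Suc algebra_simps)
qed

section \<open>Hermite functions in the weighted space\<close>

lemma gauss_real_continuous:
  fixes f :: "real \<Rightarrow> 'a::{banach, second_countable_topology}"
  assumes "continuous_on UNIV f"
  shows "integrable (gauss_real \<nu>) f \<longleftrightarrow> integrable lborel (\<lambda>x. exp (- \<nu> * x\<^sup>2) *\<^sub>R f x)"
    and "(LINT x|gauss_real \<nu>. f x) = (LINT x|lborel. exp (- \<nu> * x\<^sup>2) *\<^sub>R f x)"
  unfolding gauss_real_def
  by (intro density_lebesgue_continuous assms continuous_intros; simp)+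

text \<open>The orthonormal basis \<open>g_fun \<beta>\<close> of the space with weight \<open>\<beta>\<close>, moved to the space with weight \<open>\<nu>\<close>.\<close>

definition hermite_fun :: "real \<Rightarrow> real \<Rightarrow> nat \<Rightarrow> real \<Rightarrow> complex" where
  "hermite_fun \<nu> \<beta> m x = complex_of_real (g_fun \<beta> m x * exp (- ((\<beta> - \<nu>) / 2) * x\<^sup>2))"

lemma hermite_fun_cnj: "cnj (hermite_fun \<nu> \<beta> m x) = hermite_fun \<nu> \<beta> m x"
  by (simp add: hermite_fun_def)

lemma g_fun_continuous: "continuous_on UNIV (g_fun \<beta> m)"
  unfolding g_fun_def
  by (intro continuous_intros continuous_on_compose2[OF hermite_continuous[of UNIV]]) auto

lemma hermite_fun_continuous: "continuous_on UNIV (hermite_fun \<nu> \<beta> m)"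
  unfolding hermite_fun_def by (intro continuous_intros g_fun_continuous)

lemma g_fun_orthonormal:
  assumes \<beta>: "0 < \<beta>"
  shows "has_bochner_integral lborel (\<lambda>x. g_fun \<beta> m x * g_fun \<beta> k x * exp (- \<beta> * x\<^sup>2)) (if m = k then 1 else 0)"
proof -
  let ?h = "\<lambda>x::real. hermite m x * hermite k x * exp (- x\<^sup>2)"
  let ?C = "sqrt (\<beta> / pi) / (sqrt (2 ^ m * fact m) * sqrt (2 ^ k * fact k))"
  have b: "sqrt \<beta> \<noteq> 0" using \<beta> by simp
  have "has_bochner_integral lborel ?h (hermite_inner m k)"
    unfolding hermite_inner_def by (rule has_bochner_integral_integrable[OF hermite_product_integrable])
  then have "has_bochner_integral lborel (\<lambda>x. ?h (0 + sqrt \<beta> * x)) (hermite_inner m k /\<^sub>R \<bar>sqrt \<beta>\<bar>)"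
    using lborel_has_bochner_integral_real_affine_iff[OF b, of ?h "hermite_inner m k" 0] by blast
  then have "has_bochner_integral lborel (\<lambda>x. ?C * ?h (0 + sqrt \<beta> * x)) (?C * (hermite_inner m k /\<^sub>R \<bar>sqrt \<beta>\<bar>))"
    by (rule has_bochner_integral_mult_right)
  moreover have "?C * ?h (0 + sqrt \<beta> * x) = g_fun \<beta> m x * g_fun \<beta> k x * exp (- \<beta> * x\<^sup>2)" for x
  proof -
    have "(\<beta> / pi) powr (1 / 4) * (\<beta> / pi) powr (1 / 4) = sqrt (\<beta> / pi)"
      using \<beta> by (simp add: powr_half_sqrt flip: powr_add)
    then show ?thesis
      using \<beta> by (simp add: g_fun_def power_mult_distrib)
  qed
  moreover have "?C * (hermite_inner m k /\<^sub>R \<bar>sqrt \<beta>\<bar>) = (if m = k then 1 else 0)"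
  proof (cases "m = k")
    case True
    have "sqrt (2 ^ k * fact k) * sqrt (2 ^ k * fact k) = 2 ^ k * fact k" by simp
    then show ?thesis
      using \<beta> True by (simp add: hermite_inner_eq real_sqrt_divide del: real_sqrt_mult_self)
  qed (simp add: hermite_inner_eq)
  ultimately show ?thesis by simp
qed

lemma hermite_fun_product:
  assumes \<beta>: "0 < \<beta>"
  shows "integrable (gauss_real \<nu>) (\<lambda>x. hermite_fun \<nu> \<beta> m x * cnj (hermite_fun \<nu> \<beta> k x))"
    and "l2_inner (gauss_real \<nu>) (hermite_fun \<nu> \<beta> m) (hermite_fun \<nu> \<beta> k) = (if m = k then 1 else 0)"
proof -
  have c: "continuous_on UNIV (\<lambda>x. hermite_fun \<nu> \<beta> m x * cnj (hermite_fun \<nu> \<beta> k x))"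
    by (intro continuous_intros hermite_fun_continuous)
  have "exp (- \<nu> * x\<^sup>2) *\<^sub>R (hermite_fun \<nu> \<beta> m x * cnj (hermite_fun \<nu> \<beta> k x))
      = complex_of_real (g_fun \<beta> m x * g_fun \<beta> k x * exp (- \<beta> * x\<^sup>2))" for x
  proof -
    have "exp (- \<nu> * x\<^sup>2) * (exp (- ((\<beta> - \<nu>) / 2) * x\<^sup>2) * exp (- ((\<beta> - \<nu>) / 2) * x\<^sup>2)) = exp (- \<beta> * x\<^sup>2)"
      by (simp add: field_simps flip: exp_add)
    then have "complex_of_real (g_fun \<beta> m x * g_fun \<beta> k x * exp (- \<beta> * x\<^sup>2))
      = complex_of_real (g_fun \<beta> m x * g_fun \<beta> k x * (exp (- \<nu> * x\<^sup>2) * (exp (- ((\<beta> - \<nu>) / 2) * x\<^sup>2) * exp (- ((\<beta> - \<nu>) / 2) * x\<^sup>2))))"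
      by simp
    then show ?thesis
      unfolding hermite_fun_cnj unfolding hermite_fun_def scaleR_conv_of_real of_real_mult
      by (simp only: mult_ac)
  qed
  moreover have "has_bochner_integral lborel (\<lambda>x. complex_of_real (g_fun \<beta> m x * g_fun \<beta> k x * exp (- \<beta> * x\<^sup>2)))
      (complex_of_real (if m = k then 1 else 0))"
    by (intro has_bochner_integral_of_real g_fun_orthonormal \<beta>)
  ultimately have h: "has_bochner_integral lborel (\<lambda>x. exp (- \<nu> * x\<^sup>2) *\<^sub>R (hermite_fun \<nu> \<beta> m x * cnj (hermite_fun \<nu> \<beta> k x)))
      (if m = k then 1 else 0)"
    by (simp only: if_distrib[of complex_of_real] of_real_1 of_real_0)
  show "integrable (gauss_real \<nu>) (\<lambda>x. hermite_fun \<nu> \<beta> m x * cnj (hermite_fun \<nu> \<beta> k x))"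
    unfolding gauss_real_continuous(1)[OF c] using h by (rule integrable.intros)
  show "l2_inner (gauss_real \<nu>) (hermite_fun \<nu> \<beta> m) (hermite_fun \<nu> \<beta> k) = (if m = k then 1 else 0)"
    unfolding l2_inner_def gauss_real_continuous(2)[OF c] using h by (rule has_bochner_integral_integral_eq)
qed

lemma hermite_fun_L2:
  assumes \<beta>: "0 < \<beta>"
  shows "hermite_fun \<nu> \<beta> m \<in> L2 (gauss_real \<nu>)"
proof -
  have "hermite_fun \<nu> \<beta> m \<in> borel_measurable (gauss_real \<nu>)"
    using hermite_fun_continuous[of \<nu> \<beta> m]
    by (simp add: gauss_real_def measurable_completion borel_measurable_continuous_onI)
  moreover have "integrable (gauss_real \<nu>) (\<lambda>x. (norm (hermite_fun \<nu> \<beta> m x))\<^sup>2)"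
    using integrable_norm[OF hermite_fun_product(1)[OF \<beta>, of \<nu> m m]]
    by (simp add: norm_mult power2_eq_square)
  ultimately show ?thesis by (simp add: L2_def)
qed

text \<open>Terms of a convergent series are bounded, and the factor (1/4)^m in it becomes 2^m after
  a square root. This crude rate suffices, since \<open>fock_coeff\<close> decays faster than any
  geometric sequence.\<close>

lemma hermite_fun_growth: "\<exists>C. \<forall>m. norm (hermite_fun \<nu> \<beta> m x) \<le> C * 2 ^ m"
proof -
  let ?X = "sqrt \<beta> * x" and ?P = "hermite_growth \<bar>sqrt \<beta> * x\<bar>"
  have s: "summable (\<lambda>m. (1 / 4) ^ m * (?P m)\<^sup>2)"
    by (rule hermite_growth_summable) auto
  let ?S = "\<Sum>m. (1 / 4) ^ m * (?P m)\<^sup>2"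
  let ?E = "(\<beta> / pi) powr (1 / 4) * exp (- ((\<beta> - \<nu>) / 2) * x\<^sup>2)"
  have "norm (hermite_fun \<nu> \<beta> m x) \<le> ?E * sqrt ?S * 2 ^ m" for m
  proof -
    have "(1 / 4) ^ m * (?P m)\<^sup>2 \<le> ?S"
      using sum_le_suminf[OF s, of "{m}"] by simp
    moreover have "(2 ^ m)\<^sup>2 = (4 :: real) ^ m"
      by (simp add: power2_eq_square flip: power_mult_distrib)
    ultimately have "(?P m)\<^sup>2 \<le> ?S * (2 ^ m)\<^sup>2"
      by (simp add: power_divide field_simps)
    then have "?P m \<le> sqrt (?S * (2 ^ m)\<^sup>2)"
      by (rule real_le_rsqrt)
    then have P: "?P m \<le> sqrt ?S * 2 ^ m"
      by (simp add: real_sqrt_mult)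
    have "norm (hermite m (complex_of_real ?X)) \<le> sqrt (2 ^ m * fact m) * ?P m"
      by (rule hermite_bound) (simp del: of_real_mult)
    then have "\<bar>hermite m ?X\<bar> / sqrt (2 ^ m * fact m) \<le> ?P m"
      unfolding hermite_of_real norm_of_real by (simp add: divide_le_eq mult.commute)
    then have "\<bar>hermite m ?X\<bar> / sqrt (2 ^ m * fact m) \<le> sqrt ?S * 2 ^ m"
      using P by simp
    then have "?E * (\<bar>hermite m ?X\<bar> / sqrt (2 ^ m * fact m)) \<le> ?E * (sqrt ?S * 2 ^ m)"
      by (intro mult_left_mono) auto
    moreover have "norm (hermite_fun \<nu> \<beta> m x) = ?E * (\<bar>hermite m ?X\<bar> / sqrt (2 ^ m * fact m))"
      by (simp add: hermite_fun_def g_fun_def norm_mult norm_divide abs_mult norm_of_real mult_ac del: of_real_mult of_real_divide)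
    ultimately show ?thesis by (simp add: mult.assoc)
  qed
  then show ?thesis by blast
qed

text \<open>For \<beta> = \<nu> this is the classical Segal-Bargmann kernel; the Gaussian in x
  accounts for the change of weight from \<beta> to \<nu>.\<close>

definition bargmann_kernel :: "real \<Rightarrow> real \<Rightarrow> real \<Rightarrow> complex \<Rightarrow> complex" where
  "bargmann_kernel \<nu> \<beta> x z = complex_of_real ((\<beta> / pi) powr (1 / 4) * sqrt (\<nu> / pi) * exp (- ((\<beta> - \<nu>) / 2) * x\<^sup>2))
     * exp (complex_of_real (sqrt (2 * \<beta> * \<nu>) * x) * z - complex_of_real (\<nu> / 2) * z\<^sup>2)"

lemma bargmann_entire_family:
  assumes "0 < \<nu>"
  shows "entire_family (\<lambda>m z. hermite_fun \<nu> \<beta> m x * fock_basis \<nu> m z)"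
proof -
  obtain C where "\<And>m. norm (hermite_fun \<nu> \<beta> m x) \<le> C * 2 ^ m"
    using hermite_fun_growth by blast
  then show ?thesis
    by (rule fock_entire_family[OF assms]) simp
qed

text \<open>The Hermite generating function at w = sqrt (\<nu> / 2) z: the roots of
  \<open>fact m\<close> in the two normalisations multiply to the \<open>fact m\<close> in its
  denominators.\<close>

lemma bargmann_kernel_series:
  assumes \<nu>: "0 < \<nu>" and \<beta>: "0 < \<beta>"
  shows "(\<Sum>m. hermite_fun \<nu> \<beta> m x * fock_basis \<nu> m z) = bargmann_kernel \<nu> \<beta> x z"
proof -
  let ?X = "complex_of_real (sqrt \<beta> * x)" and ?w = "complex_of_real (sqrt (\<nu> / 2)) * z"
  let ?K = "(\<beta> / pi) powr (1 / 4) * sqrt (\<nu> / pi) * exp (- ((\<beta> - \<nu>) / 2) * x\<^sup>2)"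
  have "hermite_fun \<nu> \<beta> m x * fock_basis \<nu> m z = complex_of_real ?K * (hermite m ?X / fact m * ?w ^ m)" for m
  proof -
    have s: "fock_coeff \<nu> m / sqrt (2 ^ m * fact m) = sqrt (\<nu> / pi) * sqrt (\<nu> / 2) ^ m / fact m"
    proof -
      have "fock_coeff \<nu> m / sqrt (2 ^ m * fact m) = sqrt (\<nu> ^ Suc m / (pi * fact m) / (2 ^ m * fact m))"
        unfolding fock_coeff_def real_sqrt_divide ..
      also have "\<nu> ^ Suc m / (pi * fact m) / (2 ^ m * fact m) = (\<nu> / pi) * (\<nu> / 2) ^ m / (fact m)\<^sup>2"
        by (simp add: power_divide power2_eq_square)
      also have "sqrt \<dots> = sqrt (\<nu> / pi) * sqrt (\<nu> / 2) ^ m / fact m"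
        by (simp add: real_sqrt_divide real_sqrt_mult real_sqrt_power)
      finally show ?thesis .
    qed
    have "hermite_fun \<nu> \<beta> m x * fock_basis \<nu> m z
        = complex_of_real ((\<beta> / pi) powr (1 / 4) * exp (- ((\<beta> - \<nu>) / 2) * x\<^sup>2) * hermite m (sqrt \<beta> * x)
          * (fock_coeff \<nu> m / sqrt (2 ^ m * fact m))) * z ^ m"
      by (simp add: hermite_fun_def g_fun_def fock_basis_def)
    also have "\<dots> = complex_of_real ?K * (hermite m ?X / fact m * ?w ^ m)"
      unfolding s hermite_of_real by (simp add: power_mult_distrib)
    finally show ?thesis .
  qed
  moreover have "(\<lambda>m. complex_of_real ?K * (hermite m ?X / fact m * ?w ^ m)) sums
      (complex_of_real ?K * exp (2 * ?X * ?w - ?w\<^sup>2))"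
    by (intro sums_mult hermite_generating_function)
  moreover have "2 * ?X * ?w - ?w\<^sup>2 = complex_of_real (sqrt (2 * \<beta> * \<nu>) * x) * z - complex_of_real (\<nu> / 2) * z\<^sup>2"
  proof -
    have "2 * sqrt \<beta> * sqrt (\<nu> / 2) = sqrt 4 * (sqrt \<beta> * sqrt (\<nu> / 2))" by simp
    also have "\<dots> = sqrt (2 * \<beta> * \<nu>)"
      unfolding real_sqrt_mult[symmetric] by simp
    finally have "complex_of_real (2 * sqrt \<beta> * sqrt (\<nu> / 2)) = complex_of_real (sqrt (2 * \<beta> * \<nu>))"
      by (rule arg_cong)
    moreover have "(complex_of_real (sqrt (\<nu> / 2)))\<^sup>2 = complex_of_real (\<nu> / 2)"
      using \<nu> by (simp flip: of_real_power)
    moreover have "2 * ?X * ?w - ?w\<^sup>2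
        = complex_of_real (2 * sqrt \<beta> * sqrt (\<nu> / 2)) * complex_of_real x * z - (complex_of_real (sqrt (\<nu> / 2)))\<^sup>2 * z\<^sup>2"
      by (simp add: power_mult_distrib)
    ultimately show ?thesis
      by (simp only: of_real_mult[of "sqrt (2 * \<beta> * \<nu>)" x])
  qed
  ultimately show ?thesis
    by (simp only: bargmann_kernel_def sums_iff)
qed

text \<open>Levy's uniqueness theorem concerns probability measures. The positive and negative parts
  of \<open>u\<close> have equal transforms, hence equal mass (take \<open>t = 0\<close>), and are
  normalised by it; mass zero is the trivial case.\<close>

lemma char_eq_imp_zero:
  fixes u :: "real \<Rightarrow> real"
  assumes u: "integrable lborel u" and z: "\<And>t. (LINT x|lborel. complex_of_real (u x) * iexp (t * x)) = 0"
  shows "AE x in lborel. u x = 0"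
proof -
  have um[measurable]: "u \<in> borel_measurable borel" using u by auto
  define p where "p x = max 0 (u x)" for x
  define q where "q x = max 0 (- u x)" for x
  have [measurable]: "p \<in> borel_measurable borel" "q \<in> borel_measurable borel"
    unfolding p_def q_def by measurable
  have i: "integrable lborel p" "integrable lborel q"
    unfolding p_def q_def using u by (auto intro!: Bochner_Integration.integrable_max)
  have upq: "u x = p x - q x" and pq0: "0 \<le> p x" "0 \<le> q x" for x by (auto simp: p_def q_def)
  have ie: "integrable lborel (\<lambda>x. complex_of_real (p x) * iexp (t * x))"
    "integrable lborel (\<lambda>x. complex_of_real (q x) * iexp (t * x))" for t
    by (rule Bochner_Integration.integrable_bound[OF i(1)], use pq0 in \<open>auto simp: norm_mult\<close>)
      (rule Bochner_Integration.integrable_bound[OF i(2)], use pq0 in \<open>auto simp: norm_mult\<close>)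
  have four: "(LINT x|lborel. complex_of_real (p x) * iexp (t * x)) = (LINT x|lborel. complex_of_real (q x) * iexp (t * x))" for t
    using z[of t] ie[of t] unfolding upq by (simp add: left_diff_distrib)
  define m where "m = (LINT x|lborel. p x)"
  have "complex_of_real m = complex_of_real (LINT x|lborel. q x)"
    using four[of 0] unfolding m_def by (simp flip: integral_complex_of_real)
  then have mq: "m = (LINT x|lborel. q x)" by (simp only: of_real_eq_iff)
  have m0: "0 \<le> m" unfolding m_def using pq0 by (intro Bochner_Integration.integral_nonneg) auto
  show ?thesis
  proof (cases "m = 0")
    case True
    have "AE x in lborel. p x = 0" "AE x in lborel. q x = 0"
      using integral_nonneg_eq_0_iff_AE[OF i(1)] integral_nonneg_eq_0_iff_AE[OF i(2)] pq0 True mq m_def by auto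
    then show ?thesis
      by eventually_elim (simp add: upq)
  next
    case False
    then have m: "0 < m" using m0 by simp
    define D where "D r = density lborel (\<lambda>x. ennreal (r x / m))" for r :: "real \<Rightarrow> real"
    have D: "real_distribution (D r) \<and> (\<forall>t. char (D r) t = (LINT x|lborel. complex_of_real (r x) * iexp (t * x)) / m)"
      if r: "integrable lborel r" "\<And>x. 0 \<le> r x" "(LINT x|lborel. r x) = m" for r
    proof
      have [measurable]: "r \<in> borel_measurable borel" using r by auto
      have "emeasure (D r) UNIV = (\<integral>\<^sup>+x. ennreal (r x / m) \<partial>lborel)"
        unfolding D_def by (subst emeasure_density) auto
      also have "\<dots> = ennreal (LINT x|lborel. r x / m)"
        using r m by (intro nn_integral_eq_integral) auto
      also have "\<dots> = 1" using r m by simp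
      finally have "emeasure (D r) UNIV = 1" .
      then show "real_distribution (D r)"
        unfolding real_distribution_def real_distribution_axioms_def
        by (auto intro!: prob_spaceI simp: D_def)
      show "\<forall>t. char (D r) t = (LINT x|lborel. complex_of_real (r x) * iexp (t * x)) / m"
      proof
        fix t
        have "char (D r) t = (LINT x|lborel. (r x / m) *\<^sub>R iexp (t * x))"
          unfolding char_def D_def using r m by (subst integral_density) auto
        also have "\<dots> = (LINT x|lborel. complex_of_real (r x) * iexp (t * x) / m)"
          by (intro Bochner_Integration.integral_cong) (auto simp: scaleR_conv_of_real)
        also have "\<dots> = (LINT x|lborel. complex_of_real (r x) * iexp (t * x)) / m"
          by (rule integral_divide_zero)
        finally show "char (D r) t = (LINT x|lborel. complex_of_real (r x) * iexp (t * x)) / m" .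
      qed
    qed
    have "D p = D q"
      using D[of p] D[of q] i pq0 mq m_def four
      by (intro Levy_uniqueness) (auto simp: fun_eq_iff)
    then have "AE x in lborel. ennreal (p x / m) = ennreal (q x / m)"
      unfolding D_def by (intro sigma_finite_measure.density_unique[OF sigma_finite_lborel]) auto
    then show ?thesis
      by eventually_elim (use m pq0 in \<open>simp add: upq\<close>)
  qed
qed

text \<open>\<open>H\<close> is a Borel version of \<open>G\<close>, as required by
  \<open>char_eq_imp_zero\<close>. Reflecting \<open>t\<close> shows that \<open>cnj H\<close> has
  zero transform too, so real and imaginary parts can be treated separately.\<close>

lemma fourier_eq_imp_zero:
  fixes G :: "real \<Rightarrow> complex"
  assumes G: "integrable lebesgue G" and z: "\<And>t. (LINT x|lebesgue. G x * iexp (t * x)) = 0"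
  shows "AE x in lebesgue. G x = 0"
proof -
  have Gm: "G \<in> borel_measurable lebesgue" using G by auto
  obtain u where u: "u \<in> borel_measurable lborel" "AE x in lborel. Re (G x) = u x"
    using completion_ex_borel_measurable_real[of "\<lambda>x. Re (G x)" lborel] Gm by auto
  obtain v where v: "v \<in> borel_measurable lborel" "AE x in lborel. Im (G x) = v x"
    using completion_ex_borel_measurable_real[of "\<lambda>x. Im (G x)" lborel] Gm by auto
  have [measurable]: "u \<in> borel_measurable borel" "v \<in> borel_measurable borel" using u v by auto
  define H where "H x = Complex (u x) (v x)" for x
  have Hm[measurable]: "H \<in> borel_measurable borel"
    unfolding H_def Complex_eq by measurable
  have "AE x in lborel. G x = H x"
    using u(2) v(2) by eventually_elim (simp add: H_def complex_eq_iff)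
  then have GH: "AE x in lebesgue. G x = H x"
    by (rule AE_completion)
  have Hm': "H \<in> borel_measurable lebesgue"
    using Hm by (simp add: measurable_completion)
  have "integrable lebesgue H"
    using G GH Hm' Gm integrable_cong_AE by blast
  then have Hi: "integrable lborel H"
    using Hm by (simp add: integrable_completion)
  have im: "(\<lambda>x. iexp (t * x)) \<in> borel_measurable borel" for t :: real
    by (intro borel_measurable_continuous_onI continuous_intros)
  have ii: "integrable lborel (\<lambda>x. H x * iexp (t * x))" for t :: real
    by (rule Bochner_Integration.integrable_bound[OF Hi]) (use im in \<open>auto simp: norm_mult\<close>)
  have zH: "(LINT x|lborel. H x * iexp (t * x)) = 0" for t
  proof -
    have "(LINT x|lborel. H x * iexp (t * x)) = (LINT x|lebesgue. H x * iexp (t * x))"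
      by (rule integral_completion[symmetric]) (use im in measurable)
    also have "\<dots> = (LINT x|lebesgue. G x * iexp (t * x))"
    proof (rule integral_cong_AE)
      have "(\<lambda>x. iexp (t * x)) \<in> borel_measurable lebesgue"
        using im by (simp add: measurable_completion)
      then show "(\<lambda>x. H x * iexp (t * x)) \<in> borel_measurable lebesgue"
        "(\<lambda>x. G x * iexp (t * x)) \<in> borel_measurable lebesgue"
        using Gm Hm' by (auto intro: borel_measurable_times)
      show "AE x in lebesgue. H x * iexp (t * x) = G x * iexp (t * x)"
        using GH by eventually_elim simp
    qed
    finally show ?thesis using z by simp
  qed
  have zC: "(LINT x|lborel. cnj (H x) * iexp (t * x)) = 0" for t
  proof -
    have "(LINT x|lborel. cnj (H x) * iexp (t * x)) = (LINT x|lborel. cnj (H x * iexp (- t * x)))"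
      by (intro Bochner_Integration.integral_cong) (auto simp: exp_cnj)
    also have "\<dots> = cnj (LINT x|lborel. H x * iexp (- t * x))"
      by (rule Bochner_Integration.integral_cnj)
    finally show ?thesis using zH[of "- t"] by simp
  qed
  have ic: "integrable lborel (\<lambda>x. cnj (H x) * iexp (t * x))" for t
  proof -
    have "integrable lborel (\<lambda>x. cnj (H x * iexp (- t * x)))"
      using ii[of "- t"] by (rule integrable_cnj)
    moreover have "cnj (H x * iexp (- t * x)) = cnj (H x) * iexp (t * x)" for x
      by (simp add: exp_cnj)
    ultimately show ?thesis by (simp only:)
  qed
  have "AE x in lborel. u x = 0"
  proof (rule char_eq_imp_zero)
    show "integrable lborel u"
      using integrable_Re[OF Hi] by (simp add: H_def)
    fix t
    have "complex_of_real (u x) * iexp (t * x) = (H x * iexp (t * x) + cnj (H x) * iexp (t * x)) * (1 / 2)" for x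
      unfolding distrib_right[symmetric] complex_add_cnj by (simp add: H_def)
    then show "(LINT x|lborel. complex_of_real (u x) * iexp (t * x)) = 0"
      by (simp only: integral_mult_left_zero Bochner_Integration.integral_add[OF ii ic] zH zC) simp
  qed
  moreover have "AE x in lborel. v x = 0"
  proof (rule char_eq_imp_zero)
    show "integrable lborel v"
      using integrable_Im[OF Hi] by (simp add: H_def)
    fix t
    have aw: "complex_of_real a * w = complex_of_real (2 * a) * \<i> * w * (- \<i> / 2)" for a w
      by (simp add: complex_eq_iff)
    have "complex_of_real (v x) * iexp (t * x) = (H x * iexp (t * x) - cnj (H x) * iexp (t * x)) * (- \<i> / 2)" for x
      unfolding left_diff_distrib[symmetric] complex_diff_cnj H_def complex.sel by (rule aw)
    then show "(LINT x|lborel. complex_of_real (v x) * iexp (t * x)) = 0"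
      by (simp only: integral_mult_left_zero Bochner_Integration.integral_diff[OF ii ic] zH zC) simp
  qed
  ultimately have "AE x in lborel. H x = 0"
    by eventually_elim (simp add: H_def complex_eq_iff)
  then have "AE x in lebesgue. H x = 0"
    by (rule AE_completion)
  with GH show ?thesis
    by eventually_elim simp
qed

section \<open>Completeness of the Hermite functions\<close>

lemma gauss_real_lebesgue:
  fixes f :: "real \<Rightarrow> complex"
  assumes "f \<in> borel_measurable lebesgue"
  shows "integrable (gauss_real \<nu>) f \<longleftrightarrow> integrable lebesgue (\<lambda>x. f x * complex_of_real (exp (- \<nu> * x\<^sup>2)))"
    and "(LINT x|gauss_real \<nu>. f x) = (LINT x|lebesgue. f x * complex_of_real (exp (- \<nu> * x\<^sup>2)))"
proof -
  have "(\<lambda>x. exp (- \<nu> * x\<^sup>2)) \<in> borel_measurable borel"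
    by (intro borel_measurable_continuous_onI continuous_intros)
  then have m: "(\<lambda>x. exp (- \<nu> * x\<^sup>2)) \<in> borel_measurable lebesgue"
    by (simp add: measurable_completion)
  have e: "exp (- \<nu> * x\<^sup>2) *\<^sub>R f x = f x * complex_of_real (exp (- \<nu> * x\<^sup>2))" for x
    by (simp only: scaleR_conv_of_real mult.commute)
  show "integrable (gauss_real \<nu>) f \<longleftrightarrow> integrable lebesgue (\<lambda>x. f x * complex_of_real (exp (- \<nu> * x\<^sup>2)))"
    unfolding gauss_real_def e[symmetric] using m assms by (subst integrable_density) auto
  show "(LINT x|gauss_real \<nu>. f x) = (LINT x|lebesgue. f x * complex_of_real (exp (- \<nu> * x\<^sup>2)))"
    unfolding gauss_real_def e[symmetric] using m assms by (subst integral_density) auto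
qed

lemma gauss_real_measurable: "f \<in> borel_measurable (gauss_real \<nu>) \<longleftrightarrow> f \<in> borel_measurable lebesgue"
  by (simp add: gauss_real_def)

lemma bargmann_pairing:
  assumes \<nu>: "0 < \<nu>" and \<beta>: "0 < \<beta>" and f: "f \<in> L2 (gauss_real \<nu>)"
  shows "integrable (gauss_real \<nu>) (\<lambda>x. f x * bargmann_kernel \<nu> \<beta> x z)"
    and "(LINT x|gauss_real \<nu>. f x * bargmann_kernel \<nu> \<beta> x z)
      = (\<Sum>m. l2_inner (gauss_real \<nu>) f (hermite_fun \<nu> \<beta> m) * fock_basis \<nu> m z)"
proof -
  have n: "l2_sq (gauss_real \<nu>) (hermite_fun \<nu> \<beta> m) = 1" for m
    using hermite_fun_product(2)[OF \<beta>, of \<nu> m m] unfolding l2_inner_self by simp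
  have e: "summable (\<lambda>m. norm (fock_basis \<nu> m z))"
    using entire_family_summable[OF fock_entire_family[OF \<nu>, of "\<lambda>m. 1" 1 1]] by simp
  have s: "summable (\<lambda>m. norm (cnj (hermite_fun \<nu> \<beta> m x) * fock_basis \<nu> m z))" for x
    unfolding hermite_fun_cnj by (rule entire_family_summable[OF bargmann_entire_family[OF \<nu>]])
  note p = orthonormal_pairing[OF f hermite_fun_L2[OF \<beta>] n e s, unfolded hermite_fun_cnj bargmann_kernel_series[OF \<nu> \<beta>]]
  show "integrable (gauss_real \<nu>) (\<lambda>x. f x * bargmann_kernel \<nu> \<beta> x z)"
    "(LINT x|gauss_real \<nu>. f x * bargmann_kernel \<nu> \<beta> x z)
      = (\<Sum>m. l2_inner (gauss_real \<nu>) f (hermite_fun \<nu> \<beta> m) * fock_basis \<nu> m z)"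
    by (fact p)+
qed

text \<open>Vanishing coefficients make the pairing with the kernel vanish for every z. At z = i t /
  c the linear term of the exponent is i t x and the quadratic one is a constant, so the Fourier
  transform of \<open>G\<close> vanishes at \<open>t\<close>.\<close>

lemma hermite_fun_total:
  assumes \<nu>: "0 < \<nu>" and \<beta>: "0 < \<beta>" and f: "f \<in> L2 (gauss_real \<nu>)"
    and z: "\<And>m. l2_inner (gauss_real \<nu>) f (hermite_fun \<nu> \<beta> m) = 0"
  shows "AE x in gauss_real \<nu>. f x = 0"
proof -
  have fm: "f \<in> borel_measurable lebesgue"
    using L2_measurable[OF f] by (simp add: gauss_real_measurable)
  define c where "c = sqrt (2 * \<beta> * \<nu>)"
  define C where "C = (\<beta> / pi) powr (1 / 4) * sqrt (\<nu> / pi)"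
  let ?e = "\<lambda>x. exp (- ((\<beta> - \<nu>) / 2) * x\<^sup>2)"
  define G where "G x = f x * complex_of_real (?e x * exp (- \<nu> * x\<^sup>2))" for x
  have c: "c \<noteq> 0" using \<nu> \<beta> by (simp add: c_def)
  have C: "C \<noteq> 0" using \<nu> \<beta> by (simp add: C_def)
  have km: "(\<lambda>x. f x * bargmann_kernel \<nu> \<beta> x w) \<in> borel_measurable lebesgue" for w
  proof -
    have "(\<lambda>x. bargmann_kernel \<nu> \<beta> x w) \<in> borel_measurable borel"
      unfolding bargmann_kernel_def by (intro borel_measurable_continuous_onI continuous_intros)
    then show ?thesis
      using fm by (intro borel_measurable_times) (simp_all add: measurable_completion)
  qed
  define K where "K t = complex_of_real (C * exp (\<nu> / 2 * (t / c)\<^sup>2))" for t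
  have k: "f x * bargmann_kernel \<nu> \<beta> x (\<i> * complex_of_real (t / c)) * complex_of_real (exp (- \<nu> * x\<^sup>2))
      = K t * (G x * iexp (t * x))" for x t
  proof -
    have "complex_of_real (c * x) * (\<i> * complex_of_real (t / c)) - complex_of_real (\<nu> / 2) * (\<i> * complex_of_real (t / c))\<^sup>2
        = complex_of_real (\<nu> / 2 * (t / c)\<^sup>2) + \<i> * complex_of_real (t * x)"
    proof -
      have "complex_of_real (c * x) * (\<i> * complex_of_real (t / c)) = \<i> * complex_of_real (t * x)"
        using c by simp
      moreover have "(\<i> * complex_of_real (t / c))\<^sup>2 = - complex_of_real ((t / c)\<^sup>2)"
        by (simp add: power_mult_distrib power_divide)
      ultimately show ?thesis by simp
    qed
    then have "exp (complex_of_real (c * x) * (\<i> * complex_of_real (t / c)) - complex_of_real (\<nu> / 2) * (\<i> * complex_of_real (t / c))\<^sup>2)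
        = complex_of_real (exp (\<nu> / 2 * (t / c)\<^sup>2)) * iexp (t * x)"
      by (simp only: exp_add exp_of_real)
    then show ?thesis
      unfolding bargmann_kernel_def G_def K_def c_def[symmetric] C_def by (simp only: of_real_mult mult_ac)
  qed
  have K0: "K t \<noteq> 0" for t
    using C unfolding K_def by (simp only: of_real_eq_0_iff) simp
  have "integrable lebesgue (\<lambda>x. K 0 * (G x * iexp (0 * x)))"
    using bargmann_pairing(1)[OF \<nu> \<beta> f] unfolding k[symmetric] gauss_real_lebesgue(1)[OF km, symmetric] .
  then have "integrable lebesgue (\<lambda>x. inverse (K 0) * (K 0 * (G x * iexp (0 * x))))"
    by (rule integrable_mult_right)
  then have Gi: "integrable lebesgue G"
    by (simp only: mult.assoc[symmetric] left_inverse[OF K0] mult_1_left) simp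
  have "(LINT x|lebesgue. G x * iexp (t * x)) = 0" for t
  proof -
    have "K t * (LINT x|lebesgue. G x * iexp (t * x)) = (LINT x|lebesgue. K t * (G x * iexp (t * x)))"
      by (rule integral_mult_right_zero[symmetric])
    also have "\<dots> = 0"
      unfolding k[symmetric] gauss_real_lebesgue(2)[OF km, symmetric] bargmann_pairing(2)[OF \<nu> \<beta> f] z by simp
    finally show ?thesis
      using K0[of t] by (simp only: mult_eq_0_iff) simp
  qed
  from fourier_eq_imp_zero[OF Gi this] have "AE x in lebesgue. f x = 0"
    by (rule AE_mp) (simp add: G_def)
  moreover have "(\<lambda>x. exp (- \<nu> * x\<^sup>2)) \<in> borel_measurable borel"
    by (intro borel_measurable_continuous_onI continuous_intros)
  then have "(\<lambda>x. exp (- \<nu> * x\<^sup>2)) \<in> borel_measurable lebesgue"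
    by (simp add: measurable_completion)
  ultimately show ?thesis
    unfolding gauss_real_def by (subst AE_density) auto
qed

lemma hermite_fun_orthonormal_sequence:
  assumes "0 < \<nu>" "0 < \<beta>"
  shows "orthonormal_sequence (gauss_real \<nu>) (hermite_fun \<nu> \<beta>)"
  by unfold_locales
    (use assms hermite_fun_L2 hermite_fun_product(2) hermite_fun_total in auto)

section \<open>The kernel and the transform\<close>

lemma entire_family_mult:
  assumes h: "entire_family h" and e: "e holomorphic_on UNIV"
  shows "entire_family (\<lambda>m z. e z * h m z)"
  unfolding entire_family_def
proof (intro conjI allI)
  show "(\<lambda>z. e z * h m z) holomorphic_on UNIV" for m
    using entire_familyD(1)[OF h] e by (intro holomorphic_intros)
  fix R :: real
  obtain M where M: "summable M" "\<And>m z. norm z \<le> R \<Longrightarrow> norm (h m z) \<le> M m"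
    using entire_familyD(2)[OF h, of R] by blast
  have "compact (e ` cball 0 R)"
    using e by (intro compact_continuous_image holomorphic_on_imp_continuous_on)
      (auto intro: holomorphic_on_subset)
  then have "bounded (e ` cball 0 R)"
    by (rule compact_imp_bounded)
  then obtain B where B: "\<And>z. z \<in> cball 0 R \<Longrightarrow> norm (e z) \<le> B"
    unfolding bounded_iff by blast
  have "norm (e z * h m z) \<le> B * M m" if "norm z \<le> R" for m z
    unfolding norm_mult using B[of z] M(2)[OF that, of m] that order_trans[OF norm_ge_zero]
    by (intro mult_mono) auto
  then show "\<exists>M. summable M \<and> (\<forall>m z. norm z \<le> R \<longrightarrow> norm (e z * h m z) \<le> M m)"
    using M(1) by (intro exI[of _ "\<lambda>m. B * M m"] conjI allI impI summable_mult)
qed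

section \<open>Parameter identities and the closed form of the kernel\<close>

lemma nu_pos:
  assumes "0 < s" "s < 1"
  shows "0 < nu s"
proof -
  have "s\<^sup>2 < 1" using assms by (simp add: abs_square_less_1)
  with assms show ?thesis by (simp add: nu_def)
qed

text \<open>Merges exp (- \<alpha> z^2) with the factor exp (- \<nu> z^2 / 2) of the Bargmann kernel
  into the exponent of the closed formula.\<close>

lemma alpha_nu:
  assumes "0 < s"
  shows "alpha s + nu s / 2 = 1 / (2 * s)"
  using assms by (simp add: alpha_def nu_def field_simps power2_eq_square)

lemma hermite_smooth: "smooth (hermite m)"
  by (intro smooth_holomorphic hermite_holomorphic)

lemma fock_basis_smooth: "smooth (fock_basis \<nu> m)"
  unfolding fock_basis_def[abs_def] by (intro smooth_holomorphic holomorphic_intros)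

text \<open>After conjugation, exp (- z^2 / 2) and exp (- (\<alpha> - 1/2) z^2) merge. The power in
  \<open>psi\<close> is u^m, and the two Hermite normalisations supply the denominator of
  \<open>mehler_term\<close>.\<close>

lemma psi_term:
  assumes s: "0 < s" "s < 1"
  defines "u \<equiv> sqrt ((1 - s) / (1 + s))"
  shows "complex_of_real (g_fun (nu s) m x) * psi s m n z
    = complex_of_real ((nu s / pi) powr (1 / 4) * sqrt ((1 - s) / (pi * nu s ^ n * fact n * sqrt s)))
      * exp (- complex_of_real (alpha s) * z\<^sup>2)
      * (nabla (nu s) 0 ^^ n) (\<lambda>w. exp (complex_of_real (alpha s - 1 / 2) * w\<^sup>2)
          * mehler_term u (complex_of_real (sqrt (nu s) * x)) m w) z"
proof -
  let ?\<gamma> = "alpha s - 1 / 2" and ?X = "sqrt (nu s) * x"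
  let ?A = "nabla (nu s) 0 ^^ n" and ?H = "\<lambda>w. exp (complex_of_real ?\<gamma> * w\<^sup>2) * hermite m w"
  have t: "0 < (1 - s) / (1 + s)" using s by simp
  have u: "((1 - s) / (1 + s)) powr (real m / 2) = u ^ m"
  proof -
    have "((1 - s) / (1 + s)) powr (real m / 2) = (((1 - s) / (1 + s)) powr (1 / 2)) powr real m"
      by (simp add: powr_powr)
    also have "\<dots> = u ^ m"
      using t unfolding u_def by (simp add: powr_half_sqrt powr_realpow)
    finally show ?thesis .
  qed
  let ?k = "complex_of_real (u ^ m / (2 ^ m * fact m)) * hermite m (complex_of_real ?X)"
  have sH: "smooth ?H"
    by (intro smooth_mult smooth_exp_square hermite_smooth)
  have "(\<lambda>w. exp (complex_of_real ?\<gamma> * w\<^sup>2) * mehler_term u (complex_of_real ?X) m w) = (\<lambda>w. ?k * ?H w)"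
    by (simp add: mehler_term_def fun_eq_iff)
  then have 1: "?A (\<lambda>w. exp (complex_of_real ?\<gamma> * w\<^sup>2) * mehler_term u (complex_of_real ?X) m w) z = ?k * ?A ?H z"
    by (simp only: nabla_funpow_cmult[OF sH])
  have 2: "(nabla (nu s) ?\<gamma> ^^ n) (hermite m) z = exp (- complex_of_real ?\<gamma> * z\<^sup>2) * ?A ?H z"
    by (rule fun_cong[OF nabla_funpow_conjugate[OF hermite_smooth]])
  have 3: "exp (- z\<^sup>2 / 2) * exp (- complex_of_real ?\<gamma> * z\<^sup>2) = exp (- complex_of_real (alpha s) * z\<^sup>2)"
    by (simp add: algebra_simps flip: exp_add)
  have 4: "1 / (sqrt (2 ^ m * fact m) * sqrt (2 ^ m * fact m)) = 1 / (2 ^ m * fact m)"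
    by simp
  let ?p = "sqrt ((1 - s) / (pi * nu s ^ n * fact n * sqrt s))" and ?r = "sqrt (2 ^ m * fact m)"
  have alg: "complex_of_real (a * (H / r)) * (complex_of_real (p * t) * (E / complex_of_real r) * (E' * A))
      = complex_of_real (a * p) * (E * E') * (complex_of_real (t * (1 / (r * r))) * complex_of_real H * A)"
    for a H r p t :: real and E E' A :: complex
    by (simp add: divide_inverse mult_ac)
  have "complex_of_real (g_fun (nu s) m x) * psi s m n z
      = complex_of_real ((nu s / pi) powr (1 / 4) * ?p) * (exp (- z\<^sup>2 / 2) * exp (- complex_of_real ?\<gamma> * z\<^sup>2))
        * (complex_of_real (u ^ m * (1 / (?r * ?r))) * hermite m (complex_of_real ?X) * ?A ?H z)"
    unfolding psi_def g_fun_def 2 u hermite_of_real by (rule alg)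
  then show ?thesis
    unfolding 1 3 4 by simp
qed

text \<open>Here 1 - u^2 = 2s / (1 + s). In the exponent the cross term becomes sqrt (2 \<beta>
  \<nu>) x w exactly for \<beta> = \<nu>/s, the origin of the second scale; the w^2 terms add up to
  -\<nu>/2 and the x^2 term to -(\<beta> - \<nu>)/2.\<close>

lemma mehler_bargmann:
  assumes s: "0 < s" "s < 1"
  defines "u \<equiv> sqrt ((1 - s) / (1 + s))"
  shows "complex_of_real ((nu s / pi) powr (1 / 4) * sqrt ((1 - s) / (pi * nu s ^ n * fact n * sqrt s)))
      * (exp (complex_of_real (alpha s - 1 / 2) * w\<^sup>2) * mehler u (complex_of_real (sqrt (nu s) * x)) w)
    = complex_of_real (1 / sqrt (nu s ^ n * fact n)) * bargmann_kernel (nu s) (nu s / s) x w"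
proof -
  note \<nu> = nu_pos[OF s]
  have u2: "u\<^sup>2 = (1 - s) / (1 + s)" "0 \<le> u"
    using s by (simp_all add: u_def)
  have u1: "u < 1"
    using s unfolding u_def by (simp add: real_sqrt_lt_1_iff)
  have omu: "1 - u\<^sup>2 = 2 * s / (1 + s)"
    unfolding u2 using s by (simp add: field_simps)
  let ?X = "complex_of_real (sqrt (nu s) * x)" and ?c = "sqrt (2 * (nu s / s) * nu s)"
  have c: "2 * u * sqrt (nu s) / (1 - u\<^sup>2) = ?c"
  proof (rule power2_eq_imp_eq)
    have "(2 * u * sqrt (nu s) / (1 - u\<^sup>2))\<^sup>2 = 4 * u\<^sup>2 * nu s / (2 * s / (1 + s))\<^sup>2"
      unfolding omu[symmetric] using \<nu> by (simp add: power_mult_distrib power_divide)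
    also have "\<dots> = (1 - s) * (1 + s) * nu s / s\<^sup>2"
    proof -
      have "4 * ((1 - s) / t) * nu s / (2 * s / t)\<^sup>2 = (1 - s) * t * nu s / s\<^sup>2" if "t \<noteq> 0" for t
        using that s by (simp add: field_simps power2_eq_square)
      then show ?thesis unfolding u2(1) using s by simp
    qed
    also have "(1 - s) * (1 + s) = 2 * s * nu s"
      using s by (simp add: nu_def field_simps power2_eq_square)
    also have "2 * s * nu s * nu s / s\<^sup>2 = 2 * (nu s / s) * nu s"
      using s by (simp add: power2_eq_square)
    also have "\<dots> = ?c\<^sup>2" using \<nu> s by simp
    finally show "(2 * u * sqrt (nu s) / (1 - u\<^sup>2))\<^sup>2 = ?c\<^sup>2" .
    show "0 \<le> 2 * u * sqrt (nu s) / (1 - u\<^sup>2)"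
      unfolding omu using u2 s \<nu> by simp
  qed (use \<nu> s in simp)
  have q: "u\<^sup>2 / (1 - u\<^sup>2) = (1 - s) / (2 * s)"
  proof -
    have "((1 - s) / t) / (2 * s / t) = (1 - s) / (2 * s)" if "t \<noteq> 0" for t
      using that by simp
    then show ?thesis unfolding omu unfolding u2(1) using s by simp
  qed
  have a: "alpha s - 1 / 2 - (1 - s) / (2 * s) = - (nu s / 2)"
    using s by (simp add: alpha_def nu_def field_simps power2_eq_square)
  have b: "(1 - s) / (2 * s) * nu s = (nu s / s - nu s) / 2"
    using s by (simp add: field_simps)
  have nz: "complex_of_real (1 - u\<^sup>2) \<noteq> 0"
    unfolding omu using s by (simp only: of_real_eq_0_iff) simp
  have "(2 * of_real u * ?X * w - of_real (u\<^sup>2) * (?X\<^sup>2 + w\<^sup>2)) / of_real (1 - u\<^sup>2)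
      = complex_of_real (2 * u * sqrt (nu s) / (1 - u\<^sup>2)) * complex_of_real x * w
        - complex_of_real (u\<^sup>2 / (1 - u\<^sup>2)) * ((complex_of_real (sqrt (nu s)))\<^sup>2 * (complex_of_real x)\<^sup>2 + w\<^sup>2)"
    unfolding of_real_divide using nz by (simp add: divide_simps power_mult_distrib)
  also have "(complex_of_real (sqrt (nu s)))\<^sup>2 = complex_of_real (nu s)"
    using \<nu> by (simp flip: of_real_power)
  also have "complex_of_real (u\<^sup>2 / (1 - u\<^sup>2)) * (complex_of_real (nu s) * (complex_of_real x)\<^sup>2 + w\<^sup>2)
      = complex_of_real ((1 - s) / (2 * s) * nu s * x\<^sup>2) + complex_of_real ((1 - s) / (2 * s)) * w\<^sup>2"
    unfolding q by (simp add: distrib_left)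
  finally have "complex_of_real (alpha s - 1 / 2) * w\<^sup>2 + (2 * of_real u * ?X * w - of_real (u\<^sup>2) * (?X\<^sup>2 + w\<^sup>2)) / of_real (1 - u\<^sup>2)
      = complex_of_real (- ((nu s / s - nu s) / 2) * x\<^sup>2)
        + (complex_of_real (?c * x) * w + complex_of_real (alpha s - 1 / 2 - (1 - s) / (2 * s)) * w\<^sup>2)"
    unfolding c b by (simp add: algebra_simps)
  then have e: "exp (complex_of_real (alpha s - 1 / 2) * w\<^sup>2) * exp ((2 * of_real u * ?X * w - of_real (u\<^sup>2) * (?X\<^sup>2 + w\<^sup>2)) / of_real (1 - u\<^sup>2))
      = complex_of_real (exp (- ((nu s / s - nu s) / 2) * x\<^sup>2)) * exp (complex_of_real (?c * x) * w - complex_of_real (nu s / 2) * w\<^sup>2)"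
    unfolding a exp_add[symmetric] exp_of_real[symmetric] by simp
  have k: "(nu s / pi) powr (1 / 4) * sqrt ((1 - s) / (pi * nu s ^ n * fact n * sqrt s)) * (1 - u\<^sup>2) powr (- 1 / 2)
      = 1 / sqrt (nu s ^ n * fact n) * ((nu s / s / pi) powr (1 / 4) * sqrt (nu s / pi))"
  proof -
    have p: "(1 - u\<^sup>2) powr (- 1 / 2) = sqrt ((1 + s) / (2 * s))"
    proof -
      have "(1 - u\<^sup>2) powr (- 1 / 2) = 1 / (1 - u\<^sup>2) powr (1 / 2)"
        by (simp add: powr_minus_divide)
      also have "\<dots> = sqrt ((1 + s) / (2 * s))"
        unfolding omu using s by (simp add: powr_half_sqrt real_sqrt_divide)
      finally show ?thesis .
    qed
    \<comment> \<open>The nested root in \<open>psi\<close> contributes the quarter power of 1/s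
      that turns (\<nu> / \<pi>)^(1/4) into (\<beta> / \<pi>)^(1/4) for \<beta> = \<nu>/s.\<close>
    have s4: "sqrt (1 / sqrt s) = (1 / s) powr (1 / 4)"
      using s by (simp add: powr_powr powr_divide real_sqrt_divide flip: powr_half_sqrt)
    have "sqrt ((1 - s) / (pi * nu s ^ n * fact n * sqrt s)) * sqrt ((1 + s) / (2 * s))
        = sqrt (1 / (nu s ^ n * fact n) * (nu s / pi) * (1 / sqrt s))"
      unfolding real_sqrt_mult[symmetric]
    proof (rule arg_cong[of _ _ sqrt])
      have n: "(1 - s) * ((1 + s) / (2 * s)) = nu s"
        using s by (simp add: nu_def field_simps power2_eq_square)
      have "(1 - s) / (pi * nu s ^ n * fact n * sqrt s) * ((1 + s) / (2 * s))
          = (1 - s) * ((1 + s) / (2 * s)) / (pi * nu s ^ n * fact n * sqrt s)"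
        by simp
      then show "(1 - s) / (pi * nu s ^ n * fact n * sqrt s) * ((1 + s) / (2 * s))
          = 1 / (nu s ^ n * fact n) * (nu s / pi) * (1 / sqrt s)"
        unfolding n by simp
    qed
    also have "\<dots> = 1 / sqrt (nu s ^ n * fact n) * sqrt (nu s / pi) * (1 / s) powr (1 / 4)"
      unfolding s4[symmetric] by (simp add: real_sqrt_mult real_sqrt_divide)
    finally have "sqrt ((1 - s) / (pi * nu s ^ n * fact n * sqrt s)) * sqrt ((1 + s) / (2 * s))
        = 1 / sqrt (nu s ^ n * fact n) * sqrt (nu s / pi) * (1 / s) powr (1 / 4)" .
    moreover have "(nu s / pi) powr (1 / 4) * (1 / s) powr (1 / 4) = (nu s / s / pi) powr (1 / 4)"
    proof -
      have "(nu s / pi) powr (1 / 4) * (1 / s) powr (1 / 4) = (nu s / pi * (1 / s)) powr (1 / 4)"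
        by (rule powr_mult[symmetric])
      also have "nu s / pi * (1 / s) = nu s / s / pi" by simp
      finally show ?thesis .
    qed
    ultimately show ?thesis
      unfolding p by (simp only: mult.assoc) (simp only: mult_ac)
  qed
  have "complex_of_real ((nu s / pi) powr (1 / 4) * sqrt ((1 - s) / (pi * nu s ^ n * fact n * sqrt s)))
      * (exp (complex_of_real (alpha s - 1 / 2) * w\<^sup>2) * mehler u ?X w)
    = complex_of_real ((nu s / pi) powr (1 / 4) * sqrt ((1 - s) / (pi * nu s ^ n * fact n * sqrt s)) * (1 - u\<^sup>2) powr (- 1 / 2))
      * (exp (complex_of_real (alpha s - 1 / 2) * w\<^sup>2) * exp ((2 * of_real u * ?X * w - of_real (u\<^sup>2) * (?X\<^sup>2 + w\<^sup>2)) / of_real (1 - u\<^sup>2)))"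
    unfolding mehler_formula[OF u2(2) u1] of_real_mult[of _ "(1 - u\<^sup>2) powr (- 1 / 2)"] by (simp only: mult_ac)
  then show ?thesis
    unfolding e k bargmann_kernel_def by (simp only: of_real_mult mult_ac)
qed

lemma bargmann_kernel_smooth: "smooth (bargmann_kernel \<nu> \<beta> x)"
  unfolding bargmann_kernel_def[abs_def] by (intro smooth_holomorphic holomorphic_intros)

lemma S_kernel_sums:
  assumes s: "0 < s" "s < 1"
  shows "(\<lambda>m. complex_of_real (g_fun (nu s) m x) * psi s m n z) sums
    (complex_of_real (1 / sqrt (nu s ^ n * fact n)) * exp (- complex_of_real (alpha s) * z\<^sup>2)
      * (nabla (nu s) 0 ^^ n) (bargmann_kernel (nu s) (nu s / s) x) z)"
proof -
  let ?u = "sqrt ((1 - s) / (1 + s))" and ?X = "complex_of_real (sqrt (nu s) * x)"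
  let ?e = "\<lambda>w. exp (complex_of_real (alpha s - 1 / 2) * w\<^sup>2)"
  let ?P = "complex_of_real ((nu s / pi) powr (1 / 4) * sqrt ((1 - s) / (pi * nu s ^ n * fact n * sqrt s)))"
  let ?A = "nabla (nu s) 0 ^^ n" and ?a = "exp (- complex_of_real (alpha s) * z\<^sup>2)"
  have u: "0 \<le> ?u" "?u < 1"
    using s by (simp_all add: real_sqrt_lt_1_iff)
  note fm = mehler_entire_family[OF u, of ?X]
  have f: "entire_family (\<lambda>m w. ?e w * mehler_term ?u ?X m w)"
    by (intro entire_family_mult fm holomorphic_intros)
  have "(\<lambda>w. \<Sum>m. ?e w * mehler_term ?u ?X m w) = (\<lambda>w. ?e w * mehler ?u ?X w)"
    unfolding mehler_def
    by (intro ext suminf_mult summable_norm_cancel[OF entire_family_summable[OF fm]])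
  then have "(\<lambda>m. ?A (\<lambda>w. ?e w * mehler_term ?u ?X m w) z) sums ?A (\<lambda>w. ?e w * mehler ?u ?X w) z"
    using nabla_funpow_entire_family(2)[OF f, of n "nu s" z]
      summable_sums[OF summable_norm_cancel[OF nabla_funpow_entire_family(1)[OF f, of n "nu s" z]]] by simp
  then have 1: "(\<lambda>m. complex_of_real (g_fun (nu s) m x) * psi s m n z) sums (?P * ?a * ?A (\<lambda>w. ?e w * mehler ?u ?X w) z)"
    unfolding psi_term[OF s] by (rule sums_mult)
  have sm: "smooth (\<lambda>w. ?e w * mehler ?u ?X w)"
    using entire_family_deriv(2)[OF f] \<open>(\<lambda>w. \<Sum>m. ?e w * mehler_term ?u ?X m w) = (\<lambda>w. ?e w * mehler ?u ?X w)\<close>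
    by (intro smooth_holomorphic) simp
  have "?P * ?A (\<lambda>w. ?e w * mehler ?u ?X w) z = ?A (\<lambda>w. ?P * (?e w * mehler ?u ?X w)) z"
    unfolding nabla_funpow_cmult[OF sm] ..
  also have "\<dots> = complex_of_real (1 / sqrt (nu s ^ n * fact n)) * ?A (bargmann_kernel (nu s) (nu s / s) x) z"
    unfolding mehler_bargmann[OF s] nabla_funpow_cmult[OF bargmann_kernel_smooth] ..
  finally have "?P * ?a * ?A (\<lambda>w. ?e w * mehler ?u ?X w) z
      = complex_of_real (1 / sqrt (nu s ^ n * fact n)) * ?a * ?A (bargmann_kernel (nu s) (nu s / s) x) z"
    by (simp only: mult.commute[of _ ?a] mult.assoc)
  with 1 show ?thesis by (simp only:)
qed

lemma S_kernel_eq: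
  assumes s: "0 < s" "s < 1"
  shows "S_kernel s n x z = complex_of_real (1 / sqrt (nu s ^ n * fact n)) * exp (- complex_of_real (alpha s) * z\<^sup>2)
      * (nabla (nu s) 0 ^^ n) (bargmann_kernel (nu s) (nu s / s) x) z"
  unfolding S_kernel_def using S_kernel_sums[OF s] by (rule sums_unique[symmetric])

lemma I_poly_eq:
  "I_poly n \<nu> (- \<nu> / 2) c z = exp (complex_of_real (\<nu> / 2) * z\<^sup>2 - c * z)
    * (nabla \<nu> 0 ^^ n) (\<lambda>w. exp (c * w - complex_of_real (\<nu> / 2) * w\<^sup>2)) z"
proof -
  let ?g = "\<lambda>w. exp (c * w - complex_of_real (\<nu> / 2) * w\<^sup>2)"
  have g: "smooth ?g"
    by (intro smooth_holomorphic holomorphic_intros)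
  have 1: "(\<lambda>w. exp (- complex_of_real (\<nu> * (norm w)\<^sup>2) + complex_of_real (- \<nu> / 2) * w\<^sup>2 + c * w))
      = (\<lambda>w. complex_of_real (exp (- \<nu> * (norm w)\<^sup>2)) * ?g w)"
    by (simp add: fun_eq_iff algebra_simps exp_of_real[symmetric] flip: exp_add)
  have 2: "exp (complex_of_real (\<nu> * (norm z)\<^sup>2) - complex_of_real (- \<nu> / 2) * z\<^sup>2 - c * z) * complex_of_real (exp (- \<nu> * (norm z)\<^sup>2))
      = exp (complex_of_real (\<nu> / 2) * z\<^sup>2 - c * z)"
    by (simp add: exp_of_real[symmetric] flip: exp_add)
  have 3: "(- 1) ^ n * ((- 1) ^ n :: complex) = 1"
    by (simp flip: power_add)
  let ?E = "exp (complex_of_real (\<nu> * (norm z)\<^sup>2) - complex_of_real (- \<nu> / 2) * z\<^sup>2 - c * z)"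
  have "I_poly n \<nu> (- \<nu> / 2) c z = ((- 1) ^ n * (- 1) ^ n) * ((?E * complex_of_real (exp (- \<nu> * (norm z)\<^sup>2))) * (nabla \<nu> 0 ^^ n) ?g z)"
    unfolding I_poly_def 1 wirt_funpow_gauss[OF g] by (simp only: mult_ac)
  then show ?thesis
    unfolding 2 3 by simp
qed

lemma S_kernel_I_poly:
  assumes s: "0 < s" "s < 1"
  shows "S_kernel s n x z =
          complex_of_real ((nu s / (pi * s)) powr (1 / 4)
            * sqrt ((1 - s\<^sup>2) / (2 * pi * s * nu s ^ n * fact n)))
          * exp (- complex_of_real (1 / (2 * s)) * z\<^sup>2
                 - complex_of_real (nu s * (1 - s) / (2 * s) * x\<^sup>2)
                 + complex_of_real (nu s * sqrt (2 * s) / s * x) * z)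
          * I_poly n (nu s) (- nu s / 2) (complex_of_real (nu s * sqrt (2 * s) / s * x)) z"
proof -
  note \<nu> = nu_pos[OF s]
  let ?c = "nu s * sqrt (2 * s) / s"
  let ?g = "\<lambda>w. exp (complex_of_real (?c * x) * w - complex_of_real (nu s / 2) * w\<^sup>2)"
  let ?A = "nabla (nu s) 0 ^^ n"
  have c: "sqrt (2 * (nu s / s) * nu s) = ?c"
  proof -
    have "2 * (nu s / s) * nu s = ?c\<^sup>2"
      using s by (simp add: power_mult_distrib power_divide) (simp add: field_simps power2_eq_square)
    then show ?thesis
      using s \<nu> by (simp add: real_sqrt_unique)
  qed
  have g: "smooth ?g"
    by (intro smooth_holomorphic holomorphic_intros)
  let ?K = "(nu s / s / pi) powr (1 / 4) * sqrt (nu s / pi) * exp (- ((nu s / s - nu s) / 2) * x\<^sup>2)"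
  have "bargmann_kernel (nu s) (nu s / s) x = (\<lambda>w. complex_of_real ?K * ?g w)"
    unfolding bargmann_kernel_def[abs_def] c ..
  then have "?A (bargmann_kernel (nu s) (nu s / s) x) z = complex_of_real ?K * ?A ?g z"
    by (simp only: nabla_funpow_cmult[OF g])
  then have 1: "S_kernel s n x z = complex_of_real (1 / sqrt (nu s ^ n * fact n) * ?K) * exp (- complex_of_real (alpha s) * z\<^sup>2) * ?A ?g z"
    unfolding S_kernel_eq[OF s] of_real_mult[of "1 / sqrt (nu s ^ n * fact n)" ?K] by (simp only: mult_ac)
  have k: "1 / sqrt (nu s ^ n * fact n) * ?K
      = (nu s / (pi * s)) powr (1 / 4) * sqrt ((1 - s\<^sup>2) / (2 * pi * s * nu s ^ n * fact n))
        * exp (- (nu s * (1 - s) / (2 * s) * x\<^sup>2))"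
  proof -
    have "sqrt ((1 - s\<^sup>2) / (2 * pi * s * nu s ^ n * fact n)) = sqrt (1 / (nu s ^ n * fact n) * (nu s / pi))"
    proof (rule arg_cong[of _ _ sqrt])
      have n: "(1 - s\<^sup>2) / (2 * s) = nu s"
        by (simp add: nu_def)
      have "(1 - s\<^sup>2) / (2 * pi * s * nu s ^ n * fact n) = (1 - s\<^sup>2) / (2 * s) / (pi * nu s ^ n * fact n)"
        by simp
      then show "(1 - s\<^sup>2) / (2 * pi * s * nu s ^ n * fact n) = 1 / (nu s ^ n * fact n) * (nu s / pi)"
        unfolding n by simp
    qed
    moreover have "(nu s / s - nu s) / 2 = nu s * (1 - s) / (2 * s)"
      using s by (simp add: field_simps)
    ultimately show ?thesis
      by (simp add: real_sqrt_mult real_sqrt_divide mult.commute[of pi s])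
  qed
  \<comment> \<open>The terms in x z cancel between the prefactor and the exponential of
    \<open>I_poly_eq\<close>; what remains in z^2 is -\<alpha> by \<open>alpha_nu\<close>.\<close>
  have e: "complex_of_real (exp (- (nu s * (1 - s) / (2 * s) * x\<^sup>2))) * exp (- complex_of_real (alpha s) * z\<^sup>2)
      = exp (- complex_of_real (1 / (2 * s)) * z\<^sup>2
                 - complex_of_real (nu s * (1 - s) / (2 * s) * x\<^sup>2)
                 + complex_of_real (?c * x) * z)
        * exp (complex_of_real (nu s / 2) * z\<^sup>2 - complex_of_real (?c * x) * z)"
    unfolding alpha_nu[OF s(1), symmetric] exp_of_real[symmetric] exp_add[symmetric]
    by (rule arg_cong[of _ _ exp]) (simp add: algebra_simps)
  show ?thesis
    unfolding 1 k I_poly_eq of_real_mult[of _ "exp (- (nu s * (1 - s) / (2 * s) * x\<^sup>2))"]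
    using e by (simp only: mult.assoc)
qed

text \<open>Given by coefficients instead of an integral, so that norm and surjectivity come
  directly from the two orthonormal expansions; \<open>bargmann_pairing\<close> identifies it with
  the integral.\<close>

definition bargmann :: "real \<Rightarrow> real \<Rightarrow> (real \<Rightarrow> complex) \<Rightarrow> complex \<Rightarrow> complex" where
  "bargmann \<nu> \<beta> f z = (\<Sum>m. l2_inner (gauss_real \<nu>) f (hermite_fun \<nu> \<beta> m) * fock_basis \<nu> m z)"

lemma bargmann_Fock:
  assumes \<nu>: "0 < \<nu>" and \<beta>: "0 < \<beta>" and f: "f \<in> L2 (gauss_real \<nu>)"
  shows "bargmann \<nu> \<beta> f \<in> Fock \<nu> 0" "fock_norm2 \<nu> (bargmann \<nu> \<beta> f) = l2_sq (gauss_real \<nu>) f"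
proof -
  interpret orthonormal_sequence "gauss_real \<nu>" "hermite_fun \<nu> \<beta>"
    using \<nu> \<beta> by (rule hermite_fun_orthonormal_sequence)
  have b: "bargmann \<nu> \<beta> f = (\<lambda>z. \<Sum>m. l2_inner (gauss_real \<nu>) f (hermite_fun \<nu> \<beta> m) * fock_basis \<nu> m z)"
    by (simp add: bargmann_def fun_eq_iff)
  show "bargmann \<nu> \<beta> f \<in> Fock \<nu> 0"
    unfolding b by (rule fock_synthesis(2)[OF bessel(2)[OF f] \<nu>])
  show "fock_norm2 \<nu> (bargmann \<nu> \<beta> f) = l2_sq (gauss_real \<nu>) f"
    unfolding b fock_synthesis(3)[OF bessel(2)[OF f] \<nu>] parseval[OF f] ..
qed

lemma bargmann_surj:
  assumes \<nu>: "0 < \<nu>" and \<beta>: "0 < \<beta>" and h: "h \<in> Fock \<nu> 0"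
  shows "\<exists>f\<in>L2 (gauss_real \<nu>). bargmann \<nu> \<beta> f = h"
proof -
  interpret orthonormal_sequence "gauss_real \<nu>" "hermite_fun \<nu> \<beta>"
    using \<nu> \<beta> by (rule hermite_fun_orthonormal_sequence)
  obtain c where c: "summable (\<lambda>m. (norm (c m))\<^sup>2)" "h = (\<lambda>z. \<Sum>m. c m * fock_basis \<nu> m z)"
    using fock_analysis[OF h \<nu>] by blast
  obtain f where "f \<in> L2 (gauss_real \<nu>)" "\<And>m. l2_inner (gauss_real \<nu>) f (hermite_fun \<nu> \<beta> m) = c m"
    using riesz_fischer[OF c(1)] by blast
  then show ?thesis
    unfolding c(2) by (intro bexI[of _ f]) (simp_all add: bargmann_def fun_eq_iff)
qed

text \<open>The power of \<open>A\<close> is never moved through the integral. It is applied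
  termwise to the series of the kernel and to that of \<open>bargmann\<close>, and
  \<open>orthonormal_pairing\<close> matches the results.\<close>

lemma S_transform_eq:
  assumes s: "0 < s" "s < 1" and f: "f \<in> L2 (gauss_real (nu s))"
  shows "integrable lebesgue (\<lambda>x. f x * S_kernel s n x z * complex_of_real (exp (- nu s * x\<^sup>2)))"
    and "S_transform s n f z = exp (- complex_of_real (alpha s) * z\<^sup>2)
      * (complex_of_real (1 / sqrt (nu s ^ n * fact n)) * (nabla (nu s) 0 ^^ n) (bargmann (nu s) (nu s / s) f) z)"
proof -
  note \<nu> = nu_pos[OF s]
  have \<beta>: "0 < nu s / s" using \<nu> s by simp
  interpret orthonormal_sequence "gauss_real (nu s)" "hermite_fun (nu s) (nu s / s)"
    using \<nu> \<beta> by (rule hermite_fun_orthonormal_sequence)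
  let ?\<phi> = "hermite_fun (nu s) (nu s / s)" and ?M = "gauss_real (nu s)" and ?e = "fock_basis (nu s)"
  let ?A = "nabla (nu s) 0 ^^ n" and ?k = "complex_of_real (1 / sqrt (nu s ^ n * fact n))"
  let ?a = "exp (- complex_of_real (alpha s) * z\<^sup>2)"
  have tm: "?A (\<lambda>w. c * ?e m w) z = c * ?A (?e m) z" for c m
    unfolding nabla_funpow_cmult[OF fock_basis_smooth] ..
  have fam1: "entire_family ?e"
    using fock_entire_family[OF \<nu>, of "\<lambda>m. 1" 1 1] by simp
  note fam2 = bargmann_entire_family[OF \<nu>, of "nu s / s"]
  note fam3 = fock_synthesis(1)[OF bessel(2)[OF f] \<nu>]
  have K: "?A (bargmann_kernel (nu s) (nu s / s) x) z = (\<Sum>m. cnj (?\<phi> m x) * ?A (?e m) z)" for x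
  proof -
    have "bargmann_kernel (nu s) (nu s / s) x = (\<lambda>w. \<Sum>m. ?\<phi> m x * ?e m w)"
      by (simp add: fun_eq_iff bargmann_kernel_series[OF \<nu> \<beta>])
    then show ?thesis
      unfolding hermite_fun_cnj using nabla_funpow_entire_family(2)[OF fam2[of x], of n "nu s" z]
      unfolding tm by simp
  qed
  have B: "?A (bargmann (nu s) (nu s / s) f) z = (\<Sum>m. l2_inner ?M f (?\<phi> m) * ?A (?e m) z)"
  proof -
    have "bargmann (nu s) (nu s / s) f = (\<lambda>w. \<Sum>m. l2_inner ?M f (?\<phi> m) * ?e m w)"
      by (simp add: fun_eq_iff bargmann_def)
    then show ?thesis
      using nabla_funpow_entire_family(2)[OF fam3, of n "nu s" z] unfolding tm by simp
  qed
  have n: "l2_sq ?M (?\<phi> m) = 1" for m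
    using orthonormal[of m m] unfolding l2_inner_self by simp
  have sm: "summable (\<lambda>m. norm (cnj (?\<phi> m x) * ?A (?e m) z))" for x
    using nabla_funpow_entire_family(1)[OF fam2[of x], of n "nu s" z] unfolding hermite_fun_cnj tm .
  note pair = orthonormal_pairing[OF f in_L2 n nabla_funpow_entire_family(1)[OF fam1] sm, folded K B]
  have S: "f x * S_kernel s n x z = (?k * ?a) * (f x * ?A (bargmann_kernel (nu s) (nu s / s) x) z)" for x
    unfolding S_kernel_eq[OF s] by (simp only: mult_ac)
  have i: "integrable ?M (\<lambda>x. f x * S_kernel s n x z)"
    unfolding S by (intro integrable_mult_right pair(1))
  have m: "(\<lambda>x. f x * S_kernel s n x z) \<in> borel_measurable lebesgue"
    using borel_measurable_integrable[OF i] unfolding gauss_real_measurable .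
  show "integrable lebesgue (\<lambda>x. f x * S_kernel s n x z * complex_of_real (exp (- nu s * x\<^sup>2)))"
    using i unfolding gauss_real_lebesgue(1)[OF m] .
  have "S_transform s n f z = (LINT x|?M. f x * S_kernel s n x z)"
    unfolding S_transform_def gauss_real_lebesgue(2)[OF m] ..
  also have "\<dots> = (?k * ?a) * ?A (bargmann (nu s) (nu s / s) f) z"
    unfolding S integral_mult_right_zero pair(2) ..
  finally show "S_transform s n f z = ?a * (?k * ?A (bargmann (nu s) (nu s / s) f) z)"
    by (simp only: mult_ac)
qed

section \<open>Transfer to the weight \<open>omega\<close>\<close>

lemma omega_measure_continuous:
  fixes f :: "complex \<Rightarrow> 'a::{banach, second_countable_topology}"
  assumes "continuous_on UNIV f"
  shows "integrable (omega_measure s) f \<longleftrightarrow> integrable lborel (\<lambda>z. omega s z *\<^sub>R f z)"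
    and "(LINT z|omega_measure s. f z) = (LINT z|lborel. omega s z *\<^sub>R f z)"
  unfolding omega_measure_def omega_def
  by (intro density_lebesgue_continuous assms continuous_intros; simp)+

text \<open>The squared modulus of exp (- \<alpha> z^2) cancels the factor of \<open>omega\<close>
  that contains \<alpha>, leaving the Gaussian weight.\<close>

lemma Fock_omega:
  assumes F: "F \<in> Fock (nu s) n"
  shows "(\<lambda>z. exp (- complex_of_real (alpha s) * z\<^sup>2) * F z) \<in> L2 (omega_measure s)"
    and "l2_norm (omega_measure s) (\<lambda>z. exp (- complex_of_real (alpha s) * z\<^sup>2) * F z) = sqrt (fock_norm2 (nu s) F)"
proof -
  let ?g = "\<lambda>z. exp (- complex_of_real (alpha s) * z\<^sup>2) * F z"
  have sF: "smooth F" and iF: "integrable lborel (\<lambda>z. (norm (F z))\<^sup>2 * gauss (nu s) z)"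
    using F by (auto simp: Fock_iff)
  have g: "continuous_on UNIV ?g"
    using smooth_continuous[OF sF] by (intro continuous_intros)
  have g2: "continuous_on UNIV (\<lambda>z. (norm (?g z))\<^sup>2)"
    using smooth_continuous[OF sF] by (intro continuous_intros)
  have e: "omega s z *\<^sub>R (norm (?g z))\<^sup>2 = (norm (F z))\<^sup>2 * gauss (nu s) z" for z
  proof -
    have "Re (z\<^sup>2 + (cnj z)\<^sup>2) = 2 * Re (z\<^sup>2)"
      by (simp flip: complex_cnj_power)
    moreover have "(norm (exp (- complex_of_real (alpha s) * z\<^sup>2)))\<^sup>2 = exp (- 2 * alpha s * Re (z\<^sup>2))"
      by (simp add: norm_exp_eq_Re power2_eq_square flip: exp_add)
    moreover have "exp (a * (2 * r) - v * t) * (exp (- 2 * a * r) * N) = N * exp (- v * t)" for a r v t N :: real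
      by (simp add: exp_diff exp_minus field_simps)
    ultimately show ?thesis
      unfolding omega_def gauss_def norm_mult power_mult_distrib real_scaleR_def by (simp only:)
  qed
  have "?g \<in> borel_measurable (omega_measure s)"
    unfolding omega_measure_def using g by (intro density_lebesgue_measurable borel_measurable_continuous_onI)
  then show "?g \<in> L2 (omega_measure s)"
    unfolding L2_def using omega_measure_continuous(1)[OF g2, of s] iF unfolding e by blast
  show "l2_norm (omega_measure s) ?g = sqrt (fock_norm2 (nu s) F)"
    unfolding l2_norm_eq l2_sq_def omega_measure_continuous(2)[OF g2] e fock_norm2_def ..
qed

lemma fock_norm2_cmult: "fock_norm2 \<nu> (\<lambda>z. c * F z) = (norm c)\<^sup>2 * fock_norm2 \<nu> F"
  by (simp add: fock_norm2_def norm_mult power_mult_distrib mult.assoc)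

text \<open>Summability and integrability are asserted explicitly, since divergent series and
  non-integrable integrands also denote values. An isometry onto is spelled out as linearity,
  preservation of norms and equality of the image.\<close>

theorem theorem3p7:
  fixes s :: real and n :: nat
  assumes "0 < s" and "s < 1"
  shows
    "(\<forall>(x::real) (z::complex).
        summable (\<lambda>m. complex_of_real (g_fun (nu s) m x) * psi s m n z) \<and>
        S_kernel s n x z =
          complex_of_real ((nu s / (pi * s)) powr (1 / 4)
            * sqrt ((1 - s\<^sup>2) / (2 * pi * s * nu s ^ n * fact n)))
          * exp (- complex_of_real (1 / (2 * s)) * z\<^sup>2
                 - complex_of_real (nu s * (1 - s) / (2 * s) * x\<^sup>2)
                 + complex_of_real (nu s * sqrt (2 * s) / s * x) * z)
          * I_poly n (nu s) (- nu s / 2) (complex_of_real (nu s * sqrt (2 * s) / s * x)) z)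
     \<and> (\<forall>f \<in> L2 (gauss_real (nu s)). \<forall>z.
          integrable lebesgue
            (\<lambda>x. f x * S_kernel s n x z * complex_of_real (exp (- nu s * x\<^sup>2))))
     \<and> (\<forall>f \<in> L2 (gauss_real (nu s)). \<forall>g \<in> L2 (gauss_real (nu s)).
          S_transform s n (\<lambda>x. f x + g x) = (\<lambda>z. S_transform s n f z + S_transform s n g z))
     \<and> (\<forall>c::complex. \<forall>f \<in> L2 (gauss_real (nu s)).
          S_transform s n (\<lambda>x. c * f x) = (\<lambda>z. c * S_transform s n f z))
     \<and> X_space n s \<subseteq> L2 (omega_measure s)
     \<and> (\<forall>f \<in> L2 (gauss_real (nu s)).
          l2_norm (omega_measure s) (S_transform s n f) = l2_norm (gauss_real (nu s)) f)
     \<and> S_transform s n ` L2 (gauss_real (nu s)) = X_space n s"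
proof -
  note s = assms
  note \<nu> = nu_pos[OF s]
  have \<beta>: "0 < nu s / s" using \<nu> s by simp
  let ?M = "gauss_real (nu s)" and ?B = "bargmann (nu s) (nu s / s)"
  let ?k = "complex_of_real (1 / sqrt (nu s ^ n * fact n))"
  let ?F = "\<lambda>f z. ?k * (nabla (nu s) 0 ^^ n) (?B f) z"
  have c: "sqrt (nu s ^ n * fact n) > 0" using \<nu> by simp
  have kernel: "summable (\<lambda>m. complex_of_real (g_fun (nu s) m x) * psi s m n z)" for x z
    using S_kernel_sums[OF s] by (rule sums_summable)
  have int: "integrable lebesgue (\<lambda>x. f x * S_kernel s n x z * complex_of_real (exp (- nu s * x\<^sup>2)))"
    if "f \<in> L2 ?M" for f z
    by (rule S_transform_eq(1)[OF s that])
  have add: "S_transform s n (\<lambda>x. f x + g x) = (\<lambda>z. S_transform s n f z + S_transform s n g z)"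
    if "f \<in> L2 ?M" "g \<in> L2 ?M" for f g
    unfolding S_transform_def distrib_right
    by (rule ext) (rule Bochner_Integration.integral_add[OF int[OF that(1)] int[OF that(2)]])
  have cmult: "S_transform s n (\<lambda>x. c * f x) = (\<lambda>z. c * S_transform s n f z)" for c f
    unfolding S_transform_def mult.assoc by (rule ext) (rule integral_mult_right_zero)
  have X: "X_space n s \<subseteq> L2 (omega_measure s)"
    unfolding X_space_def using Fock_omega(1) by blast
  have S: "S_transform s n f = (\<lambda>z. exp (- complex_of_real (alpha s) * z\<^sup>2) * ?F f z)" if "f \<in> L2 ?M" for f
    using S_transform_eq(2)[OF s that] by (rule ext)
  have FF: "?F f \<in> Fock (nu s) n" "fock_norm2 (nu s) (?F f) = l2_sq ?M f" if f: "f \<in> L2 ?M" for f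
  proof -
    note A = Fock_funpow[OF bargmann_Fock(1)[OF \<nu> \<beta> f] \<nu>, of n]
    show "?F f \<in> Fock (nu s) n"
      using A by (intro Fock_cmult) blast
    have "(norm ?k)\<^sup>2 * (fact n * nu s ^ n) = 1"
      using \<nu> by (simp add: norm_divide power_divide)
    then show "fock_norm2 (nu s) (?F f) = l2_sq ?M f"
      unfolding fock_norm2_cmult using A bargmann_Fock(2)[OF \<nu> \<beta> f]
      by (simp only: mult.assoc[symmetric] mult_1_left)
  qed
  have iso: "l2_norm (omega_measure s) (S_transform s n f) = l2_norm ?M f" if "f \<in> L2 ?M" for f
    unfolding S[OF that] Fock_omega(2)[OF FF(1)[OF that]] FF(2)[OF that] unfolding l2_norm_eq ..
  have "S_transform s n ` L2 ?M = X_space n s"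
  proof
    show "S_transform s n ` L2 ?M \<subseteq> X_space n s"
    proof (rule image_subsetI)
      fix f assume f: "f \<in> L2 ?M"
      show "S_transform s n f \<in> X_space n s"
        unfolding X_space_def S[OF f] by (intro CollectI exI[of _ "?F f"] conjI refl FF(1)[OF f])
    qed
    show "X_space n s \<subseteq> S_transform s n ` L2 ?M"
    proof
      fix G assume "G \<in> X_space n s"
      then obtain F where F: "F \<in> Fock (nu s) n" "G = (\<lambda>z. exp (- complex_of_real (alpha s) * z\<^sup>2) * F z)"
        unfolding X_space_def by blast
      obtain h where h: "h \<in> Fock (nu s) 0" "F = (nabla (nu s) 0 ^^ n) h"
        using Fock_surj[OF F(1) \<nu>] by blast
      \<comment> \<open>This scaling of \<open>h\<close> undoes the normalisation of the
        kernel.\<close>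
      let ?r = "complex_of_real (sqrt (nu s ^ n * fact n))"
      obtain f where f: "f \<in> L2 ?M" "?B f = (\<lambda>z. ?r * h z)"
        using bargmann_surj[OF \<nu> \<beta> Fock_cmult[OF h(1)]] by blast
      have sh: "smooth h" using h by (simp add: Fock_iff)
      have "1 / r * r = 1" if "r > 0" for r :: real
        using that by simp
      from this[OF c] have "?k * ?r = 1"
        unfolding of_real_mult[symmetric] by (simp only: of_real_1)
      then have "?F f z = F z" for z
        unfolding f(2) nabla_funpow_cmult[OF sh] h(2) mult.assoc[symmetric] by simp
      then have "G = S_transform s n f"
        unfolding F(2) S[OF f(1)] by (simp only:)
      with f(1) show "G \<in> S_transform s n ` L2 ?M" by blast
    qed
  qed
  then show ?thesis
    by (intro conjI allI ballI kernel S_kernel_I_poly[OF s] int add cmult X iso)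
qed

end
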